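(* Let $\mathcal{A}$ be an accessible category with filtered colimits, $\mathcal{B}$ a finitely accessible category and $F:\mathcal{A}\to\mathcal{B}$ a functor preserving filtered colimits. Let $X\in\mathcal{B}$ be an object with $\max\{\mu_F,\operatorname{card}(\operatorname{fp}\mathcal{B})\}<\|X\|$. Assume (i) $\|X\|$ is a singular cardinal; (ii) there exists a cardinal $\phi_{F,X}<\|X\|$ such that for all regular $\kappa$ with $\phi_{F,X}<\kappa<\|X\|$, the image of $F$ contains a dense $\kappa$-filter of $\operatorname{Sub}(X)$; (iii) $F$-structures extend along morphisms. Then $X$ is in the image of $F$.
   Context: Size: for an object $X$ of an accessible category $\mathcal{C}$, $\operatorname{rank}(X)=\min\{\kappa \mid X \text{ is } \kappa\text{-presentable}\}$ ($\kappa$ ranging over regular cardinals). Let $\mathcal{C}$ be accessible with filtered colimits and let $\lambda$ be the least cardinal such that $\mathcal{C}$ is $\lambda$-accessible. If $\operatorname{rank}(X)>\lambda$ then $\operatorname{rank}(X)$ is a successor cardinal, and $\|X\|$ denotes the cardinal predecessor of $\operatorname{rank}(X)$ (otherwise $\|X\|$ is undefined). Rank of accessibility: for a functor $F:\mathcal{A}\to\mathcal{B}$ preserving filtered colimits between accessible categories with filtered colimits, $\mu_F$ is the least cardinal such that $\mathcal{A}$ and $\mathcal{B}$ are $\mu_F$-accessible and for all regular $\lambda\geq\mu_F$, $F$ takes $\lambda$-presentable objects to $\lambda$-presentable objects. For a finitely accessible category $\mathcal{B}$, $\operatorname{fp}\mathcal{B}$ is the full subcategory formed by one representative from each isomorphism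 class of finitely presentable objects. For a small category $\mathcal{C}$, $\operatorname{card}(\mathcal{C})$ is the greater of $\aleph_0$ and the cardinality of the set of morphisms of $\mathcal{C}$. Image: an object $X\in\mathcal{B}$ is in the image of $F$ if $X\cong F(U)$ for some $U\in\mathcal{A}$. $F$-structures extend along morphisms: given any morphism $g:X\to Y$ and object $U$ of $\mathcal{A}$, together with an isomorphism $i:F(U)\to F(X)$ in $\mathcal{B}$, there exist a morphism $f:U\to V$ in $\mathcal{A}$ and an isomorphism $j:F(V)\to F(Y)$ such that $j\circ F(f)=F(g)\circ i$. Subobjects and filters: $\operatorname{Sub}(X)$ is the full subcategory of the slice category over $X$ whose objects are monomorphisms into $X$; for $U,V\in\operatorname{Sub}(X)$, $U$ contains $V$, written $V\rightarrowtail U$, if there is a (necessarily unique and monic) morphism $V\to U$ in $\operatorname{Sub}(X)$. For $\kappa$ regular, a $\kappa$-filter of $\operatorname{Sub}(X)$ is a full subcategory $\mathcal{F}\subseteq\operatorname{Sub}(X)$ such that for every directed system $\mathcal{D}\to\mathcal{F}$ with $\operatorname{card}(\mathcal{D})\leq\kappa$ taking values in objects $U\in\mathcal{F}$ with $U$ $\kappa$-presentable, the colimit of $\mathcal{D}$ exists and belongs to $\mathcal{F}$. It is dense if for every $\kappa$-presentable $S\in\operatorname{Sub}(X)$ there exists a $\kappa$-presentable $U\in\mathcal{F}$ with $S\rightarrowtail U$. The image of $F$ contains a dense $\kappa$-filter of $\operatorname{Sub}(X)$ if there is a dense $\kappa$-filter $\mathcal{F}\subseteq\operatorname{Sub}(X)$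 such that every $U\in\mathcal{F}$ is in the image of $F$. *)

theory Defs
  imports Main "HOL-Library.FuncSet"
begin

unbundle cardinal_syntax

text \<open>
  Set-theoretic conventions.  The sets of the metatheory are modelled by a type \<open>'u\<close> whose
  cardinality is strongly inaccessible: a set (over any type) is small if it has fewer elements
  than \<open>'u\<close>, and up to isomorphism every small category has its objects and arrows in \<open>'u\<close>.
  Categories may have arbitrarily many objects, over arbitrary types, but those called
  accessible are locally small.  (Small) cardinals are cardinal orders \<open>\<kappa> :: 'u rel\<close>, taken up to
  \<open>=o\<close>; in notions that mention no cardinal the type \<open>'u\<close> is passed as \<open>TYPE('u)\<close>.
\<close>

definition inaccessible_type :: "'u itself \<Rightarrow> bool" where
  "inaccessible_type _ \<longleftrightarrow>
     natLeq <o |UNIV :: 'u set| \<and>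
     regularCard |UNIV :: 'u set| \<and>
     (\<forall>S :: 'u set. |S| <o |UNIV :: 'u set| \<longrightarrow> |Pow S| <o |UNIV :: 'u set| )"

definition regular_cardinal :: "'u rel \<Rightarrow> bool" where
  "regular_cardinal \<kappa> \<longleftrightarrow> Cinfinite \<kappa> \<and> regularCard \<kappa> \<and> \<kappa> <o |UNIV :: 'u set|"

definition singular_cardinal :: "'u rel \<Rightarrow> bool" where
  "singular_cardinal \<kappa> \<longleftrightarrow> Cinfinite \<kappa> \<and> \<not> regularCard \<kappa>"

definition aleph0 :: "'u rel" where
  "aleph0 = (SOME r. r =o natLeq)"

definition least_cardinal :: "('u rel \<Rightarrow> bool) \<Rightarrow> 'u rel \<Rightarrow> bool" where
  "least_cardinal P \<kappa> \<longleftrightarrow> Card_order \<kappa> \<and> P \<kappa> \<and> (\<forall>\<kappa>'. Card_order \<kappa>' \<and> P \<kappa>' \<longrightarrow> \<kappa> \<le>o \<kappa>')"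


section \<open>Categories and functors\<close>

record ('o, 'a) cat =
  Obj :: "'o set"
  Arr :: "'a set"
  Dom :: "'a \<Rightarrow> 'o"
  Cod :: "'a \<Rightarrow> 'o"
  Id :: "'o \<Rightarrow> 'a"
  Comp :: "'a \<Rightarrow> 'a \<Rightarrow> 'a"  \<comment> \<open>\<open>Comp C g f\<close> is \<open>g\<close> after \<open>f\<close>\<close>

definition hom :: "('o, 'a) cat \<Rightarrow> 'o \<Rightarrow> 'o \<Rightarrow> 'a set" where
  "hom C x y = {f \<in> Arr C. Dom C f = x \<and> Cod C f = y}"

locale category =
  fixes C :: "('o, 'a) cat"
  assumes dom_obj: "f \<in> Arr C \<Longrightarrow> Dom C f \<in> Obj C"
    and cod_obj: "f \<in> Arr C \<Longrightarrow> Cod C f \<in> Obj C"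
    and id_hom: "x \<in> Obj C \<Longrightarrow> Id C x \<in> hom C x x"
    and comp_hom: "f \<in> hom C x y \<Longrightarrow> g \<in> hom C y z \<Longrightarrow> Comp C g f \<in> hom C x z"
    and comp_id: "f \<in> hom C x y \<Longrightarrow> Comp C f (Id C x) = f"
    and id_comp: "f \<in> hom C x y \<Longrightarrow> Comp C (Id C y) f = f"
    and comp_assoc: "f \<in> hom C w x \<Longrightarrow> g \<in> hom C x y \<Longrightarrow> h \<in> hom C y z \<Longrightarrow>
      Comp C h (Comp C g f) = Comp C (Comp C h g) f"

definition monomorphism :: "('o, 'a) cat \<Rightarrow> 'a \<Rightarrow> bool" where
  "monomorphism C m \<longleftrightarrow> m \<in> Arr C \<and>
     (\<forall>x. \<forall>f \<in> hom C x (Dom C m). \<forall>g \<in> hom C x (Dom C m). Comp C m f = Comp C m g \<longrightarrow> f = g)"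

definition isomorphism :: "('o, 'a) cat \<Rightarrow> 'a \<Rightarrow> bool" where
  "isomorphism C f \<longleftrightarrow> f \<in> Arr C \<and>
     (\<exists>g \<in> hom C (Cod C f) (Dom C f).
        Comp C g f = Id C (Dom C f) \<and> Comp C f g = Id C (Cod C f))"

definition isomorphic :: "('o, 'a) cat \<Rightarrow> 'o \<Rightarrow> 'o \<Rightarrow> bool" where
  "isomorphic C x y \<longleftrightarrow> (\<exists>f \<in> hom C x y. isomorphism C f)"

definition full_subcategory :: "('o, 'a) cat \<Rightarrow> 'o set \<Rightarrow> ('o, 'a) cat" where
  "full_subcategory C S =
     C\<lparr>Obj := Obj C \<inter> S, Arr := {f \<in> Arr C. Dom C f \<in> S \<and> Cod C f \<in> S}\<rparr>"

text \<open>The sum with \<open>\<aleph>\<^sub>0\<close> is the maximum with \<open>\<aleph>\<^sub>0\<close>.\<close>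

definition cat_card :: "('o, 'a) cat \<Rightarrow> ('a + nat) rel" where
  "cat_card C = |Arr C| +c natLeq"

record ('o, 'a, 'p, 'b) func =
  OMap :: "'o \<Rightarrow> 'p"
  AMap :: "'a \<Rightarrow> 'b"

locale is_functor = A: category A + B: category B
  for A :: "('o, 'a) cat" and B :: "('p, 'b) cat" +
  fixes F :: "('o, 'a, 'p, 'b) func"
  assumes omap_obj: "x \<in> Obj A \<Longrightarrow> OMap F x \<in> Obj B"
    and amap_hom: "f \<in> hom A x y \<Longrightarrow> AMap F f \<in> hom B (OMap F x) (OMap F y)"
    and amap_id: "x \<in> Obj A \<Longrightarrow> AMap F (Id A x) = Id B (OMap F x)"
    and amap_comp: "f \<in> hom A x y \<Longrightarrow> g \<in> hom A y z \<Longrightarrow>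
      AMap F (Comp A g f) = Comp B (AMap F g) (AMap F f)"

definition func_comp ::
  "('p, 'b, 'q, 'c) func \<Rightarrow> ('o, 'a, 'p, 'b) func \<Rightarrow> ('o, 'a, 'q, 'c) func" where
  "func_comp G F = \<lparr>OMap = OMap G \<circ> OMap F, AMap = AMap G \<circ> AMap F\<rparr>"

definition in_image ::
  "('o, 'a) cat \<Rightarrow> ('p, 'b) cat \<Rightarrow> ('o, 'a, 'p, 'b) func \<Rightarrow> 'p \<Rightarrow> bool" where
  "in_image A B F X \<longleftrightarrow> (\<exists>U \<in> Obj A. isomorphic B X (OMap F U))"

definition structures_extend_along_morphisms ::
  "('o, 'a) cat \<Rightarrow> ('p, 'b) cat \<Rightarrow> ('o, 'a, 'p, 'b) func \<Rightarrow> bool" where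
  "structures_extend_along_morphisms A B F \<longleftrightarrow>
     (\<forall>X Y U g i. U \<in> Obj A \<and> g \<in> hom A X Y \<and>
        i \<in> hom B (OMap F U) (OMap F X) \<and> isomorphism B i \<longrightarrow>
        (\<exists>V f j. f \<in> hom A U V \<and>
           j \<in> hom B (OMap F V) (OMap F Y) \<and> isomorphism B j \<and>
           Comp B j (AMap F f) = Comp B (AMap F g) i))"


section \<open>Filtered colimits\<close>

definition cocone ::
  "('o, 'a) cat \<Rightarrow> ('i, 'e) cat \<Rightarrow> ('i, 'e, 'o, 'a) func \<Rightarrow> 'o \<Rightarrow> ('i \<Rightarrow> 'a) \<Rightarrow> bool" where
  "cocone C J D L \<iota> \<longleftrightarrow> L \<in> Obj C \<and>
     (\<forall>j \<in> Obj J. \<iota> j \<in> hom C (OMap D j) L) \<and>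
     (\<forall>u \<in> Arr J. Comp C (\<iota> (Cod J u)) (AMap D u) = \<iota> (Dom J u))"

definition is_colimit ::
  "('o, 'a) cat \<Rightarrow> ('i, 'e) cat \<Rightarrow> ('i, 'e, 'o, 'a) func \<Rightarrow> 'o \<Rightarrow> ('i \<Rightarrow> 'a) \<Rightarrow> bool" where
  "is_colimit C J D L \<iota> \<longleftrightarrow> cocone C J D L \<iota> \<and>
     (\<forall>M \<tau>. cocone C J D M \<tau> \<longrightarrow>
        (\<exists>!h. h \<in> hom C L M \<and> (\<forall>j \<in> Obj J. Comp C h (\<iota> j) = \<tau> j)))"

definition small_category :: "('u, 'u) cat \<Rightarrow> bool" where
  "small_category J \<longleftrightarrow> category J \<and> |Arr J| <o |UNIV :: 'u set|"

definition filtered :: "'u rel \<Rightarrow> ('u, 'u) cat \<Rightarrow> bool" where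
  "filtered \<kappa> J \<longleftrightarrow>
     (\<forall>(K :: ('u, 'u) cat) D. is_functor K J D \<and> |Arr K| <o \<kappa> \<longrightarrow> (\<exists>L \<iota>. cocone J K D L \<iota>))"

definition filtered_diagram ::
  "'u rel \<Rightarrow> ('o, 'a) cat \<Rightarrow> ('u, 'u) cat \<Rightarrow> ('u, 'u, 'o, 'a) func \<Rightarrow> bool" where
  "filtered_diagram \<kappa> C J D \<longleftrightarrow> small_category J \<and> filtered \<kappa> J \<and> is_functor J C D"

definition has_filtered_colimits_at :: "'u rel \<Rightarrow> ('o, 'a) cat \<Rightarrow> bool" where
  "has_filtered_colimits_at \<kappa> C \<longleftrightarrow>
     (\<forall>J D. filtered_diagram \<kappa> C J D \<longrightarrow> (\<exists>L \<iota>. is_colimit C J D L \<iota>))"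

definition has_filtered_colimits :: "'u itself \<Rightarrow> ('o, 'a) cat \<Rightarrow> bool" where
  "has_filtered_colimits _ C \<longleftrightarrow> has_filtered_colimits_at (aleph0 :: 'u rel) C"

definition preserves_filtered_colimits ::
  "'u itself \<Rightarrow> ('o, 'a) cat \<Rightarrow> ('p, 'b) cat \<Rightarrow> ('o, 'a, 'p, 'b) func \<Rightarrow> bool" where
  "preserves_filtered_colimits _ A B F \<longleftrightarrow>
     (\<forall>J D L \<iota>. filtered_diagram (aleph0 :: 'u rel) A J D \<and> is_colimit A J D L \<iota> \<longrightarrow>
        is_colimit B J (func_comp F D) (OMap F L) (\<lambda>j. AMap F (\<iota> j)))"


section \<open>Presentable objects and accessible categories\<close>

text \<open>
  The maps \<open>hom(X, D j) \<rightarrow> hom(X, L)\<close> given by postcomposition with \<open>\<iota> j\<close> form a colimit cocone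
  in the category of small sets.  As test objects it suffices to take the small subsets \<open>T\<close> of
  \<open>'u\<close>, every small set being in bijection with one of these.
\<close>

definition hom_preserves_colimit ::
  "('o, 'a) cat \<Rightarrow> 'o \<Rightarrow> ('u, 'u) cat \<Rightarrow> ('u, 'u, 'o, 'a) func \<Rightarrow> 'o \<Rightarrow> ('u \<Rightarrow> 'a) \<Rightarrow> bool" where
  "hom_preserves_colimit C X J D L \<iota> \<longleftrightarrow>
     (\<forall>(T :: 'u set) t. |T| <o |UNIV :: 'u set| \<and>
        (\<forall>j \<in> Obj J. t j \<in> hom C X (OMap D j) \<rightarrow> T) \<and>
        (\<forall>u \<in> Arr J. \<forall>g \<in> hom C X (OMap D (Dom J u)).
           t (Cod J u) (Comp C (AMap D u) g) = t (Dom J u) g) \<longrightarrow>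
        (\<exists>!h. h \<in> hom C X L \<rightarrow>\<^sub>E T \<and>
           (\<forall>j \<in> Obj J. \<forall>g \<in> hom C X (OMap D j). h (Comp C (\<iota> j) g) = t j g)))"

definition presentable :: "'u rel \<Rightarrow> ('o, 'a) cat \<Rightarrow> 'o \<Rightarrow> bool" where
  "presentable \<kappa> C X \<longleftrightarrow> regular_cardinal \<kappa> \<and> X \<in> Obj C \<and>
     (\<forall>J D L \<iota>. filtered_diagram \<kappa> C J D \<and> is_colimit C J D L \<iota> \<longrightarrow>
        hom_preserves_colimit C X J D L \<iota>)"

definition accessible_at :: "'u rel \<Rightarrow> ('o, 'a) cat \<Rightarrow> bool" where
  "accessible_at \<kappa> C \<longleftrightarrow> regular_cardinal \<kappa> \<and> category C \<and>
     (\<forall>x \<in> Obj C. \<forall>y \<in> Obj C. |hom C x y| <o |UNIV :: 'u set| ) \<and>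
     has_filtered_colimits_at \<kappa> C \<and>
     (\<exists>S. |S| <o |UNIV :: 'u set| \<and> (\<forall>s \<in> S. presentable \<kappa> C s) \<and>
        (\<forall>X \<in> Obj C. \<exists>J D \<iota>. filtered_diagram \<kappa> C J D \<and> OMap D ` Obj J \<subseteq> S \<and>
           is_colimit C J D X \<iota>))"

definition accessible :: "'u itself \<Rightarrow> ('o, 'a) cat \<Rightarrow> bool" where
  "accessible _ C \<longleftrightarrow> (\<exists>\<kappa> :: 'u rel. accessible_at \<kappa> C)"

definition finitely_accessible :: "'u itself \<Rightarrow> ('o, 'a) cat \<Rightarrow> bool" where
  "finitely_accessible _ C \<longleftrightarrow> accessible_at (aleph0 :: 'u rel) C"

definition finitely_presentable :: "'u itself \<Rightarrow> ('o, 'a) cat \<Rightarrow> 'o \<Rightarrow> bool" where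
  "finitely_presentable _ C X \<longleftrightarrow> presentable (aleph0 :: 'u rel) C X"

text \<open>Isomorphic objects \<open>X\<close> yield the same chosen representative \<open>SOME Y. isomorphic C X Y\<close>.\<close>

definition fp :: "'u itself \<Rightarrow> ('o, 'a) cat \<Rightarrow> ('o, 'a) cat" where
  "fp u C = full_subcategory C
     ((\<lambda>X. SOME Y. isomorphic C X Y) ` {X. finitely_presentable u C X})"

definition is_rank :: "('o, 'a) cat \<Rightarrow> 'o \<Rightarrow> 'u rel \<Rightarrow> bool" where
  "is_rank C X \<rho> \<longleftrightarrow> least_cardinal (\<lambda>\<kappa>. presentable \<kappa> C X) \<rho>"

text \<open>\<open>is_size C X \<nu>\<close>: the size of \<open>X\<close> is defined and equals \<open>\<nu>\<close>.\<close>

definition is_size :: "('o, 'a) cat \<Rightarrow> 'o \<Rightarrow> 'u rel \<Rightarrow> bool" where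
  "is_size C X \<nu> \<longleftrightarrow> Card_order \<nu> \<and>
     (\<exists>(\<theta> :: 'u rel) (\<rho> :: 'u rel).
        least_cardinal (\<lambda>\<kappa>. accessible_at \<kappa> C) \<theta> \<and> is_rank C X \<rho> \<and> \<theta> <o \<rho> \<and> \<rho> =o cardSuc \<nu>)"

definition is_rank_of_accessibility ::
  "('o, 'a) cat \<Rightarrow> ('p, 'b) cat \<Rightarrow> ('o, 'a, 'p, 'b) func \<Rightarrow> 'u rel \<Rightarrow> bool" where
  "is_rank_of_accessibility A B F \<mu> \<longleftrightarrow>
     least_cardinal (\<lambda>\<kappa>. accessible_at \<kappa> A \<and> accessible_at \<kappa> B \<and>
       (\<forall>\<theta> :: 'u rel. regular_cardinal \<theta> \<and> \<kappa> \<le>o \<theta> \<longrightarrow>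
          (\<forall>U. presentable \<theta> A U \<longrightarrow> presentable \<theta> B (OMap F U)))) \<mu>"


section \<open>Subobjects and filters\<close>

text \<open>A morphism from \<open>v\<close> to \<open>w\<close> in the slice over \<open>X\<close> is a triple \<open>(v, h, w)\<close> with \<open>w \<circ> h = v\<close>.\<close>

definition slice :: "('o, 'a) cat \<Rightarrow> 'o \<Rightarrow> ('a, 'a \<times> 'a \<times> 'a) cat" where
  "slice C X =
     \<lparr>Obj = {v \<in> Arr C. Cod C v = X},
      Arr = {(v, h, w). v \<in> Arr C \<and> Cod C v = X \<and> w \<in> Arr C \<and> Cod C w = X \<and>
               h \<in> hom C (Dom C v) (Dom C w) \<and> Comp C w h = v},
      Dom = (\<lambda>(v, h, w). v),
      Cod = (\<lambda>(v, h, w). w),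
      Id = (\<lambda>v. (v, Id C (Dom C v), v)),
      Comp = (\<lambda>(v', h', w') (v, h, w). (v, Comp C h' h, w'))\<rparr>"

definition Sub :: "('o, 'a) cat \<Rightarrow> 'o \<Rightarrow> ('a, 'a \<times> 'a \<times> 'a) cat" where
  "Sub C X = full_subcategory (slice C X) {m. monomorphism C m}"

definition contains :: "('o, 'a) cat \<Rightarrow> 'o \<Rightarrow> 'a \<Rightarrow> 'a \<Rightarrow> bool" where
  "contains C X U V \<longleftrightarrow> hom (Sub C X) V U \<noteq> {}"

definition directed_poset :: "('i, 'e) cat \<Rightarrow> bool" where
  "directed_poset J \<longleftrightarrow> category J \<and> Obj J \<noteq> {} \<and>
     (\<forall>x y f g. f \<in> hom J x y \<and> g \<in> hom J x y \<longrightarrow> f = g) \<and>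
     (\<forall>x y. hom J x y \<noteq> {} \<and> hom J y x \<noteq> {} \<longrightarrow> x = y) \<and>
     (\<forall>x \<in> Obj J. \<forall>y \<in> Obj J. \<exists>z. hom J x z \<noteq> {} \<and> hom J y z \<noteq> {})"

text \<open>
  A full subcategory of \<open>Sub C X\<close> is given by its set \<open>\<F>\<close> of objects.  A subobject \<open>m\<close> is called
  \<open>\<kappa>\<close>-presentable, or in the image of a functor, when its underlying object \<open>Dom C m\<close> is.
  Colimits are taken in \<open>Sub C X\<close>; being determined up to isomorphism only, the colimit belongs
  to \<open>\<F>\<close> if some colimiting object does.
\<close>

definition is_filter :: "'u rel \<Rightarrow> ('o, 'a) cat \<Rightarrow> 'o \<Rightarrow> 'a set \<Rightarrow> bool" where
  "is_filter \<kappa> C X \<F> \<longleftrightarrow> \<F> \<subseteq> Obj (Sub C X) \<and>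
     (\<forall>(J :: ('u, 'u) cat) D. directed_poset J \<and> cat_card J \<le>o \<kappa> \<and>
        is_functor J (full_subcategory (Sub C X) \<F>) D \<and>
        (\<forall>j \<in> Obj J. presentable \<kappa> C (Dom C (OMap D j))) \<longrightarrow>
        (\<exists>L \<iota>. is_colimit (Sub C X) J D L \<iota> \<and> L \<in> \<F>))"

definition is_dense :: "'u rel \<Rightarrow> ('o, 'a) cat \<Rightarrow> 'o \<Rightarrow> 'a set \<Rightarrow> bool" where
  "is_dense \<kappa> C X \<F> \<longleftrightarrow>
     (\<forall>S \<in> Obj (Sub C X). presentable \<kappa> C (Dom C S) \<longrightarrow>
        (\<exists>U \<in> \<F>. presentable \<kappa> C (Dom C U) \<and> contains C X U S))"

definition image_contains_dense_filter ::
  "'u rel \<Rightarrow> ('o, 'a) cat \<Rightarrow> ('p, 'b) cat \<Rightarrow> ('o, 'a, 'p, 'b) func \<Rightarrow> 'p \<Rightarrow> bool" where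
  "image_contains_dense_filter \<kappa> A B F X \<longleftrightarrow>
     (\<exists>\<F>. is_filter \<kappa> B X \<F> \<and> is_dense \<kappa> B X \<F> \<and> (\<forall>U \<in> \<F>. in_image A B F (Dom B U)))"

end

theory Submission
  imports Defs
begin

text \<open>
  The argument follows Hodges' version of Shelah's singular compactness theorem.  Write \<open>X\<close> as a
  filtered colimit of finitely presentable objects.  Sets \<open>M\<close> of arrows of the index category that
  are closed under suitable finitary operations yield subobjects \<open>s M\<close> of \<open>X\<close>, and these play the
  role of the subsets of an underlying set.  For regular \<open>\<kappa>\<close> below \<open>\<nu> = \<parallel>X\<parallel>\<close> consider the game in
  which one player names a set \<open>Z\<close> of size below \<open>\<kappa>\<close> and the other extends the current \<open>M\<close> to some
  \<open>N \<supseteq> Z\<close> of size below \<open>\<kappa>\<close>, with \<open>s N\<close> in the filter, such that the inclusion of \<open>s M\<close> in \<open>s N\<close>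
  lifts to \<open>A\<close>.  If the second player lost from every position above some set, playing a winning
  strategy of the first along a chain of length \<open>\<kappa>\<close> would give a subobject \<open>F(V)\<close>; comparing the
  chain with a presentation of \<open>V\<close> by \<open>\<kappa>\<close>-presentable objects, some infinite play has lifting
  inclusions throughout, a contradiction.  So winning positions are cofinal.  Now choose a
  continuous cofinal sequence of length \<open>cf \<nu>\<close>, run one game for each of its members in parallel,
  and interleave the \<open>\<omega>\<close> moves so that the unions \<open>N i\<close> form a continuous chain, with union
  isomorphic to \<open>X\<close>, whose successor inclusions lift to \<open>A\<close>.  As structures extend along
  morphisms, these lifts can be composed transfinitely.
\<close>

text \<open>Structures in \<open>A\<close> arise only as colimits or by extension: \<open>F\<close>
  need not be full or faithful, and an inclusion between two subobjects in its image need not lift.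
  Two devices cope with this. \<open>interpolation\<close> threads maps F(W) -> m -> F(W') through a
  subobject m of F(V), with W -> W' over V in \<open>A\<close>; repeated countably often, it yields
  a structure on a union that maps to V. And \<open>lifts\<close> asks only for some pair of
  structures, since \<open>extend_carries\<close> extends every structure on the smaller set; so the
  structure that \<open>N i\<close> gets from its own game and the one cut out of the structure of
  its successor need never be compared. The challenges of the first player can be taken to depend on
  the position alone; hence a chain can meet the challenge of each of its members without
  foreknowledge of which members a lifting play will visit. The size of \<open>fp B\<close> enters
  through purity: whenever X identifies two maps from a representative to an object of a subdiagram,
  the subdiagram must contain an arrow identifying them. Since rank(X) is the successor of
  \<open>\<nu>\<close>, at most \<open>\<nu>\<close> arrows already give all of X.\<close>

section \<open>Filtered categories\<close>

lemma finite_ordLess_Cinfinite: "finite S \<Longrightarrow> Cinfinite r \<Longrightarrow> |S| <o r"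
  by (simp add: Cfinite_ordLess_Cinfinite card_of_card_order_on cfinite_def Field_card_of)

lemma image_ordLess: "|S| <o r \<Longrightarrow> |f ` S| <o r"
  by (meson card_of_image ordLeq_ordLess_trans)

lemma subset_ordLess: "|S| <o r \<Longrightarrow> T \<subseteq> S \<Longrightarrow> |T| <o r"
  by (meson card_of_mono1 ordLeq_ordLess_trans)

lemma insert_ordLess: "|S| <o r \<Longrightarrow> Cinfinite r \<Longrightarrow> |insert a S| <o r"
  using Un_Cinfinite_bound_strict[of "{a}" r S] finite_ordLess_Cinfinite[of "{a}" r] by simp

lemma regular_cardinalD:
  assumes "regular_cardinal (\<kappa> :: 'u rel)"
  shows "Cinfinite \<kappa>" "Card_order \<kappa>" "regularCard \<kappa>" "\<kappa> <o |UNIV :: 'u set|" "stable \<kappa>"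
  using assms by (auto simp: regular_cardinal_def cinfinite_def intro!: regularCard_stable)

lemma Times_ordLess_Cinfinite_aux:
  assumes "Cinfinite r" "finite S \<and> finite T \<or> infinite T \<and> |S| \<le>o |T|" "|T| <o r"
  shows "|S \<times> T| <o r"
  using assms(2)
proof
  assume "infinite T \<and> |S| \<le>o |T|"
  then have "|S \<times> T| \<le>o |T|"
    using card_of_Times_ordLeq_infinite_Field[of "|T|" S T]
    by (simp add: Field_card_of card_of_card_order_on ordLeq_refl)
  then show ?thesis using assms(3) by (rule ordLeq_ordLess_trans)
qed (use assms(1) in \<open>auto intro: finite_ordLess_Cinfinite\<close>)

lemma Times_ordLess_Cinfinite:
  assumes "Cinfinite r" "|A| <o r" "|B| <o r" shows "|A \<times> B| <o r"
proof -
  have "|A| \<le>o |B| \<or> |B| \<le>o |A|" by (simp add: ordLeq_total card_of_Well_order)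
  then consider "finite A \<and> finite B" | "infinite B" "|A| \<le>o |B|" | "infinite A" "|B| \<le>o |A|"
    using card_of_ordLeq_finite by metis
  then show ?thesis
  proof cases
    case 3
    then have "|B \<times> A| <o r" using Times_ordLess_Cinfinite_aux assms by blast
    then show ?thesis using card_of_Times_commute ordIso_ordLess_trans by blast
  qed (use Times_ordLess_Cinfinite_aux assms in blast)+
qed

lemma lists_ordLess:
  assumes "Cinfinite r" "natLeq <o r" "stable r" "|S| <o r" shows "|lists S| <o r"
proof -
  have l: "|{l \<in> lists S. length l = n}| <o r" for n
  proof (induction n)
    case 0
    have "{l \<in> lists S. length l = 0} \<subseteq> {[]}" by auto
    then show ?case using assms(1) by (meson finite.simps finite_ordLess_Cinfinite finite_subset)
  next
    case (Suc n)
    have "{l \<in> lists S. length l = Suc n} \<subseteq> (\<lambda>(x, l). x # l) ` (S \<times> {l \<in> lists S. length l = n})"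
      by (auto simp: length_Suc_conv image_iff)
    then show ?case using subset_ordLess[OF image_ordLess[OF Times_ordLess_Cinfinite[OF assms(1,4) Suc]]] by blast
  qed
  have "lists S = (\<Union>n \<in> UNIV. {l \<in> lists S. length l = n})" by auto
  moreover have "|\<Union>n \<in> (UNIV :: nat set). {l \<in> lists S. length l = n}| <o r"
    using assms(2,3) l card_of_nat ordIso_ordLess_trans by (intro stable_UNION) blast+
  ultimately show ?thesis by simp
qed

text \<open>Supplies names in \<open>'u\<close> for the objects that a hand-built index category
  needs besides given arrows.\<close>

lemma fresh_element:
  assumes "|S :: 'u set| <o r" "r \<le>o |UNIV :: 'u set|" shows "\<exists>z. z \<notin> S"
proof (rule ccontr)
  assume "\<not> ?thesis" then have "S = UNIV" by auto
  then show False using assms not_ordLess_ordLeq by blast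
qed

section \<open>Rewriting rules for composites\<close>

lemma hom_iff: "f \<in> hom C x y \<longleftrightarrow> f \<in> Arr C \<and> Dom C f = x \<and> Cod C f = y"
  by (auto simp: hom_def)

context category
begin

lemma comp_simps [simp]:
  assumes "f \<in> Arr C" "g \<in> Arr C" "Cod C f = Dom C g"
  shows "Comp C g f \<in> Arr C" "Dom C (Comp C g f) = Dom C f" "Cod C (Comp C g f) = Cod C g"
  using comp_hom[of f "Dom C f" "Cod C f" g "Cod C g"] assms by (auto simp: hom_iff)

lemma id_simps [simp]:
  assumes "x \<in> Obj C"
  shows "Id C x \<in> Arr C" "Dom C (Id C x) = x" "Cod C (Id C x) = x"
  using id_hom[OF assms] by (auto simp: hom_iff)

lemma comp_id_simps [simp]:
  assumes "f \<in> Arr C"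
  shows "Dom C f = x \<Longrightarrow> Comp C f (Id C x) = f" "Cod C f = y \<Longrightarrow> Comp C (Id C y) f = f"
  using comp_id[of f "Dom C f" "Cod C f"] id_comp[of f "Dom C f" "Cod C f"] assms by (auto simp: hom_iff)

lemma assoc_right [simp]:
  assumes "f \<in> Arr C" "g \<in> Arr C" "h \<in> Arr C" "Cod C f = Dom C g" "Cod C g = Dom C h"
  shows "Comp C (Comp C h g) f = Comp C h (Comp C g f)"
  using comp_assoc[of f "Dom C f" "Cod C f" g "Cod C g" h "Cod C h"] assms by (auto simp: hom_iff)

lemma hom_obj: "f \<in> hom C x y \<Longrightarrow> x \<in> Obj C" "f \<in> hom C x y \<Longrightarrow> y \<in> Obj C"
  using dom_obj cod_obj by (auto simp: hom_iff)

lemma rewrite_left: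
  assumes "Comp C a b = c" "b \<in> Arr C" "a \<in> Arr C" "Cod C b = Dom C a" "x \<in> Arr C" "Cod C x = Dom C b"
  shows "Comp C a (Comp C b x) = Comp C c x"
  using assms assoc_right[of x b a] by simp

end

text \<open>A cocone over the graph formed by a set \<open>P\<close> of arrows: unlike for functors, no index
  category has to be encoded in \<open>'u\<close>.\<close>

definition bound :: "('o, 'a) cat \<Rightarrow> 'a set \<Rightarrow> 'o \<Rightarrow> ('o \<Rightarrow> 'a) \<Rightarrow> bool" where
  "bound J P c \<tau> \<longleftrightarrow> c \<in> Obj J \<and>
     (\<forall>u \<in> P. \<tau> (Dom J u) \<in> hom J (Dom J u) c \<and> \<tau> (Cod J u) \<in> hom J (Cod J u) c \<and>
        Comp J (\<tau> (Cod J u)) u = \<tau> (Dom J u))"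

text \<open>A cocone over a functor from \<open>K\<close> depends only on the graph of image arrows,
  of which there are fewer than \<open>\<kappa>\<close>. Together with \<open>bounded\<close> this
  frees later arguments from coding index categories.\<close>

lemma filtered_if_bounds:
  assumes "category J" "\<And>P. P \<subseteq> Arr J \<Longrightarrow> |P| <o \<kappa> \<Longrightarrow> \<exists>c \<tau>. bound J P c \<tau>"
  shows "filtered \<kappa> J"
  unfolding filtered_def
proof (intro allI impI)
  fix K :: "('b, 'b) cat" and D
  assume "is_functor K J D \<and> |Arr K| <o \<kappa>"
  then interpret D: is_functor K J D by simp
  have K: "|Arr K| <o \<kappa>" using \<open>_ \<and> _\<close> by simp
  have arr: "AMap D u \<in> hom J (OMap D (Dom K u)) (OMap D (Cod K u))" if "u \<in> Arr K" for u
    using D.amap_hom[of u] that by (auto simp: hom_iff)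
  obtain c \<tau> where "bound J (AMap D ` Arr K) c \<tau>"
    using assms(2)[of "AMap D ` Arr K"] arr image_ordLess[OF K] by (auto simp: hom_iff)
  \<comment> \<open>An object of \<open>K\<close> is reached as the domain of its identity, whose
    image is among the bounded arrows.\<close>
  moreover have "\<tau> (OMap D j) \<in> hom J (OMap D j) c" if "j \<in> Obj K" "bound J (AMap D ` Arr K) c \<tau>" for j
    using arr[of "Id K j"] that(2) D.A.id_simps[OF that(1)] unfolding bound_def hom_iff
    by (metis image_eqI)
  ultimately have "cocone J K D c (\<lambda>j. \<tau> (OMap D j))"
    using arr unfolding cocone_def bound_def hom_iff by auto
  then show "\<exists>L \<iota>. cocone J K D L \<iota>" by blast
qed

locale filtered_category = category J for J :: "('u, 'u) cat" +
  fixes \<kappa> :: "'u rel"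
  assumes regular: "regular_cardinal \<kappa>" and filtered: "filtered \<kappa> J"
begin

lemmas regularD = regular_cardinalD[OF regular]

lemma obj_bound:
  assumes "S \<subseteq> Obj J" "|S| <o \<kappa>"
  shows "\<exists>c \<sigma>. c \<in> Obj J \<and> (\<forall>x \<in> S. \<sigma> x \<in> hom J x c)"
proof -
  define K :: "('u, 'u) cat" where
    "K = \<lparr>Obj = S, Arr = S, Dom = id, Cod = id, Id = id, Comp = (\<lambda>g f. f)\<rparr>"
  define D :: "('u, 'u, 'u, 'u) func" where "D = \<lparr>OMap = id, AMap = Id J\<rparr>"
  have "is_functor K J D"
    using assms(1) by unfold_locales (auto simp: K_def D_def hom_iff subset_iff)
  moreover have "|Arr K| <o \<kappa>" using assms(2) by (simp add: K_def)
  ultimately obtain c \<sigma> where "cocone J K D c \<sigma>" using filtered unfolding filtered_def by blast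
  then show ?thesis unfolding cocone_def by (auto simp: K_def D_def)
qed

lemma coequalize:
  assumes "Q \<subseteq> hom J x y" "|Q| <o \<kappa>" "x \<in> Obj J" "y \<in> Obj J"
  shows "\<exists>z w. w \<in> hom J y z \<and> (\<forall>u \<in> Q. \<forall>v \<in> Q. Comp J w u = Comp J w v)"
proof -
  obtain z0 where z0: "z0 \<notin> Q" using fresh_element[OF assms(2)] regularD ordLess_imp_ordLeq by blast
  have s: "|insert z0 Q| <o \<kappa>" "|insert a (insert z0 Q)| <o \<kappa>" for a
    by (intro insert_ordLess assms(2) regularD(1))+
  obtain z1 where z1: "z1 \<notin> insert z0 Q" using fresh_element[OF s(1)] regularD ordLess_imp_ordLeq by blast
  \<comment> \<open>Two objects, with the members of \<open>Q\<close> as arrows from the first to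
    the second. \<open>z0\<close> and \<open>z1\<close> are at once the objects and their
    identities, hence must lie outside \<open>Q\<close>.\<close>
  define K :: "('u, 'u) cat" where
    "K = \<lparr>Obj = {z0, z1}, Arr = insert z1 (insert z0 Q), Dom = (\<lambda>u. if u = z1 then z1 else z0),
       Cod = (\<lambda>u. if u = z0 then z0 else z1), Id = id, Comp = (\<lambda>g f. if f = z0 \<or> f = z1 then g else f)\<rparr>"
  define D where "D = \<lparr>OMap = (\<lambda>z. if z = z0 then x else y),
    AMap = (\<lambda>u. if u = z0 then Id J x else if u = z1 then Id J y else u)\<rparr>"
  have "is_functor K J D"
  proof unfold_locales
    fix f g x' y' z assume "f \<in> hom K x' y'" "g \<in> hom K y' z"
    then show "AMap D (Comp K g f) = Comp J (AMap D g) (AMap D f)"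
      using assms(1,3,4) z0 z1 unfolding K_def D_def hom_iff by (cases "f = z0"; cases "f = z1"; cases "g = z1") (auto simp: hom_iff subset_iff)
  qed (use assms(1,3,4) z0 z1 in \<open>auto simp: K_def D_def hom_iff subset_iff split: if_split_asm\<close>)
  moreover have "|Arr K| <o \<kappa>" using s by (simp add: K_def)
  ultimately obtain c \<sigma> where "cocone J K D c \<sigma>" using filtered unfolding filtered_def by blast
  then have "\<sigma> z1 \<in> hom J y c" "\<And>u. u \<in> Q \<Longrightarrow> Comp J (\<sigma> z1) u = \<sigma> z0"
    unfolding cocone_def using z0 z1 by (auto simp: K_def D_def split: if_splits)
  then show ?thesis by force
qed

lemma coequalize_pair:
  assumes "u \<in> hom J x y" "v \<in> hom J x y"
  shows "\<exists>z w. w \<in> hom J y z \<and> Comp J w u = Comp J w v"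
  using coequalize[of "{u, v}" x y, OF _ finite_ordLess_Cinfinite[OF _ regularD(1)] hom_obj[OF assms(1)]] assms
  by fastforce

text \<open>Bounding the codomains gives parallel arrows out of \<open>x\<close>, which
  \<open>coequalize\<close> identifies. It is the tool for satisfying fewer than
  \<open>\<kappa>\<close> separate requirements at once, when each asks for a further move from the
  same index.\<close>

lemma common_extension:
  assumes "x \<in> Obj J" "|I| <o \<kappa>" "\<And>i. i \<in> I \<Longrightarrow> w i \<in> Arr J" "\<And>i. i \<in> I \<Longrightarrow> Dom J (w i) = x"
  shows "\<exists>c v a. c \<in> Obj J \<and> a \<in> hom J x c \<and> (\<forall>i \<in> I. v i \<in> hom J (Cod J (w i)) c \<and> Comp J (v i) (w i) = a)"
proof -
  obtain c \<sigma> where c: "c \<in> Obj J" "\<forall>y \<in> insert x ((\<lambda>i. Cod J (w i)) ` I). \<sigma> y \<in> hom J y c"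
  proof -
    have "|insert x ((\<lambda>i. Cod J (w i)) ` I)| <o \<kappa>"
      by (intro insert_ordLess image_ordLess assms(2) regularD(1))
    moreover have "insert x ((\<lambda>i. Cod J (w i)) ` I) \<subseteq> Obj J" using assms cod_obj by auto
    ultimately show ?thesis using obj_bound[of "insert x ((\<lambda>i. Cod J (w i)) ` I)"] that by blast
  qed
  \<comment> \<open>Including \<open>\<sigma> x\<close> provides a value for \<open>a\<close> even
    when \<open>I\<close> is empty.\<close>
  let ?Q = "insert (\<sigma> x) ((\<lambda>i. Comp J (\<sigma> (Cod J (w i))) (w i)) ` I)"
  have 1: "\<sigma> x \<in> hom J x c" "\<And>i. i \<in> I \<Longrightarrow> \<sigma> (Cod J (w i)) \<in> hom J (Cod J (w i)) c" using c by auto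
  have Q: "?Q \<subseteq> hom J x c" using 1 assms by (auto simp: hom_iff)
  have Q': "|?Q| <o \<kappa>"
    by (intro insert_ordLess image_ordLess assms(2) regularD(1))
  obtain z m where m: "m \<in> hom J c z" "\<forall>u \<in> ?Q. \<forall>v \<in> ?Q. Comp J m u = Comp J m v"
    by (insert coequalize[OF Q Q' assms(1) c(1)], elim exE conjE, rule that)
  have "Comp J (Comp J m (\<sigma> (Cod J (w i)))) (w i) = Comp J m (\<sigma> x)" if "i \<in> I" for i
    using m(2)[rule_format, of "Comp J (\<sigma> (Cod J (w i))) (w i)" "\<sigma> x"] that assms(3,4)[OF that] 1(2)[OF that] m(1)
    by (simp add: hom_iff)
  then show ?thesis using 1 m(1) hom_obj(2)[OF m(1)] assms(3,4)
    by (intro exI[of _ z] exI[of _ "\<lambda>i. Comp J m (\<sigma> (Cod J (w i)))"] exI[of _ "Comp J m (\<sigma> x)"])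
      (auto simp: hom_iff)
qed

text \<open>The converse of \<open>filtered_if_bounds\<close>. Above a common bound of the
  endpoints, each triangle is made to commute by an arrow of its own;
  \<open>common_extension\<close> merges these arrows.\<close>

lemma bounded:
  assumes "P \<subseteq> Arr J" "|P| <o \<kappa>"
  shows "\<exists>c \<tau>. bound J P c \<tau>"
proof -
  let ?S = "Dom J ` P \<union> Cod J ` P"
  have "|?S| <o \<kappa>" using image_ordLess[OF assms(2)] regularD by (intro Un_Cinfinite_bound_strict) auto
  moreover have "?S \<subseteq> Obj J" using assms(1) dom_obj cod_obj by auto
  ultimately obtain c \<sigma> where c: "c \<in> Obj J" "\<forall>x \<in> ?S. \<sigma> x \<in> hom J x c"
    using obj_bound[of ?S] by blast
  have s: "\<sigma> (Dom J u) \<in> hom J (Dom J u) c" "\<sigma> (Cod J u) \<in> hom J (Cod J u) c" "u \<in> Arr J"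
    if "u \<in> P" for u using that c(2) assms(1) by auto
  have "\<exists>w. w \<in> Arr J \<and> Dom J w = c \<and> Comp J w (Comp J (\<sigma> (Cod J u)) u) = Comp J w (\<sigma> (Dom J u))"
    if u: "u \<in> P" for u
  proof -
    have "Comp J (\<sigma> (Cod J u)) u \<in> hom J (Dom J u) c"
      using s[OF u] by (auto simp: hom_iff)
    from coequalize_pair[OF this s(1)[OF u]]
    show ?thesis by (auto simp: hom_iff)
  qed
  then obtain w where w: "\<And>u. u \<in> P \<Longrightarrow> w u \<in> Arr J" "\<And>u. u \<in> P \<Longrightarrow> Dom J (w u) = c"
    "\<And>u. u \<in> P \<Longrightarrow> Comp J (w u) (Comp J (\<sigma> (Cod J u)) u) = Comp J (w u) (\<sigma> (Dom J u))" by metis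
  obtain d v a where d: "d \<in> Obj J" "a \<in> hom J c d"
    "\<And>u. u \<in> P \<Longrightarrow> v u \<in> hom J (Cod J (w u)) d \<and> Comp J (v u) (w u) = a"
    by (insert common_extension[where w = w, OF c(1) assms(2) w(1,2)]) blast
  have "Comp J (Comp J a (\<sigma> (Cod J u))) u = Comp J a (\<sigma> (Dom J u))" if "u \<in> P" for u
  proof -
    have a: "a = Comp J (v u) (w u)" using d that by simp
    show ?thesis unfolding a using w[OF that] d(3)[OF that] s[OF that] by (auto simp: hom_iff)
  qed
  then have "bound J P d (\<lambda>x. Comp J a (\<sigma> x))"
    unfolding bound_def using s d by (auto simp: hom_iff)
  then show ?thesis by blast
qed

lemma bound_pair:
  assumes "x \<in> Obj J" "y \<in> Obj J"
  shows "\<exists>z u v. u \<in> hom J x z \<and> v \<in> hom J y z"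
  using obj_bound[of "{x, y}"] finite_ordLess_Cinfinite[OF _ regularD(1), of "{x, y}"] assms by auto

lemma span_completion:
  assumes "u \<in> hom J x y" "v \<in> hom J x z"
  shows "\<exists>w a b. a \<in> hom J y w \<and> b \<in> hom J z w \<and> Comp J a u = Comp J b v"
proof -
  obtain t a b where t: "a \<in> hom J y t" "b \<in> hom J z t" using bound_pair hom_obj assms by metis
  have "Comp J a u \<in> hom J x t" "Comp J b v \<in> hom J x t" using t assms by (auto simp: hom_iff)
  then obtain w c where c: "c \<in> hom J t w" "Comp J c (Comp J a u) = Comp J c (Comp J b v)"
    using coequalize_pair by blast
  then show ?thesis using t assms
    by (intro exI[of _ w] exI[of _ "Comp J c a"] exI[of _ "Comp J c b"]) (auto simp: hom_iff)
qed

end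

section \<open>Presentable objects\<close>

lemma inaccessibleD:
  assumes "inaccessible_type TYPE('u)"
  shows "natLeq <o |UNIV :: 'u set|" "Cinfinite |UNIV :: 'u set|" "stable |UNIV :: 'u set|"
    "infinite (UNIV :: 'u set)"
proof -
  show 1: "natLeq <o |UNIV :: 'u set|" using assms by (simp add: inaccessible_type_def)
  then show 2: "Cinfinite |UNIV :: 'u set|"
    by (meson card_of_Card_order card_of_card_order_on cinfinite_mono natLeq_cinfinite ordLess_imp_ordLeq)
  then show "infinite (UNIV :: 'u set)" by (simp add: cinfinite_def Field_card_of)
  then show "stable |UNIV :: 'u set|"
    using assms by (intro regularCard_stable) (auto simp: inaccessible_type_def Field_card_of card_of_card_order_on)
qed

text \<open>\<open>aleph0\<close> is defined by choice; a copy of the naturals inside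
  \<open>'u\<close> shows that there is something to choose.\<close>

lemma aleph0_natLeq:
  assumes "inaccessible_type TYPE('u)" shows "(aleph0 :: 'u rel) =o natLeq"
proof -
  have "|UNIV :: nat set| \<le>o |UNIV :: 'u set|"
    using ordLess_imp_ordLeq[OF ordIso_ordLess_trans[OF card_of_nat inaccessibleD(1)[OF assms]]] .
  then obtain f :: "nat \<Rightarrow> 'u" where "inj f" by (auto simp: card_of_ordLeq[symmetric])
  then have "|range f| =o |UNIV :: nat set|"
    by (intro ordIso_symmetric[OF card_of_ordIsoI[of f]]) (simp add: bij_betw_def)
  then have "|range f| =o natLeq" using card_of_nat ordIso_transitive by blast
  then show ?thesis unfolding aleph0_def by (rule someI)
qed

lemma regular_aleph0:
  assumes "inaccessible_type TYPE('u)" shows "regular_cardinal (aleph0 :: 'u rel)"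
proof -
  note a = ordIso_symmetric[OF aleph0_natLeq[OF assms]]
  show ?thesis unfolding regular_cardinal_def
    using Cinfinite_cong[OF a natLeq_Cinfinite] regularCard_ordIso[OF a natLeq_Cinfinite regularCard_natLeq]
      ordIso_ordLess_trans[OF ordIso_symmetric[OF a] inaccessibleD(1)[OF assms]] by blast
qed

lemma aleph0_least:
  assumes "inaccessible_type TYPE('u)" "regular_cardinal (\<kappa> :: 'u rel)" shows "(aleph0 :: 'u rel) \<le>o \<kappa>"
  using aleph0_natLeq[OF assms(1)] natLeq_ordLeq_cinfinite regular_cardinalD(1)[OF assms(2)] ordIso_ordLeq_trans
  by blast

lemma filtered_mono: "filtered \<kappa> J \<Longrightarrow> \<theta> \<le>o \<kappa> \<Longrightarrow> filtered \<theta> J"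
  unfolding filtered_def using ordLess_ordLeq_trans by blast

lemma filtered_diagram_mono: "filtered_diagram \<kappa> C J D \<Longrightarrow> \<theta> \<le>o \<kappa> \<Longrightarrow> filtered_diagram \<theta> C J D"
  unfolding filtered_diagram_def using filtered_mono by blast

lemma filtered_diagram_category:
  "filtered_diagram \<kappa> C J D \<Longrightarrow> regular_cardinal \<kappa> \<Longrightarrow> filtered_category J \<kappa>"
  unfolding filtered_diagram_def small_category_def
  by (simp add: filtered_category_def filtered_category_axioms_def)

context is_functor
begin

lemma amap_arr [simp]:
  assumes "f \<in> Arr A"
  shows "AMap F f \<in> Arr B" "Dom B (AMap F f) = OMap F (Dom A f)" "Cod B (AMap F f) = OMap F (Cod A f)"
  using amap_hom[of f "Dom A f" "Cod A f"] assms by (auto simp: hom_iff)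

lemma amap_comp_arr:
  assumes "f \<in> Arr A" "g \<in> Arr A" "Cod A f = Dom A g"
  shows "AMap F (Comp A g f) = Comp B (AMap F g) (AMap F f)"
  using amap_comp[of f "Dom A f" "Cod A f" g "Cod A g"] assms by (auto simp: hom_iff)

end

locale colimit = is_functor J C D for J :: "('i, 'e) cat" and C :: "('o, 'a) cat" and D +
  fixes L \<iota>
  assumes colim: "is_colimit C J D L \<iota>"
begin

lemma cocone: "cocone C J D L \<iota>" using colim by (simp add: is_colimit_def)

lemma tip [simp]: "L \<in> Obj C" using cocone by (simp add: cocone_def)

lemma leg_hom: "j \<in> Obj J \<Longrightarrow> \<iota> j \<in> hom C (OMap D j) L" using cocone by (simp add: cocone_def)

lemma leg_arr [simp]:
  assumes "j \<in> Obj J" shows "\<iota> j \<in> Arr C" "Dom C (\<iota> j) = OMap D j" "Cod C (\<iota> j) = L"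
  using leg_hom[OF assms] by (auto simp: hom_iff)

lemma leg_natural: "u \<in> Arr J \<Longrightarrow> Comp C (\<iota> (Cod J u)) (AMap D u) = \<iota> (Dom J u)"
  using cocone by (simp add: cocone_def)

lemma leg_natural_comp:
  assumes "u \<in> hom J i j" "g \<in> Arr C" "Cod C g = OMap D i"
  shows "Comp C (\<iota> j) (Comp C (AMap D u) g) = Comp C (\<iota> i) g"
  using B.rewrite_left[OF leg_natural[of u], of g] assms A.dom_obj A.cod_obj by (auto simp: hom_iff)

lemma induced:
  assumes "cocone C J D M \<tau>"
  obtains h where "h \<in> hom C L M" "\<forall>j \<in> Obj J. Comp C h (\<iota> j) = \<tau> j"
  using colim assms unfolding is_colimit_def by blast

lemma joint_epi:
  assumes "h \<in> hom C L M" "h' \<in> hom C L M" "\<forall>j \<in> Obj J. Comp C h (\<iota> j) = Comp C h' (\<iota> j)"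
  shows "h = h'"
proof -
  have "cocone C J D M (\<lambda>j. Comp C h (\<iota> j))"
    using assms(1) cocone A.dom_obj A.cod_obj B.hom_obj(2)[OF assms(1)]
    by (auto simp: cocone_def hom_iff leg_natural)
  then have "\<exists>!k. k \<in> hom C L M \<and> (\<forall>j \<in> Obj J. Comp C k (\<iota> j) = Comp C h (\<iota> j))"
    using colim unfolding is_colimit_def by blast
  then show ?thesis using assms by metis
qed

end

lemma colimitI: "is_functor J C D \<Longrightarrow> is_colimit C J D L \<iota> \<Longrightarrow> colimit J C D L \<iota>"
  by (simp add: colimit_def colimit_axioms_def)

text \<open>The elementary form of \<open>\<kappa>\<close>-presentability: surjectivity and injectivity of the comparison
  map from the colimit of the hom-sets.\<close>

definition factorizes ::
  "('o, 'a) cat \<Rightarrow> 'o \<Rightarrow> ('i, 'e) cat \<Rightarrow> ('i, 'e, 'o, 'a) func \<Rightarrow> 'o \<Rightarrow> ('i \<Rightarrow> 'a) \<Rightarrow> bool" where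
  "factorizes C P J D L \<iota> \<longleftrightarrow>
     (\<forall>p \<in> hom C P L. \<exists>j \<in> Obj J. \<exists>g \<in> hom C P (OMap D j). Comp C (\<iota> j) g = p) \<and>
     (\<forall>j \<in> Obj J. \<forall>g \<in> hom C P (OMap D j). \<forall>g' \<in> hom C P (OMap D j).
        Comp C (\<iota> j) g = Comp C (\<iota> j) g' \<longrightarrow>
        (\<exists>u \<in> Arr J. Dom J u = j \<and> Comp C (AMap D u) g = Comp C (AMap D u) g'))"

context
  fixes C :: "('o, 'a) cat" and J :: "('u, 'u) cat" and D L \<iota> and \<kappa> :: "'u rel" and P
  assumes diag: "filtered_diagram \<kappa> C J D" and colim: "is_colimit C J D L \<iota>"
    and reg: "regular_cardinal \<kappa>" and P: "P \<in> Obj C"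
begin

interpretation D: colimit J C D L \<iota>
  using colim diag by (simp add: colimitI filtered_diagram_def)

interpretation J: filtered_category J \<kappa> by (rule filtered_diagram_category[OF diag reg])

text \<open>Maps into a two-element set suffice. If \<open>p\<close> did not factor, two functions
  on \<open>hom C P L\<close> differing only at \<open>p\<close> would restrict to the same constant
  cocone. If \<open>g\<close> and \<open>g'\<close> agree in \<open>L\<close>, the indicator
  function of the class of \<open>g\<close> is a cocone, so it cannot separate them.\<close>

lemma factorizes_if_hom_preserves_colimit:
  assumes "inaccessible_type TYPE('u)" "hom_preserves_colimit C P J D L \<iota>"
  shows "factorizes C P J D L \<iota>"
  unfolding factorizes_def
proof (intro conjI ballI impI)
  obtain a b :: 'u where ab: "a \<noteq> b" using fresh_element[of "{a}" "|UNIV :: 'u set|" for a]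
      finite_ordLess_Cinfinite[OF _ inaccessibleD(2)[OF assms(1)]] ordLeq_refl[OF card_of_Card_order]
    by (metis finite.emptyI finite.insertI singletonI)
  have T: "|{a, b}| <o |UNIV :: 'u set|" by (rule finite_ordLess_Cinfinite[OF _ inaccessibleD(2)[OF assms(1)]]) simp
  note pres = assms(2)[unfolded hom_preserves_colimit_def, THEN spec, of "{a, b}"]
  {
    fix p assume p: "p \<in> hom C P L"
    let ?t = "\<lambda>j g. a"
    have ex: "\<exists>!h. h \<in> hom C P L \<rightarrow>\<^sub>E {a, b} \<and> (\<forall>j \<in> Obj J. \<forall>g \<in> hom C P (OMap D j). h (Comp C (\<iota> j) g) = a)"
      using pres[THEN spec, of ?t] T by simp
    show "\<exists>j \<in> Obj J. \<exists>g \<in> hom C P (OMap D j). Comp C (\<iota> j) g = p"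
    proof (rule ccontr)
      assume no: "\<not> ?thesis"
      let ?h = "\<lambda>q \<in> hom C P L. a" and ?h' = "\<lambda>q \<in> hom C P L. if q = p then b else a"
      have c: "Comp C (\<iota> j) g \<in> hom C P L" if "j \<in> Obj J" "g \<in> hom C P (OMap D j)" for j g
        using that by (auto simp: hom_iff)
      have "?h = ?h'" 
      proof (rule ex1E[OF ex])
        fix k assume *: "\<forall>h. h \<in> hom C P L \<rightarrow>\<^sub>E {a, b} \<and> (\<forall>j \<in> Obj J. \<forall>g \<in> hom C P (OMap D j). h (Comp C (\<iota> j) g) = a) \<longrightarrow> h = k"
        have "?h = k" by (rule *[rule_format]) (use c in auto)
        moreover have "?h' = k"
        proof (rule *[rule_format], intro conjI ballI)
          fix j g assume "j \<in> Obj J" "g \<in> hom C P (OMap D j)"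
          then show "?h' (Comp C (\<iota> j) g) = a" using c no by auto
        qed auto
        ultimately show ?thesis by simp
      qed
      then have "?h p = ?h' p" by metis
      then show False using p ab by simp
    qed
  }
  {
    fix j g g' assume j: "j \<in> Obj J" and g: "g \<in> hom C P (OMap D j)" and g': "g' \<in> hom C P (OMap D j)"
      and eq: "Comp C (\<iota> j) g = Comp C (\<iota> j) g'"
    \<comment> \<open>The relation of representing the same element as \<open>g\<close> in the
      colimit of the hom-sets.\<close>
    define R where "R k f \<longleftrightarrow> (\<exists>m u v. u \<in> hom J j m \<and> v \<in> hom J k m \<and> Comp C (AMap D u) g = Comp C (AMap D v) f)" for k f
    have R: "R (Cod J u) (Comp C (AMap D u) f) \<longleftrightarrow> R (Dom J u) f"
      if u: "u \<in> Arr J" and f: "f \<in> hom C P (OMap D (Dom J u))" for u f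
    proof
      assume "R (Cod J u) (Comp C (AMap D u) f)"
      then obtain m v w where "v \<in> hom J j m" "w \<in> hom J (Cod J u) m"
        "Comp C (AMap D v) g = Comp C (AMap D w) (Comp C (AMap D u) f)" unfolding R_def by blast
      then show "R (Dom J u) f" unfolding R_def using u f
        by (intro exI[of _ m] exI[of _ v] exI[of _ "Comp J w u"]) (auto simp: hom_iff D.amap_comp_arr)
    next
      assume "R (Dom J u) f"
      then obtain m v w where v: "v \<in> hom J j m" "w \<in> hom J (Dom J u) m"
        "Comp C (AMap D v) g = Comp C (AMap D w) f" unfolding R_def by blast
      obtain n x y where x: "x \<in> hom J m n" "y \<in> hom J (Cod J u) n" "Comp J x w = Comp J y u"
        using J.span_completion[OF v(2), of u "Cod J u"] u by (auto simp: hom_iff)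
      have "Comp C (AMap D (Comp J x v)) g = Comp C (AMap D x) (Comp C (AMap D w) f)"
        using x v g by (simp add: hom_iff D.amap_comp_arr)
      also have "\<dots> = Comp C (Comp C (AMap D x) (AMap D w)) f"
        using x v f by (simp add: hom_iff)
      also have "\<dots> = Comp C (AMap D (Comp J x w)) f"
        using D.amap_comp[OF v(2) x(1)] by simp
      also have "\<dots> = Comp C (AMap D y) (Comp C (AMap D u) f)"
        unfolding x(3) using x(2) u f by (simp add: hom_iff D.amap_comp_arr)
      finally show "R (Cod J u) (Comp C (AMap D u) f)" unfolding R_def using x v
        by (intro exI[of _ n] exI[of _ "Comp J x v"] exI[of _ y]) (auto simp: hom_iff)
    qed
    let ?t = "\<lambda>k f. if R k f then b else a"
    have "\<exists>!h. h \<in> hom C P L \<rightarrow>\<^sub>E {a, b} \<and> (\<forall>j \<in> Obj J. \<forall>g \<in> hom C P (OMap D j). h (Comp C (\<iota> j) g) = ?t j g)"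
      using pres[THEN spec, of ?t] T R by simp
    then obtain h where "\<forall>j \<in> Obj J. \<forall>g \<in> hom C P (OMap D j). h (Comp C (\<iota> j) g) = ?t j g" by blast
    then have "?t j g = ?t j g'" using eq j g g' by metis
    moreover have "R j g" unfolding R_def using j D.A.id_hom[OF j] by blast
    ultimately have "R j g'" using ab by (auto split: if_splits)
    then obtain m u v where u: "u \<in> hom J j m" "v \<in> hom J j m" "Comp C (AMap D u) g = Comp C (AMap D v) g'"
      unfolding R_def by blast
    \<comment> \<open>\<open>u\<close> and \<open>v\<close> may be different arrows out of
      \<open>j\<close>, but a single one is required.\<close>
    then obtain n w where w: "w \<in> hom J m n" "Comp J w u = Comp J w v" using J.coequalize_pair by blast
    have "Comp C (AMap D (Comp J w u)) g = Comp C (AMap D w) (Comp C (AMap D v) g')"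
      using u w(1) g by (simp add: hom_iff D.amap_comp_arr)
    also have "\<dots> = Comp C (AMap D (Comp J w u)) g'"
      unfolding w(2) using u w(1) g' by (simp add: hom_iff D.amap_comp_arr)
    finally show "\<exists>u \<in> Arr J. Dom J u = j \<and> Comp C (AMap D u) g = Comp C (AMap D u) g'"
      using u w by (intro bexI[of _ "Comp J w u"]) (auto simp: hom_iff)
  }
qed

text \<open>The value at \<open>p\<close> is read off from any factorization of \<open>p\<close>:
  one exists by the first half of \<open>factorizes\<close>, and the second half makes the value
  independent of it.\<close>

lemma hom_preserves_colimit_if_factorizes:
  assumes "factorizes C P J D L \<iota>"
  shows "hom_preserves_colimit C P J D L \<iota>"
  unfolding hom_preserves_colimit_def
proof (intro allI impI, elim conjE)
  fix T :: "'u set" and t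
  assume t: "\<forall>j \<in> Obj J. t j \<in> hom C P (OMap D j) \<rightarrow> T"
    "\<forall>u \<in> Arr J. \<forall>g \<in> hom C P (OMap D (Dom J u)). t (Cod J u) (Comp C (AMap D u) g) = t (Dom J u) g"
  have fac: "\<exists>j g. j \<in> Obj J \<and> g \<in> hom C P (OMap D j) \<and> Comp C (\<iota> j) g = p" if "p \<in> hom C P L" for p
    using assms that unfolding factorizes_def by blast
  have eq: "t j g = t k f" if *: "j \<in> Obj J" "k \<in> Obj J" "g \<in> hom C P (OMap D j)" "f \<in> hom C P (OMap D k)"
    "Comp C (\<iota> j) g = Comp C (\<iota> k) f" for j k g f
  proof -
    obtain m u v where u: "u \<in> hom J j m" "v \<in> hom J k m" using J.bound_pair * by blast
    let ?g = "Comp C (AMap D u) g" and ?f = "Comp C (AMap D v) f"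
    have gf: "?g \<in> hom C P (OMap D m)" "?f \<in> hom C P (OMap D m)" using u * by (auto simp: hom_iff)
    moreover have "Comp C (\<iota> m) ?g = Comp C (\<iota> m) ?f"
      using D.leg_natural_comp[OF u(1)] D.leg_natural_comp[OF u(2)] * by (simp add: hom_iff)
    moreover have m: "m \<in> Obj J" using u D.A.hom_obj by blast
    ultimately obtain w where w: "w \<in> Arr J" "Dom J w = m" "Comp C (AMap D w) ?g = Comp C (AMap D w) ?f"
      using assms unfolding factorizes_def by blast
    have "t j g = t m ?g" "t k f = t m ?f" using t(2) u * by (auto simp: hom_iff)
    moreover have "t m ?g = t (Cod J w) (Comp C (AMap D w) ?g)" "t m ?f = t (Cod J w) (Comp C (AMap D w) ?f)"
      using t(2) w(1,2) gf by auto
    ultimately show ?thesis using w(3) by simp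
  qed
  define h where "h = (\<lambda>p \<in> hom C P L. SOME x. \<exists>j g. j \<in> Obj J \<and> g \<in> hom C P (OMap D j) \<and> Comp C (\<iota> j) g = p \<and> x = t j g)"
  have h: "h (Comp C (\<iota> j) g) = t j g" if "j \<in> Obj J" "g \<in> hom C P (OMap D j)" for j g
  proof -
    have "Comp C (\<iota> j) g \<in> hom C P L" using that by (auto simp: hom_iff)
    moreover have "(SOME x. \<exists>k f. k \<in> Obj J \<and> f \<in> hom C P (OMap D k) \<and> Comp C (\<iota> k) f = Comp C (\<iota> j) g \<and> x = t k f) = t j g"
    proof (rule some_equality)
      fix x assume "\<exists>k f. k \<in> Obj J \<and> f \<in> hom C P (OMap D k) \<and> Comp C (\<iota> k) f = Comp C (\<iota> j) g \<and> x = t k f"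
      then obtain k f where "k \<in> Obj J" "f \<in> hom C P (OMap D k)" "Comp C (\<iota> k) f = Comp C (\<iota> j) g" "x = t k f" by blast
      then show "x = t j g" using eq[of k j f g] that by simp
    qed (use that in blast)
    ultimately show ?thesis by (simp add: h_def)
  qed
  show "\<exists>!h. h \<in> hom C P L \<rightarrow>\<^sub>E T \<and> (\<forall>j \<in> Obj J. \<forall>g \<in> hom C P (OMap D j). h (Comp C (\<iota> j) g) = t j g)"
  proof (rule ex1I[of _ h])
    have "h p \<in> T" if "p \<in> hom C P L" for p using fac[OF that] h t(1) by fastforce
    then have "h \<in> hom C P L \<rightarrow>\<^sub>E T" by (simp add: h_def)
    then show "h \<in> hom C P L \<rightarrow>\<^sub>E T \<and> (\<forall>j \<in> Obj J. \<forall>g \<in> hom C P (OMap D j). h (Comp C (\<iota> j) g) = t j g)"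
      using h by blast
  next
    fix k assume k: "k \<in> hom C P L \<rightarrow>\<^sub>E T \<and> (\<forall>j \<in> Obj J. \<forall>g \<in> hom C P (OMap D j). k (Comp C (\<iota> j) g) = t j g)"
    show "k = h"
    proof
      fix p show "k p = h p"
      proof (cases "p \<in> hom C P L")
        case True then show ?thesis using fac[OF True] h k by metis
      next
        case False then show ?thesis using k by (auto simp: h_def PiE_def extensional_def)
      qed
    qed
  qed
qed

end

lemma presentable_iff:
  assumes "inaccessible_type TYPE('u)"
  shows "presentable (\<kappa> :: 'u rel) C P \<longleftrightarrow> regular_cardinal \<kappa> \<and> P \<in> Obj C \<and>
     (\<forall>J D L \<iota>. filtered_diagram \<kappa> C J D \<and> is_colimit C J D L \<iota> \<longrightarrow> factorizes C P J D L \<iota>)"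
proof -
  have "hom_preserves_colimit C P J D L \<iota> \<longleftrightarrow> factorizes C P J D L \<iota>"
    if "regular_cardinal \<kappa> \<and> P \<in> Obj C" "filtered_diagram \<kappa> C J D \<and> is_colimit C J D L \<iota>"
    for J :: "('u, 'u) cat" and D L \<iota>
    using factorizes_if_hom_preserves_colimit[of \<kappa> C J D L \<iota> P]
      hom_preserves_colimit_if_factorizes[of \<kappa> C J D L \<iota> P] assms that by metis
  then show ?thesis unfolding presentable_def by metis
qed

lemma presentable_mono:
  fixes \<kappa> \<theta> :: "'u rel"
  assumes "presentable \<theta> C P" "\<theta> \<le>o \<kappa>" "regular_cardinal \<kappa>" shows "presentable \<kappa> C P"
proof -
  have "filtered_diagram \<theta> C J D" if "filtered_diagram \<kappa> C J D" for J D
    using filtered_diagram_mono[OF that assms(2)] .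
  then show ?thesis using assms unfolding presentable_def by simp
qed

section \<open>Directed systems\<close>

text \<open>Morphisms out of \<open>L\<close> are compatible families of morphisms out of fewer than
  \<open>\<kappa>\<close> presentable objects. The members factor through separate stages;
  \<open>\<kappa>\<close>-filteredness provides one stage where all of them factor, and further on
  one where they are compatible.\<close>

lemma presentable_colimit:
  fixes \<kappa> :: "'u rel"
  assumes inacc: "inaccessible_type TYPE('u)" and "colimit J C D L \<iota>" and reg: "regular_cardinal \<kappa>"
    and card: "|Arr J| <o \<kappa>" and pres: "\<forall>j \<in> Obj J. presentable \<kappa> C (OMap D j)"
  shows "presentable \<kappa> C L"
proof -
  interpret D: colimit J C D L \<iota> by fact
  have "factorizes C L I E Q e" if diag: "filtered_diagram \<kappa> C I E" and colim: "is_colimit C I E Q e"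
    for I :: "('u, 'u) cat" and E Q e
  proof -
    interpret E: colimit I C E Q e using diag colim by (simp add: colimitI filtered_diagram_def)
    interpret I: filtered_category I \<kappa> by (rule filtered_diagram_category[OF diag reg])
    have fac: "factorizes C (OMap D j) I E Q e" if "j \<in> Obj J" for j
      using pres that diag colim unfolding presentable_iff[OF inacc] by blast
    have "Obj J \<subseteq> Dom J ` Arr J" using D.A.id_simps(1,2) by (metis image_eqI subsetI)
    then have card': "|Obj J| <o \<kappa>" using image_ordLess[OF card] subset_ordLess by blast
    show ?thesis unfolding factorizes_def
    proof (intro conjI ballI impI)
      fix p assume p: "p \<in> hom C L Q"
      have "\<exists>i g. i \<in> Obj I \<and> g \<in> hom C (OMap D j) (OMap E i) \<and> Comp C (e i) g = Comp C p (\<iota> j)" if j: "j \<in> Obj J" for j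
      proof -
        have "Comp C p (\<iota> j) \<in> hom C (OMap D j) Q" using p j by (auto simp: hom_iff)
        then show ?thesis using fac[OF j] unfolding factorizes_def by blast
      qed
      then obtain i g where g: "\<And>j. j \<in> Obj J \<Longrightarrow> i j \<in> Obj I" "\<And>j. j \<in> Obj J \<Longrightarrow> g j \<in> hom C (OMap D j) (OMap E (i j))"
        "\<And>j. j \<in> Obj J \<Longrightarrow> Comp C (e (i j)) (g j) = Comp C p (\<iota> j)" by metis
      have "i ` Obj J \<subseteq> Obj I" using g(1) by blast
      from I.obj_bound[OF this image_ordLess[OF card']] obtain c \<sigma>
        where c: "c \<in> Obj I" "\<forall>x \<in> i ` Obj J. \<sigma> x \<in> hom I x c" by blast
      define G where "G j = Comp C (AMap E (\<sigma> (i j))) (g j)" for j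
      have G: "G j \<in> hom C (OMap D j) (OMap E c)" "Comp C (e c) (G j) = Comp C p (\<iota> j)" if "j \<in> Obj J" for j
      proof -
        have \<sigma>: "\<sigma> (i j) \<in> hom I (i j) c" using c that by blast
        show "G j \<in> hom C (OMap D j) (OMap E c)" using \<sigma> g(2)[OF that] by (auto simp: G_def hom_iff)
        show "Comp C (e c) (G j) = Comp C p (\<iota> j)"
          using E.leg_natural_comp[OF \<sigma>, of "g j"] g(2,3)[OF that] by (simp add: G_def hom_iff)
      qed
      have "\<exists>w. w \<in> Arr I \<and> Dom I w = c \<and>
          Comp C (AMap E w) (Comp C (G (Cod J u)) (AMap D u)) = Comp C (AMap E w) (G (Dom J u))"
        if u: "u \<in> Arr J" for u
      proof -
        have o: "Dom J u \<in> Obj J" "Cod J u \<in> Obj J" using u D.A.dom_obj D.A.cod_obj by auto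
        have h: "Comp C (G (Cod J u)) (AMap D u) \<in> hom C (OMap D (Dom J u)) (OMap E c)"
          using G(1)[OF o(2)] u by (auto simp: hom_iff)
        have "Comp C (e c) (Comp C (G (Cod J u)) (AMap D u)) = Comp C (Comp C (e c) (G (Cod J u))) (AMap D u)"
          using G(1)[OF o(2)] u c(1) by (simp add: hom_iff)
        also have "\<dots> = Comp C (e c) (G (Dom J u))"
          unfolding G(2)[OF o(2)] G(2)[OF o(1)] using p u o D.leg_natural[OF u] by (simp add: hom_iff)
        finally show ?thesis using fac[OF o(1)] h G(1)[OF o(1)] c(1) unfolding factorizes_def by blast
      qed
      then obtain w where w: "\<And>u. u \<in> Arr J \<Longrightarrow> w u \<in> Arr I" "\<And>u. u \<in> Arr J \<Longrightarrow> Dom I (w u) = c"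
        "\<And>u. u \<in> Arr J \<Longrightarrow>
          Comp C (AMap E (w u)) (Comp C (G (Cod J u)) (AMap D u)) = Comp C (AMap E (w u)) (G (Dom J u))" by metis
      obtain d v a where d: "d \<in> Obj I" "a \<in> hom I c d"
        "\<forall>u \<in> Arr J. v u \<in> hom I (Cod I (w u)) d \<and> Comp I (v u) (w u) = a"
        by (insert I.common_extension[where w = w, OF c(1) card w(1,2)]) blast
      have "cocone C J D (OMap E d) (\<lambda>j. Comp C (AMap E a) (G j))"
        unfolding cocone_def
      proof (intro conjI ballI)
        show "OMap E d \<in> Obj C" using d E.omap_obj by blast
        fix j assume "j \<in> Obj J" then show "Comp C (AMap E a) (G j) \<in> hom C (OMap D j) (OMap E d)"
          using d(2) G(1) by (auto simp: hom_iff)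
      next
        fix u assume u: "u \<in> Arr J"
        have o: "Dom J u \<in> Obj J" "Cod J u \<in> Obj J" using u D.A.dom_obj D.A.cod_obj by auto
        have a: "AMap E a = Comp C (AMap E (v u)) (AMap E (w u))"
          using d(3) w(1,2)[OF u] u E.amap_comp_arr[of "w u" "v u"] by (auto simp: hom_iff)
        show "Comp C (Comp C (AMap E a) (G (Cod J u))) (AMap D u) = Comp C (AMap E a) (G (Dom J u))"
          unfolding a using w(1,2,3)[OF u] d(3) u G(1)[OF o(1)] G(1)[OF o(2)] by (auto simp: hom_iff)
      qed
      then obtain h where h: "h \<in> hom C L (OMap E d)" "\<forall>j \<in> Obj J. Comp C h (\<iota> j) = Comp C (AMap E a) (G j)"
        by (rule D.induced)
      have "Comp C (e d) h = p"
      proof (rule D.joint_epi[OF _ p])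
        show "Comp C (e d) h \<in> hom C L Q" using h d(1) by (auto simp: hom_iff)
        show "\<forall>j \<in> Obj J. Comp C (Comp C (e d) h) (\<iota> j) = Comp C p (\<iota> j)"
        proof
        fix j assume j: "j \<in> Obj J"
        have "Comp C (Comp C (e d) h) (\<iota> j) = Comp C (e d) (Comp C (AMap E a) (G j))"
          using h d(1) j by (auto simp: hom_iff)
        then show "Comp C (Comp C (e d) h) (\<iota> j) = Comp C p (\<iota> j)"
          using E.leg_natural_comp[OF d(2), of "G j"] G[OF j] by (simp add: hom_iff)
        qed
      qed
      then show "\<exists>j \<in> Obj I. \<exists>g \<in> hom C L (OMap E j). Comp C (e j) g = p" using d h by blast
    next
      fix i g g' assume i: "i \<in> Obj I" and g: "g \<in> hom C L (OMap E i)" "g' \<in> hom C L (OMap E i)"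
        and eq: "Comp C (e i) g = Comp C (e i) g'"
      have "\<exists>w. w \<in> Arr I \<and> Dom I w = i \<and>
          Comp C (AMap E w) (Comp C g (\<iota> j)) = Comp C (AMap E w) (Comp C g' (\<iota> j))" if j: "j \<in> Obj J" for j
      proof -
        have "Comp C g (\<iota> j) \<in> hom C (OMap D j) (OMap E i)" "Comp C g' (\<iota> j) \<in> hom C (OMap D j) (OMap E i)"
          using g j by (auto simp: hom_iff)
        moreover have "Comp C (e i) (Comp C g (\<iota> j)) = Comp C (Comp C (e i) g) (\<iota> j)"
            "Comp C (e i) (Comp C g' (\<iota> j)) = Comp C (Comp C (e i) g') (\<iota> j)"
          using g i j by (auto simp: hom_iff)
        ultimately show ?thesis using fac[OF j] i eq unfolding factorizes_def by metis
      qed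
      then obtain w where w: "\<And>j. j \<in> Obj J \<Longrightarrow> w j \<in> Arr I" "\<And>j. j \<in> Obj J \<Longrightarrow> Dom I (w j) = i"
        "\<And>j. j \<in> Obj J \<Longrightarrow>
          Comp C (AMap E (w j)) (Comp C g (\<iota> j)) = Comp C (AMap E (w j)) (Comp C g' (\<iota> j))" by metis
      obtain d v a where d: "d \<in> Obj I" "a \<in> hom I i d"
        "\<forall>j \<in> Obj J. v j \<in> hom I (Cod I (w j)) d \<and> Comp I (v j) (w j) = a"
        by (insert I.common_extension[where w = w, OF i card' w(1,2)]) blast
      have "Comp C (AMap E a) g = Comp C (AMap E a) g'"
      proof (rule D.joint_epi[of _ "OMap E d"], goal_cases)
        case 3
        show ?case
        proof
          fix j assume j: "j \<in> Obj J"
          have a: "AMap E a = Comp C (AMap E (v j)) (AMap E (w j))"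
            using d(3) w(1,2)[OF j] j E.amap_comp_arr[of "w j" "v j"] by (auto simp: hom_iff)
          show "Comp C (Comp C (AMap E a) g) (\<iota> j) = Comp C (Comp C (AMap E a) g') (\<iota> j)"
            unfolding a using w[OF j] d(3) j g by (auto simp: hom_iff)
        qed
      qed (use g d in \<open>auto simp: hom_iff\<close>)
      then show "\<exists>u \<in> Arr I. Dom I u = i \<and> Comp C (AMap E u) g = Comp C (AMap E u) g'"
        using d by (auto simp: hom_iff)
    qed
  qed
  then show ?thesis using reg by (simp add: presentable_iff[OF inacc])
qed

lemma presentable_retract:
  fixes \<kappa> :: "'u rel"
  assumes inacc: "inaccessible_type TYPE('u)" and "category C" and P: "presentable \<kappa> C P"
    and r: "r \<in> hom C P Q" "s \<in> hom C Q P" "Comp C r s = Id C Q"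
  shows "presentable \<kappa> C Q"
proof -
  interpret category C by fact
  have Q: "Q \<in> Obj C" using hom_obj r by blast
  have "factorizes C Q J D L \<iota>" if "filtered_diagram \<kappa> C J D" "is_colimit C J D L \<iota>"
    for J :: "('u, 'u) cat" and D L \<iota>
  proof -
    have fac: "factorizes C P J D L \<iota>" using P that by (simp add: presentable_iff[OF inacc])
    interpret D: colimit J C D L \<iota> using that by (simp add: colimitI filtered_diagram_def)
    show ?thesis unfolding factorizes_def
    proof (intro conjI ballI impI)
      fix p assume p: "p \<in> hom C Q L"
      have "Comp C p r \<in> hom C P L" using p r by (auto simp: hom_iff)
      then obtain j g where g: "j \<in> Obj J" "g \<in> hom C P (OMap D j)" "Comp C (\<iota> j) g = Comp C p r"
        using fac unfolding factorizes_def by blast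
      have "Comp C (\<iota> j) (Comp C g s) = Comp C (Comp C p r) s" 
        using rewrite_left[OF g(3), of s] g(1,2) r by (simp add: hom_iff)
      also have "\<dots> = p" using p r Q by (simp add: hom_iff)
      finally have "Comp C (\<iota> j) (Comp C g s) = p" .
      then show "\<exists>j \<in> Obj J. \<exists>g \<in> hom C Q (OMap D j). Comp C (\<iota> j) g = p"
        using g r by (intro bexI[of _ j] bexI[of _ "Comp C g s"]) (auto simp: hom_iff)
    next
      fix j g g' assume j: "j \<in> Obj J" and g: "g \<in> hom C Q (OMap D j)" "g' \<in> hom C Q (OMap D j)"
        and eq: "Comp C (\<iota> j) g = Comp C (\<iota> j) g'"
      have "Comp C (\<iota> j) (Comp C g r) = Comp C (\<iota> j) (Comp C g' r)"
        using rewrite_left[OF eq, of r] g r j by (simp add: hom_iff)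
      moreover have "Comp C g r \<in> hom C P (OMap D j)" "Comp C g' r \<in> hom C P (OMap D j)" using g r by (auto simp: hom_iff)
      ultimately obtain u where u: "u \<in> Arr J" "Dom J u = j"
        "Comp C (AMap D u) (Comp C g r) = Comp C (AMap D u) (Comp C g' r)"
        using fac j unfolding factorizes_def by blast
      have "Comp C (AMap D u) (Comp C g (Comp C r s)) = Comp C (AMap D u) (Comp C g' (Comp C r s))"
        using arg_cong[OF u(3), of "\<lambda>x. Comp C x s"] u(1,2) g r(1,2) by (simp add: hom_iff)
      then have "Comp C (AMap D u) g = Comp C (AMap D u) g'" unfolding r(3) using g Q by (simp add: hom_iff)
      then show "\<exists>u \<in> Arr J. Dom J u = j \<and> Comp C (AMap D u) g = Comp C (AMap D u) g'" using u by blast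
    qed
  qed
  then show ?thesis using P Q by (simp add: presentable_iff[OF inacc])
qed

section \<open>Directed posets as index categories inside \<open>'u\<close>\<close>

definition pair_code :: "'i set \<Rightarrow> 'i \<times> 'i \<Rightarrow> 'u" where
  "pair_code I = (SOME e. inj_on e (I \<times> I))"

definition pair_decode :: "'i set \<Rightarrow> 'u \<Rightarrow> 'i \<times> 'i" where
  "pair_decode I = inv_into (I \<times> I) (pair_code I)"

text \<open>The arrow from \<open>i\<close> to \<open>j\<close> is the code of the pair, and an
  object is the code of its diagonal pair, so objects coincide with their identities. As only pairs
  are coded, \<open>I\<close> may be a small set over any type, such as a family of subsets of
  \<open>'u\<close>.\<close>

definition poset_cat :: "'i set \<Rightarrow> ('i \<Rightarrow> 'i \<Rightarrow> bool) \<Rightarrow> ('u, 'u) cat" where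
  "poset_cat I le =
     \<lparr>Obj = (\<lambda>i. pair_code I (i, i)) ` I,
      Arr = pair_code I ` {(i, j). i \<in> I \<and> j \<in> I \<and> le i j},
      Dom = (\<lambda>u. let i = fst (pair_decode I u) in pair_code I (i, i)),
      Cod = (\<lambda>u. let i = snd (pair_decode I u) in pair_code I (i, i)),
      Id = (\<lambda>x. x),
      Comp = (\<lambda>v u. pair_code I (fst (pair_decode I u), snd (pair_decode I v)))\<rparr>"

definition system_functor :: "'i set \<Rightarrow> ('i \<Rightarrow> 'o) \<Rightarrow> ('i \<Rightarrow> 'i \<Rightarrow> 'a) \<Rightarrow> ('u, 'u, 'o, 'a) func" where
  "system_functor I W t =
     \<lparr>OMap = (\<lambda>x. W (fst (pair_decode I x))),
      AMap = (\<lambda>u. t (fst (pair_decode I u)) (snd (pair_decode I u)))\<rparr>"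

definition directed_below :: "'u rel \<Rightarrow> 'i set \<Rightarrow> ('i \<Rightarrow> 'i \<Rightarrow> bool) \<Rightarrow> bool" where
  "directed_below \<kappa> I le \<longleftrightarrow> (\<forall>S. S \<subseteq> I \<longrightarrow> |S| <o \<kappa> \<longrightarrow> (\<exists>k \<in> I. \<forall>i \<in> S. le i k))"

locale directed_index =
  fixes u :: "'u itself" and I :: "'i set" and le :: "'i \<Rightarrow> 'i \<Rightarrow> bool"
  assumes inacc: "inaccessible_type TYPE('u)"
    and small: "|I| <o |UNIV :: 'u set|"
    and nonempty: "I \<noteq> {}"
    and refl: "i \<in> I \<Longrightarrow> le i i"
    and antisym: "i \<in> I \<Longrightarrow> j \<in> I \<Longrightarrow> le i j \<Longrightarrow> le j i \<Longrightarrow> i = j"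
    and trans: "i \<in> I \<Longrightarrow> j \<in> I \<Longrightarrow> k \<in> I \<Longrightarrow> le i j \<Longrightarrow> le j k \<Longrightarrow> le i k"
    and directed: "i \<in> I \<Longrightarrow> j \<in> I \<Longrightarrow> \<exists>k \<in> I. le i k \<and> le j k"
begin

abbreviation code :: "'i \<times> 'i \<Rightarrow> 'u" where "code \<equiv> pair_code I"
abbreviation J :: "('u, 'u) cat" where "J \<equiv> poset_cat I le"

lemma inj_code: "inj_on code (I \<times> I)"
proof -
  have "|I \<times> I| <o |UNIV :: 'u set|"
    using Times_ordLess_Cinfinite[OF inaccessibleD(2)[OF inacc] small small] .
  then have "|I \<times> I| \<le>o |UNIV :: 'u set|" by (rule ordLess_imp_ordLeq)
  then have "\<exists>e :: 'i \<times> 'i \<Rightarrow> 'u. inj_on e (I \<times> I)" by (auto simp: card_of_ordLeq[symmetric])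
  then show ?thesis unfolding pair_code_def by (rule someI_ex)
qed

lemma decode [simp]: "i \<in> I \<Longrightarrow> j \<in> I \<Longrightarrow> pair_decode I (code (i, j)) = (i, j)"
  using inj_code by (simp add: pair_decode_def)

lemma Obj_iff: "x \<in> Obj J \<longleftrightarrow> (\<exists>i \<in> I. x = code (i, i))"
  by (auto simp: poset_cat_def)

lemma Arr_iff: "x \<in> Arr J \<longleftrightarrow> (\<exists>i \<in> I. \<exists>j \<in> I. le i j \<and> x = code (i, j))"
  by (auto simp: poset_cat_def)

lemma J_simps [simp]:
  assumes "i \<in> I" "j \<in> I"
  shows "Dom J (code (i, j)) = code (i, i)" "Cod J (code (i, j)) = code (j, j)"
    "k \<in> I \<Longrightarrow> l \<in> I \<Longrightarrow> Comp J (code (k, l)) (code (i, j)) = code (i, l)"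
  using assms by (simp_all add: poset_cat_def)

lemma Id_J [simp]: "Id J x = x" by (simp add: poset_cat_def)

lemma code_eq_iff [simp]:
  "i \<in> I \<Longrightarrow> j \<in> I \<Longrightarrow> k \<in> I \<Longrightarrow> l \<in> I \<Longrightarrow> code (i, j) = code (k, l) \<longleftrightarrow> i = k \<and> j = l"
  using inj_onD[OF inj_code, of "(i, j)" "(k, l)"] by auto

lemma hom_J_iff: "x \<in> hom J y z \<longleftrightarrow> (\<exists>i \<in> I. \<exists>j \<in> I. le i j \<and> x = code (i, j) \<and> y = code (i, i) \<and> z = code (j, j))"
  by (auto simp: hom_iff Arr_iff)

lemma category_J: "category J"
proof unfold_locales
  fix w x y z f g h assume "f \<in> hom J w x" "g \<in> hom J x y" "h \<in> hom J y z"
  then show "Comp J h (Comp J g f) = Comp J (Comp J h g) f" by (auto simp: hom_J_iff)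
next
  fix x y z f g assume "f \<in> hom J x y" "g \<in> hom J y z"
  then obtain i j k where *: "i \<in> I" "j \<in> I" "k \<in> I" "le i j" "le j k" "x = code (i, i)" "z = code (k, k)"
    "f = code (i, j)" "g = code (j, k)" by (auto simp: hom_J_iff)
  then show "Comp J g f \<in> hom J x z" using trans[OF *(1-5)] by (simp add: hom_J_iff)
qed (auto simp: hom_J_iff Obj_iff Arr_iff refl)

lemma card_Arr_J:
  assumes "Cinfinite r" "|I| <o r" shows "|Arr J| <o r"
proof -
  have "Arr J \<subseteq> code ` (I \<times> I)" by (auto simp: poset_cat_def)
  then show ?thesis using subset_ordLess[OF image_ordLess[OF Times_ordLess_Cinfinite[OF assms assms(2)]]] by blast
qed

lemma small_category_J: "small_category J"
  using category_J card_Arr_J[OF inaccessibleD(2)[OF inacc] small] by (simp add: small_category_def)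

lemma directed_poset_J: "directed_poset J"
  unfolding directed_poset_def
proof (intro conjI allI impI ballI)
  fix x y assume "x \<in> Obj J" "y \<in> Obj J"
  then obtain i j where ij: "i \<in> I" "j \<in> I" "x = code (i, i)" "y = code (j, j)" by (auto simp: Obj_iff)
  then obtain k where k: "k \<in> I" "le i k" "le j k" using directed by blast
  show "\<exists>z. hom J x z \<noteq> {} \<and> hom J y z \<noteq> {}"
    using ij k by (intro exI[of _ "code (k, k)"]) (auto simp: hom_J_iff ex_in_conv[symmetric])
qed (use category_J nonempty antisym in \<open>auto simp: hom_J_iff Obj_iff ex_in_conv[symmetric]\<close>)

lemma filtered_J:
  fixes \<kappa> :: "'u rel"
  assumes "regular_cardinal \<kappa>" "directed_below \<kappa> I le" shows "filtered \<kappa> J"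
proof (rule filtered_if_bounds[OF category_J])
  fix P assume P: "P \<subseteq> Arr J" "|P| <o \<kappa>"
  let ?S = "(\<lambda>x. fst (pair_decode I x)) ` P \<union> (\<lambda>x. snd (pair_decode I x)) ` P"
  have "|?S| <o \<kappa>" using image_ordLess[OF P(2)] regular_cardinalD(1)[OF assms(1)]
    by (intro Un_Cinfinite_bound_strict) auto
  moreover have "?S \<subseteq> I" using P(1) by (fastforce simp: Arr_iff)
  ultimately obtain k where k: "k \<in> I" "\<forall>i \<in> ?S. le i k"
    using assms(2) unfolding directed_below_def by metis
  have "bound J P (code (k, k)) (\<lambda>x. code (fst (pair_decode I x), k))"
    unfolding bound_def
  proof (intro conjI ballI)
    fix x assume x: "x \<in> P"
    then obtain i j where ij: "i \<in> I" "j \<in> I" "x = code (i, j)" "le i j" using P(1) by (fastforce simp: Arr_iff)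
    then have "i \<in> ?S" "j \<in> ?S" using x by force+
    then have "le i k" "le j k" using k by blast+
    then show "code (fst (pair_decode I (Dom J x)), k) \<in> hom J (Dom J x) (code (k, k))"
      "code (fst (pair_decode I (Cod J x)), k) \<in> hom J (Cod J x) (code (k, k))"
      "Comp J (code (fst (pair_decode I (Cod J x)), k)) x = code (fst (pair_decode I (Dom J x)), k)"
      using ij k(1) by (auto simp: hom_J_iff)
  qed (use k Obj_iff in blast)
  then show "\<exists>c \<tau>. bound J P c \<tau>" by blast
qed

lemma directed_below_aleph0: "directed_below (aleph0 :: 'u rel) I le"
  unfolding directed_below_def
proof (intro allI impI)
  fix S assume S: "S \<subseteq> I" "|S| <o (aleph0 :: 'u rel)"
  then have "|S| <o natLeq" using aleph0_natLeq[OF inacc] ordLess_ordIso_trans by blast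
  then have "finite S" by (simp add: finite_iff_ordLess_natLeq)
  then show "\<exists>k \<in> I. \<forall>i \<in> S. le i k" using S(1)
  proof (induction S)
    case empty then show ?case using nonempty by blast
  next
    case (insert x S)
    then obtain k where k: "k \<in> I" "\<forall>i \<in> S. le i k" by blast
    then obtain l where "l \<in> I" "le k l" "le x l" using directed[OF k(1), of x] insert(4) by blast
    then show ?case using k insert(4) trans[OF _ k(1), of _ l] by (intro bexI[of _ l]) blast+
  qed
qed

end

text \<open>Cocones and colimits indexed by the poset itself, without codes;
  \<open>cocone_iff\<close> and \<open>is_colimit_iff\<close> translate.\<close>

definition system_cocone where
  "system_cocone C I le W t Q c \<longleftrightarrow> Q \<in> Obj C \<and> (\<forall>i \<in> I. c i \<in> hom C (W i) Q) \<and>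
     (\<forall>i \<in> I. \<forall>j \<in> I. le i j \<longrightarrow> Comp C (c j) (t i j) = c i)"

definition system_colimit where
  "system_colimit C I le W t Q c \<longleftrightarrow> system_cocone C I le W t Q c \<and>
     (\<forall>M d. system_cocone C I le W t M d \<longrightarrow>
       (\<exists>!h. h \<in> hom C Q M \<and> (\<forall>i \<in> I. Comp C h (c i) = d i)))"

locale directed_system = directed_index u I le + category C
  for u :: "'u itself" and I :: "'i set" and le and C :: "('o, 'a) cat" +
  fixes W :: "'i \<Rightarrow> 'o" and t :: "'i \<Rightarrow> 'i \<Rightarrow> 'a"
  assumes obj: "i \<in> I \<Longrightarrow> W i \<in> Obj C"
    and map_hom: "i \<in> I \<Longrightarrow> j \<in> I \<Longrightarrow> le i j \<Longrightarrow> t i j \<in> hom C (W i) (W j)"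
    and map_id: "i \<in> I \<Longrightarrow> t i i = Id C (W i)"
    and map_comp: "i \<in> I \<Longrightarrow> j \<in> I \<Longrightarrow> k \<in> I \<Longrightarrow> le i j \<Longrightarrow> le j k \<Longrightarrow> Comp C (t j k) (t i j) = t i k"
begin

abbreviation D :: "('u, 'u, 'o, 'a) func" where "D \<equiv> system_functor I W t"

lemma D_simps [simp]:
  assumes "i \<in> I" "j \<in> I" shows "OMap D (code (i, j)) = W i" "AMap D (code (i, j)) = t i j"
  using assms by (simp_all add: system_functor_def)

lemma functor_D: "is_functor J C D"
proof -
  interpret J: category J by (rule category_J)
  show ?thesis
  proof unfold_locales
    fix f g x y z assume "f \<in> hom J x y" "g \<in> hom J y z"
    then show "AMap D (Comp J g f) = Comp C (AMap D g) (AMap D f)"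
      using map_comp by (auto simp: hom_J_iff)
  qed (use obj map_hom map_id in \<open>auto simp: Obj_iff hom_J_iff\<close>)
qed

lemma filtered_diagram_D:
  fixes \<kappa> :: "'u rel"
  shows "regular_cardinal \<kappa> \<Longrightarrow> directed_below \<kappa> I le \<Longrightarrow> filtered_diagram \<kappa> C J D"
  by (simp add: filtered_diagram_def small_category_J filtered_J functor_D)

lemma filtered_diagram_aleph0: "filtered_diagram (aleph0 :: 'u rel) C J D"
  by (rule filtered_diagram_D[OF regular_aleph0[OF inacc] directed_below_aleph0])

lemma cocone_iff: "cocone C J D Q \<iota> \<longleftrightarrow> system_cocone C I le W t Q (\<lambda>i. \<iota> (code (i, i)))"
proof
  assume c: "cocone C J D Q \<iota>"
  show "system_cocone C I le W t Q (\<lambda>i. \<iota> (code (i, i)))" unfolding system_cocone_def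
  proof (intro conjI ballI impI)
    fix i assume "i \<in> I" then show "\<iota> (code (i, i)) \<in> hom C (W i) Q"
      using c D_simps Obj_iff unfolding cocone_def by metis
  next
    fix i j assume "i \<in> I" "j \<in> I" "le i j"
    then have "code (i, j) \<in> Arr J" by (auto simp: Arr_iff)
    then have "Comp C (\<iota> (Cod J (code (i, j)))) (AMap D (code (i, j))) = \<iota> (Dom J (code (i, j)))"
      using c unfolding cocone_def by blast
    then show "Comp C (\<iota> (code (j, j))) (t i j) = \<iota> (code (i, i))" using \<open>i \<in> I\<close> \<open>j \<in> I\<close> by simp
  qed (use c in \<open>simp add: cocone_def\<close>)
qed (auto simp: cocone_def system_cocone_def Obj_iff Arr_iff)

lemma is_colimit_iff: "is_colimit C J D Q \<iota> \<longleftrightarrow> system_colimit C I le W t Q (\<lambda>i. \<iota> (code (i, i)))"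
proof -
  have ball: "(\<forall>x \<in> Obj J. Comp C h (\<iota> x) = d x) \<longleftrightarrow> (\<forall>i \<in> I. Comp C h (\<iota> (code (i, i))) = d (code (i, i)))" for h d
    by (auto simp: Obj_iff)
  have "(\<forall>M d. system_cocone C I le W t M (\<lambda>i. d (code (i, i))) \<longrightarrow>
        (\<exists>!h. h \<in> hom C Q M \<and> (\<forall>i \<in> I. Comp C h (\<iota> (code (i, i))) = d (code (i, i))))) \<longleftrightarrow>
      (\<forall>M d. system_cocone C I le W t M d \<longrightarrow>
        (\<exists>!h. h \<in> hom C Q M \<and> (\<forall>i \<in> I. Comp C h (\<iota> (code (i, i))) = d i)))" (is "?l \<longleftrightarrow> ?r")
  proof
    assume l: ?l
    show ?r
    proof (intro allI impI)
      fix M d assume d: "system_cocone C I le W t M d"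
      let ?d = "\<lambda>x. d (fst (pair_decode I x))"
      have e: "?d (code (i, i)) = d i" if "i \<in> I" for i using that by simp
      have "system_cocone C I le W t M (\<lambda>i. ?d (code (i, i)))" using d e by (simp add: system_cocone_def)
      then have "\<exists>!h. h \<in> hom C Q M \<and> (\<forall>i \<in> I. Comp C h (\<iota> (code (i, i))) = ?d (code (i, i)))"
        using l[THEN spec, THEN spec[of _ ?d], of M] by blast
      then show "\<exists>!h. h \<in> hom C Q M \<and> (\<forall>i \<in> I. Comp C h (\<iota> (code (i, i))) = d i)" using e by simp
    qed
  qed blast
  then show ?thesis unfolding is_colimit_def system_colimit_def cocone_iff ball by (simp only:)
qed

lemma system_colimit_iff: "system_colimit C I le W t Q c \<longleftrightarrow> is_colimit C J D Q (\<lambda>x. c (fst (pair_decode I x)))"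
proof -
  have "system_cocone C I le W t Q (\<lambda>i. c (fst (pair_decode I (code (i, i))))) = system_cocone C I le W t Q c"
    by (simp add: system_cocone_def)
  moreover have "(\<forall>i \<in> I. Comp C h (c (fst (pair_decode I (code (i, i))))) = d i) \<longleftrightarrow> (\<forall>i \<in> I. Comp C h (c i) = d i)" for h d
    by simp
  ultimately show ?thesis unfolding is_colimit_iff system_colimit_def by simp
qed

lemma colimit_exists:
  assumes "has_filtered_colimits TYPE('u) C" shows "\<exists>Q c. system_colimit C I le W t Q c"
  using assms filtered_diagram_aleph0 is_colimit_iff
  unfolding has_filtered_colimits_def has_filtered_colimits_at_def by blast

lemma image_system:
  assumes "is_functor C B F" shows "directed_system TYPE('u) I le B (OMap F \<circ> W) (\<lambda>i j. AMap F (t i j))"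
proof -
  interpret F: is_functor C B F by fact
  show ?thesis
  proof unfold_locales
    fix i j k assume "i \<in> I" "j \<in> I" "k \<in> I" "le i j" "le j k"
    then show "Comp B (AMap F (t j k)) (AMap F (t i j)) = AMap F (t i k)"
      using F.amap_comp[OF map_hom map_hom] map_comp by metis
  qed (auto simp: obj F.omap_obj F.amap_hom map_hom map_id F.amap_id)
qed

lemma colimit_preserved:
  assumes "is_functor C B F" "preserves_filtered_colimits TYPE('u) C B F" "system_colimit C I le W t Q c"
  shows "system_colimit B I le (OMap F \<circ> W) (\<lambda>i j. AMap F (t i j)) (OMap F Q) (\<lambda>i. AMap F (c i))"
proof -
  interpret S: directed_system "TYPE('u)" I le B "OMap F \<circ> W" "\<lambda>i j. AMap F (t i j)" using image_system[OF assms(1)] .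
  have "is_colimit B J (func_comp F D) (OMap F Q) (\<lambda>x. AMap F (c (fst (pair_decode I x))))"
    using assms(2,3) filtered_diagram_aleph0 unfolding preserves_filtered_colimits_def system_colimit_iff by blast
  moreover have "func_comp F D = S.D" by (simp add: func_comp_def system_functor_def o_def)
  ultimately show ?thesis unfolding S.system_colimit_iff by simp
qed

context
  fixes Q c assumes col: "system_colimit C I le W t Q c"
begin

interpretation L: colimit J C D Q "\<lambda>x. c (fst (pair_decode I x))"
  using col functor_D by (simp add: colimitI system_colimit_iff)

lemma sys_tip: "Q \<in> Obj C" by (rule L.tip)

lemma sys_leg: "i \<in> I \<Longrightarrow> c i \<in> hom C (W i) Q"
  using col by (simp add: system_colimit_def system_cocone_def)

lemma sys_natural: "i \<in> I \<Longrightarrow> j \<in> I \<Longrightarrow> le i j \<Longrightarrow> Comp C (c j) (t i j) = c i"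
  using col by (simp add: system_colimit_def system_cocone_def)

lemma sys_induced:
  assumes "system_cocone C I le W t M d" obtains h where "h \<in> hom C Q M" "\<forall>i \<in> I. Comp C h (c i) = d i"
  using col assms unfolding system_colimit_def by blast

lemma sys_joint_epi:
  assumes "h \<in> hom C Q M" "h' \<in> hom C Q M" "\<forall>i \<in> I. Comp C h (c i) = Comp C h' (c i)" shows "h = h'"
proof (rule L.joint_epi[OF assms(1,2)])
  show "\<forall>x \<in> Obj J. Comp C h (c (fst (pair_decode I x))) = Comp C h' (c (fst (pair_decode I x)))"
    using assms(3) by (auto simp: Obj_iff)
qed

lemma sys_presentable:
  fixes \<kappa> :: "'u rel"
  assumes "regular_cardinal \<kappa>" "|I| <o \<kappa>" "\<forall>i \<in> I. presentable \<kappa> C (W i)" shows "presentable \<kappa> C Q"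
  using assms card_Arr_J[OF regular_cardinalD(1)[OF assms(1)] assms(2)]
  by (intro presentable_colimit[OF inacc L.colimit_axioms assms(1)]) (auto simp: Obj_iff)

lemma sys_factor:
  fixes \<kappa> :: "'u rel"
  assumes "presentable \<kappa> C P" "directed_below \<kappa> I le" "p \<in> hom C P Q"
  obtains i g where "i \<in> I" "g \<in> hom C P (W i)" "Comp C (c i) g = p"
proof -
  have "factorizes C P J D Q (\<lambda>x. c (fst (pair_decode I x)))"
    using assms(1) filtered_diagram_D[OF _ assms(2)] L.colim unfolding presentable_iff[OF inacc] by blast
  then obtain x g where "x \<in> Obj J" "g \<in> hom C P (OMap D x)" "Comp C (c (fst (pair_decode I x))) g = p"
    using assms(3) unfolding factorizes_def by blast
  then show ?thesis using that by (auto simp: Obj_iff)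
qed

lemma sys_factor_eq:
  fixes \<kappa> :: "'u rel"
  assumes "presentable \<kappa> C P" "directed_below \<kappa> I le" "i \<in> I" "g \<in> hom C P (W i)" "g' \<in> hom C P (W i)"
    "Comp C (c i) g = Comp C (c i) g'"
  obtains j where "j \<in> I" "le i j" "Comp C (t i j) g = Comp C (t i j) g'"
proof -
  have "factorizes C P J D Q (\<lambda>x. c (fst (pair_decode I x)))"
    using assms(1) filtered_diagram_D[OF _ assms(2)] L.colim unfolding presentable_iff[OF inacc] by blast
  moreover have "code (i, i) \<in> Obj J" using assms(3) by (auto simp: Obj_iff)
  moreover have "g \<in> hom C P (OMap D (code (i, i)))" "g' \<in> hom C P (OMap D (code (i, i)))"
    "Comp C (c (fst (pair_decode I (code (i, i))))) g = Comp C (c (fst (pair_decode I (code (i, i))))) g'"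
    using assms by simp_all
  ultimately obtain x where "x \<in> Arr J" "Dom J x = code (i, i)" "Comp C (AMap D x) g = Comp C (AMap D x) g'"
    unfolding factorizes_def by blast
  then show ?thesis using that assms(3) by (auto simp: Arr_iff)
qed

end

end

section \<open>Small subdiagrams\<close>

text \<open>A filtered diagram is the directed union of its small filtered subdiagrams.  The latter are
  given by sets of arrows closed under finitary operations, which make them filtered
  subcategories and satisfy whatever else the parameter \<open>extra\<close> encodes.\<close>

definition subdiagram :: "('o, 'a) cat \<Rightarrow> 'a set \<Rightarrow> ('o, 'a) cat" where
  "subdiagram J M = J\<lparr>Obj := Dom J ` M, Arr := M\<rparr>"

locale presentation = colimit J C D L \<iota>
  for J :: "('u, 'u) cat" and C :: "('o, 'a) cat" and D L \<iota> +
  fixes extra :: "'u list \<Rightarrow> 'u set"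
  assumes inacc: "inaccessible_type TYPE('u)"
    and filtered_colimits: "has_filtered_colimits TYPE('u) C"
    and diag: "filtered_diagram (aleph0 :: 'u rel) C J D"
    and extra: "l \<in> lists (Arr J) \<Longrightarrow> extra l \<subseteq> Arr J"
begin

interpretation J: filtered_category J aleph0
  by (rule filtered_diagram_category[OF diag regular_aleph0[OF inacc]])

definition apex :: "'u set \<Rightarrow> 'u" where
  "apex P = (SOME c. \<exists>\<tau>. bound J P c \<tau>)"

definition apex_leg :: "'u set \<Rightarrow> 'u \<Rightarrow> 'u" where
  "apex_leg P = (SOME \<tau>. bound J P (apex P) \<tau>)"

lemma bound_apex: "P \<subseteq> Arr J \<Longrightarrow> finite P \<Longrightarrow> bound J P (apex P) (apex_leg P)"
  using J.bounded[of P] finite_ordLess_Cinfinite[of P] J.regularD(1)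
  unfolding apex_leg_def apex_def by (metis (mono_tags, lifting) someI_ex)

text \<open>Lists stand for finite sets of arrows, so that \<open>lists_ordLess\<close> bounds the
  number of operations. The identity of the apex is included because the objects of a subdiagram are
  the domains of its arrows; applied to the empty list it makes closed sets nonempty.\<close>

definition ops :: "'u list \<Rightarrow> 'u set" where
  "ops l = (\<lambda>a. Id J (Dom J a)) ` set l \<union> (\<lambda>a. Id J (Cod J a)) ` set l
     \<union> (\<lambda>(g, f). Comp J g f) ` {(g, f). g \<in> set l \<and> f \<in> set l \<and> Cod J f = Dom J g}
     \<union> insert (Id J (apex (set l))) (apex_leg (set l) ` (Dom J ` set l \<union> Cod J ` set l))
     \<union> extra l"

definition closed :: "'u set \<Rightarrow> bool" where
  "closed M \<longleftrightarrow> M \<subseteq> Arr J \<and> (\<forall>l \<in> lists M. ops l \<subseteq> M)"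

lemma ops_Arr: "l \<in> lists (Arr J) \<Longrightarrow> ops l \<subseteq> Arr J"
proof -
  assume l: "l \<in> lists (Arr J)"
  then have P: "a \<in> Arr J" if "a \<in> set l" for a using that by auto
  have b: "bound J (set l) (apex (set l)) (apex_leg (set l))" using bound_apex[of "set l"] P by auto
  then have "apex_leg (set l) (Dom J a) \<in> Arr J" "apex_leg (set l) (Cod J a) \<in> Arr J" if "a \<in> set l" for a
    using that by (auto simp: bound_def hom_iff)
  moreover have "Id J (apex (set l)) \<in> Arr J" using b by (simp add: bound_def)
  moreover have "Id J (Dom J a) \<in> Arr J" "Id J (Cod J a) \<in> Arr J" if "a \<in> set l" for a
    using P[OF that] A.dom_obj A.cod_obj by simp_all
  ultimately show ?thesis unfolding ops_def using P extra[OF l]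
    by (intro Un_least insert_subsetI image_subsetI) auto
qed

lemma closed_Arr: "closed (Arr J)"
  using ops_Arr by (simp add: closed_def)

lemma closedD: "closed M \<Longrightarrow> M \<subseteq> Arr J" "closed M \<Longrightarrow> l \<in> lists M \<Longrightarrow> ops l \<subseteq> M"
  by (auto simp: closed_def)

text \<open>A list mentions finitely many arrows, so one member of the directed family contains them
  all.\<close>

lemma closed_Union:
  assumes "\<And>M. M \<in> \<M> \<Longrightarrow> closed M" "\<M> \<noteq> {}"
    and "\<And>M N. M \<in> \<M> \<Longrightarrow> N \<in> \<M> \<Longrightarrow> \<exists>K \<in> \<M>. M \<union> N \<subseteq> K"
  shows "closed (\<Union>\<M>)"
  unfolding closed_def
proof (intro conjI ballI)
  fix l assume l: "l \<in> lists (\<Union>\<M>)"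
  then have "\<exists>K \<in> \<M>. l \<in> lists K"
  proof (induction l)
    case Nil then show ?case using assms(2) by auto
  next
    case (Cons a l)
    then obtain K N where K: "K \<in> \<M>" "l \<in> lists K" "N \<in> \<M>" "a \<in> N" by auto
    then obtain K' where "K' \<in> \<M>" "K \<union> N \<subseteq> K'" using assms(3) by blast
    then show ?case using K lists_mono[of K K'] by (intro bexI[of _ K']) auto
  qed
  then show "ops l \<subseteq> \<Union>\<M>" using assms(1) closedD(2) by blast
qed (use assms(1) closedD(1) in blast)

lemma closed_nonempty: "closed M \<Longrightarrow> M \<noteq> {}"
  using closedD(2)[of M "[]"] by (auto simp: ops_def)

text \<open>What \<open>\<kappa>\<close> has to satisfy for closures of sets of size below \<open>\<kappa>\<close> to have size below \<open>\<kappa>\<close>.\<close>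

definition ample :: "'u rel \<Rightarrow> bool" where
  "ample \<kappa> \<longleftrightarrow> regular_cardinal \<kappa> \<and> natLeq <o \<kappa> \<and> (\<forall>l \<in> lists (Arr J). |extra l| <o \<kappa>)"

lemma ampleD: "ample \<kappa> \<Longrightarrow> regular_cardinal \<kappa>" "ample \<kappa> \<Longrightarrow> natLeq <o \<kappa>"
  "ample \<kappa> \<Longrightarrow> Cinfinite \<kappa>" "ample \<kappa> \<Longrightarrow> stable \<kappa>"
  by (auto simp: ample_def regular_cardinalD)

lemma card_ops:
  assumes "ample \<kappa>" "l \<in> lists (Arr J)" shows "|ops l| <o \<kappa>"
proof -
  have "{(g, f). g \<in> set l \<and> f \<in> set l \<and> Cod J f = Dom J g} \<subseteq> set l \<times> set l" by blast
  then have "finite {(g, f). g \<in> set l \<and> f \<in> set l \<and> Cod J f = Dom J g}"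
    using finite_subset by blast
  moreover have "|extra l| <o \<kappa>" using assms by (simp add: ample_def)
  ultimately show ?thesis unfolding ops_def
    by (intro Un_Cinfinite_bound_strict[OF finite_ordLess_Cinfinite[OF _ ampleD(3)[OF assms(1)]] _
      ampleD(3)[OF assms(1)]]) auto
qed

text \<open>The closure is reached after countably many steps; regularity and uncountability of
  \<open>\<kappa>\<close> keep their union below \<open>\<kappa>\<close>. Closing up inside a given
  closed \<open>N\<close> allows subdiagrams to be decomposed like the whole diagram.\<close>

lemma ex_closure:
  assumes \<kappa>: "ample \<kappa>" and N: "closed N" and Z: "Z \<subseteq> N" "|Z| <o \<kappa>"
  obtains M where "closed M" "Z \<subseteq> M" "M \<subseteq> N" "|M| <o \<kappa>"
proof -
  define step where "step M = M \<union> (\<Union>l \<in> lists M. ops l)" for M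
  define E where "E n = (step ^^ n) Z" for n
  have E: "E 0 = Z" "E (Suc n) = step (E n)" for n by (simp_all add: E_def)
  have mono: "E n \<subseteq> E m" if "n \<le> m" for n m
    by (rule lift_Suc_mono_le[OF _ that]) (auto simp: E step_def)
  have sub: "E n \<subseteq> N" for n
  proof (induction n)
    case (Suc n)
    have "lists (E n) \<subseteq> lists N" using Suc by (rule lists_mono)
    then show ?case unfolding E step_def using Suc closedD(2)[OF N] by blast
  qed (simp add: E Z)
  have "|E n| <o \<kappa>" for n
  proof (induction n)
    case (Suc n)
    have "|ops l| <o \<kappa>" if "l \<in> lists (E n)" for l
      using card_ops[OF \<kappa>] that sub[of n] closedD(1)[OF N] lists_mono by blast
    then have "|\<Union>l \<in> lists (E n). ops l| <o \<kappa>"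
      by (intro stable_UNION ampleD[OF \<kappa>] lists_ordLess[OF ampleD(3)[OF \<kappa>] ampleD(2)[OF \<kappa>]] Suc)
    then show ?case unfolding E step_def by (intro Un_Cinfinite_bound_strict Suc ampleD(3)[OF \<kappa>])
  qed (simp add: E Z)
  moreover have "|UNIV :: nat set| <o \<kappa>" using card_of_nat ampleD(2)[OF \<kappa>] ordIso_ordLess_trans by blast
  ultimately have "|\<Union>n. E n| <o \<kappa>" by (intro stable_UNION ampleD(4)[OF \<kappa>])
  moreover have "closed (\<Union>n. E n)" unfolding closed_def
  proof (intro conjI ballI)
    fix l assume "l \<in> lists (\<Union>n. E n)"
    then have "\<exists>n. l \<in> lists (E n)"
    proof (induction l)
      case (Cons a l)
      then obtain n m where nm: "l \<in> lists (E n)" "a \<in> E m" by auto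
      have "lists (E n) \<subseteq> lists (E (max n m))" "E m \<subseteq> E (max n m)" by (intro lists_mono mono; simp)+
      then show ?case using nm by (intro exI[of _ "max n m"]) auto
    qed simp
    then obtain n where "l \<in> lists (E n)" ..
    then have "ops l \<subseteq> E (Suc n)" by (auto simp: E step_def)
    then show "ops l \<subseteq> (\<Union>n. E n)" by blast
  qed (use sub closedD(1)[OF N] in blast)
  moreover have "Z \<subseteq> (\<Union>n. E n)" using E(1) by blast
  moreover have "(\<Union>n. E n) \<subseteq> N" using sub by blast
  ultimately show ?thesis using that by blast
qed

abbreviation sub :: "'u set \<Rightarrow> ('u, 'u) cat" where "sub \<equiv> subdiagram J"

lemma sub_simps [simp]: "Obj (sub M) = Dom J ` M" "Arr (sub M) = M" "Dom (sub M) = Dom J"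
  "Cod (sub M) = Cod J" "Id (sub M) = Id J" "Comp (sub M) = Comp J"
  by (simp_all add: subdiagram_def)

lemma hom_sub: "f \<in> hom (sub M) x y \<longleftrightarrow> f \<in> M \<and> Dom J f = x \<and> Cod J f = y"
  by (simp add: hom_iff)

context
  fixes M assumes M: "closed M"
begin

lemma closed_id: "a \<in> M \<Longrightarrow> Id J (Dom J a) \<in> M" "a \<in> M \<Longrightarrow> Id J (Cod J a) \<in> M"
  using closedD(2)[OF M, of "[a]"] by (auto simp: ops_def)

lemma closed_comp: "f \<in> M \<Longrightarrow> g \<in> M \<Longrightarrow> Cod J f = Dom J g \<Longrightarrow> Comp J g f \<in> M"
  using closedD(2)[OF M, of "[f, g]"] by (auto simp: ops_def)

lemma closed_cod: "a \<in> M \<Longrightarrow> Cod J a \<in> Dom J ` M"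
  using closed_id(2)[of a] A.id_simps(2)[of "Cod J a"] A.cod_obj closedD(1)[OF M] by (metis image_eqI subsetD)

lemma category_sub: "category (sub M)"
proof unfold_locales
  fix x assume "x \<in> Obj (sub M)"
  then obtain a where "a \<in> M" "x = Dom J a" by auto
  then show "Id (sub M) x \<in> hom (sub M) x x"
    using closed_id(1) closedD(1)[OF M] A.dom_obj by (auto simp: hom_sub)
qed (use closedD(1)[OF M] in \<open>auto simp: hom_sub closed_comp closed_cod subset_iff\<close>)

lemma filtered_sub: "filtered (aleph0 :: 'u rel) (sub M)"
proof (rule filtered_if_bounds[OF category_sub])
  fix P assume P: "P \<subseteq> Arr (sub M)" "|P| <o (aleph0 :: 'u rel)"
  then have "finite P" using aleph0_natLeq[OF inacc] ordLess_ordIso_trans finite_iff_ordLess_natLeq by blast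
  then obtain l where l: "set l = P" using finite_list by blast
  then have o: "ops l \<subseteq> M" using P closedD(2)[OF M] by auto
  have b: "bound J P (apex P) (apex_leg P)" using bound_apex \<open>finite P\<close> P closedD(1)[OF M] by auto
  have "Id J (apex P) \<in> M" using o l by (auto simp: ops_def)
  then have "apex P \<in> Dom J ` M" using b A.id_simps(2) unfolding bound_def by (metis image_eqI)
  moreover have "apex_leg P (Dom J a) \<in> M" "apex_leg P (Cod J a) \<in> M" if "a \<in> P" for a
    using o that unfolding l[symmetric] by (auto simp: ops_def)
  ultimately have "bound (sub M) P (apex P) (apex_leg P)"
    using b by (auto simp: bound_def hom_iff)
  then show "\<exists>c \<tau>. bound (sub M) P c \<tau>" by blast
qed

lemma functor_sub: "is_functor (sub M) C D"
proof -
  interpret S: category "sub M" by (rule category_sub)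
  show ?thesis
  proof unfold_locales
    fix f g x y z assume "f \<in> hom (sub M) x y" "g \<in> hom (sub M) y z"
    then show "AMap D (Comp (sub M) g f) = Comp C (AMap D g) (AMap D f)"
      using amap_comp_arr[of f g] closedD(1)[OF M] by (auto simp: hom_sub)
  qed (use closedD(1)[OF M] A.dom_obj in \<open>auto simp: omap_obj hom_iff subset_iff amap_id\<close>)
qed

lemma card_sub: "|M| <o |UNIV :: 'u set|"
  using diag subset_ordLess[OF _ closedD(1)[OF M]] by (auto simp: filtered_diagram_def small_category_def)

lemma filtered_diagram_sub: "filtered_diagram (aleph0 :: 'u rel) C (sub M) D"
  using category_sub filtered_sub functor_sub card_sub by (simp add: filtered_diagram_def small_category_def)

lemma ex_colimit_sub: "\<exists>Q c. is_colimit C (sub M) D Q c"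
  using filtered_diagram_sub filtered_colimits unfolding has_filtered_colimits_def has_filtered_colimits_at_def by blast

end

definition cob :: "'u set \<Rightarrow> 'o" where
  "cob M = (SOME Q. \<exists>c. is_colimit C (sub M) D Q c)"

definition cleg :: "'u set \<Rightarrow> 'u \<Rightarrow> 'a" where
  "cleg M = (SOME c. is_colimit C (sub M) D (cob M) c)"

lemma colimit_cob: "closed M \<Longrightarrow> colimit (sub M) C D (cob M) (cleg M)"
  using ex_colimit_sub[of M] functor_sub[of M] unfolding cleg_def cob_def
  by (intro colimitI) (metis (mono_tags, lifting) someI_ex)+

lemma presentable_cob:
  fixes \<kappa> :: "'u rel"
  assumes "closed M" "|M| <o \<kappa>" "regular_cardinal \<kappa>" "\<forall>j \<in> Obj J. presentable \<kappa> C (OMap D j)"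
  shows "presentable \<kappa> C (cob M)"
  using presentable_colimit[OF inacc colimit_cob[OF assms(1)] assms(3)] assms closedD(1)[OF assms(1)] A.dom_obj
  by auto

text \<open>The mediating morphism out of the chosen colimit over \<open>M\<close>. With the legs of
  a larger subdiagram it becomes the transition \<open>tr\<close>, with the legs of the whole
  diagram the map \<open>s\<close> to \<open>X\<close>.\<close>

definition comparison :: "'u set \<Rightarrow> 'o \<Rightarrow> ('u \<Rightarrow> 'a) \<Rightarrow> 'a" where
  "comparison M Q c = (SOME h. h \<in> hom C (cob M) Q \<and> (\<forall>j \<in> Dom J ` M. Comp C h (cleg M j) = c j))"

lemma comparison:
  assumes "closed M" "M \<subseteq> N" "cocone C (sub N) D Q c"
  shows "comparison M Q c \<in> hom C (cob M) Q" "j \<in> Dom J ` M \<Longrightarrow> Comp C (comparison M Q c) (cleg M j) = c j"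
proof -
  interpret M: colimit "sub M" C D "cob M" "cleg M" by (rule colimit_cob[OF assms(1)])
  have "cocone C (sub M) D Q c" using assms(2,3) by (auto simp: cocone_def)
  then have "\<exists>h. h \<in> hom C (cob M) Q \<and> (\<forall>j \<in> Dom J ` M. Comp C h (cleg M j) = c j)"
    using M.induced by (metis sub_simps(1))
  then have "comparison M Q c \<in> hom C (cob M) Q \<and> (\<forall>j \<in> Dom J ` M. Comp C (comparison M Q c) (cleg M j) = c j)"
    unfolding comparison_def by (rule someI_ex)
  then show "comparison M Q c \<in> hom C (cob M) Q" "j \<in> Dom J ` M \<Longrightarrow> Comp C (comparison M Q c) (cleg M j) = c j"
    by blast+
qed

lemma cob_ext:
  assumes "closed M" "h \<in> hom C (cob M) Q" "h' \<in> hom C (cob M) Q"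
    "\<And>j. j \<in> Dom J ` M \<Longrightarrow> Comp C h (cleg M j) = Comp C h' (cleg M j)"
  shows "h = h'"
  using colimit.joint_epi[OF colimit_cob[OF assms(1)] assms(2,3)] assms(4) by simp

definition tr :: "'u set \<Rightarrow> 'u set \<Rightarrow> 'a" where "tr M N = comparison M (cob N) (cleg N)"

lemma tr:
  assumes "closed M" "closed N" "M \<subseteq> N"
  shows "tr M N \<in> hom C (cob M) (cob N)" "j \<in> Dom J ` M \<Longrightarrow> Comp C (tr M N) (cleg M j) = cleg N j"
  using comparison[OF assms(1,3) colimit.cocone[OF colimit_cob[OF assms(2)]]] by (simp_all add: tr_def)

lemma cleg_hom: "closed M \<Longrightarrow> j \<in> Dom J ` M \<Longrightarrow> cleg M j \<in> hom C (OMap D j) (cob M)"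
  using colimit.leg_hom[OF colimit_cob] by fastforce

lemma tr_comparison:
  assumes "closed M" "closed N" "M \<subseteq> N" "N \<subseteq> K" "cocone C (sub K) D Q c"
  shows "Comp C (comparison N Q c) (tr M N) = comparison M Q c"
proof (rule cob_ext[OF assms(1)])
  note N = comparison[OF assms(2,4,5)] and M = comparison[OF assms(1) order_trans[OF assms(3,4)] assms(5)]
  note t = tr[OF assms(1-3)]
  show "Comp C (comparison N Q c) (tr M N) \<in> hom C (cob M) Q" "comparison M Q c \<in> hom C (cob M) Q"
    using N(1) M(1) t(1) by (auto simp: hom_iff)
  fix j assume j: "j \<in> Dom J ` M"
  then have "j \<in> Dom J ` N" using assms(3) by blast
  then show "Comp C (Comp C (comparison N Q c) (tr M N)) (cleg M j) = Comp C (comparison M Q c) (cleg M j)"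
    using N(1) N(2)[of j] M(2)[OF j] t(1) t(2)[OF j] cleg_hom[OF assms(1) j] by (simp add: hom_iff)
qed

lemma tr_comp:
  "closed M \<Longrightarrow> closed N \<Longrightarrow> closed K \<Longrightarrow> M \<subseteq> N \<Longrightarrow> N \<subseteq> K \<Longrightarrow> Comp C (tr N K) (tr M N) = tr M K"
  using tr_comparison[of M N K "cob K" "cleg K"] colimit.cocone[OF colimit_cob] by (simp add: tr_def)

lemma cob_obj: "closed M \<Longrightarrow> cob M \<in> Obj C"
  using colimit.tip[OF colimit_cob] .

lemma tr_id: "closed M \<Longrightarrow> tr M M = Id C (cob M)"
proof (rule cob_ext[of M])
  assume M: "closed M"
  fix j assume j: "j \<in> Dom J ` M"
  show "Comp C (tr M M) (cleg M j) = Comp C (Id C (cob M)) (cleg M j)"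
    using tr(2)[OF M M _ j] cleg_hom[OF M j] by (simp add: hom_iff)
next
  assume M: "closed M"
  show "tr M M \<in> hom C (cob M) (cob M)" "Id C (cob M) \<in> hom C (cob M) (cob M)"
    using tr(1)[OF M M] cob_obj[OF M] B.id_hom by simp_all
qed

definition small_closed :: "'u rel \<Rightarrow> 'u set \<Rightarrow> 'u set set" where
  "small_closed \<kappa> N = {M. closed M \<and> M \<subseteq> N \<and> |M| <o \<kappa>}"

context
  fixes \<kappa> N assumes \<kappa>: "ample \<kappa>" and N: "closed N"
begin

lemma directed_small_closed: "directed_below \<kappa> (small_closed \<kappa> N) (\<subseteq>)"
  unfolding directed_below_def
proof (intro allI impI)
  fix S assume S: "S \<subseteq> small_closed \<kappa> N" "|S| <o \<kappa>"
  then have "|\<Union>M \<in> S. M| <o \<kappa>" by (intro stable_UNION ampleD[OF \<kappa>]) (auto simp: small_closed_def)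
  then obtain K where "closed K" "\<Union>S \<subseteq> K" "K \<subseteq> N" "|K| <o \<kappa>"
    using S(1) by (auto simp: small_closed_def intro: ex_closure[OF \<kappa> N, of "\<Union>S"])
  then show "\<exists>k \<in> small_closed \<kappa> N. \<forall>i \<in> S. i \<subseteq> k"
    by (intro bexI[of _ K]) (auto simp: small_closed_def)
qed

lemma system_small_closed: "directed_system TYPE('u) (small_closed \<kappa> N) (\<subseteq>) C cob tr"
proof unfold_locales
  have "|Pow N| <o |UNIV :: 'u set|" using card_sub[OF N] inacc by (auto simp: inaccessible_type_def)
  moreover have "small_closed \<kappa> N \<subseteq> Pow N" by (auto simp: small_closed_def)
  ultimately show "|small_closed \<kappa> N| <o |UNIV :: 'u set|" by (rule subset_ordLess)
  have "|{} :: 'u set set| <o \<kappa>" using finite_ordLess_Cinfinite ampleD(3)[OF \<kappa>] by blast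
  then show "small_closed \<kappa> N \<noteq> {}" using directed_small_closed unfolding directed_below_def by blast
  show "\<exists>k \<in> small_closed \<kappa> N. i \<subseteq> k \<and> j \<subseteq> k" if "i \<in> small_closed \<kappa> N" "j \<in> small_closed \<kappa> N" for i j
    using directed_small_closed[unfolded directed_below_def, rule_format, of "{i, j}"] that
      finite_ordLess_Cinfinite[OF _ ampleD(3)[OF \<kappa>], of "{i, j}"] by auto
qed (use inacc tr tr_comp tr_id cob_obj in \<open>auto simp: small_closed_def\<close>)

text \<open>A colimit over a directed union is the colimit of the colimits over its members. This
  turns a presentation that is merely filtered into a \<open>\<kappa>\<close>-directed one, for
  every ample \<open>\<kappa>\<close>.\<close>

lemma colimit_small_closed:
  assumes "is_colimit C (sub N) D Q c"
  shows "system_colimit C (small_closed \<kappa> N) (\<subseteq>) cob tr Q (\<lambda>M. comparison M Q c)"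
proof -
  interpret N: colimit "sub N" C D Q c using assms functor_sub[OF N] by (rule colimitI[rotated])
  note comp = comparison[OF _ _ N.cocone]
  have ex: "\<exists>M \<in> small_closed \<kappa> N. Z \<subseteq> M" if Z: "finite Z" "Z \<subseteq> N" for Z
  proof -
    obtain M where "closed M" "Z \<subseteq> M" "M \<subseteq> N" "|M| <o \<kappa>"
      by (rule ex_closure[OF \<kappa> N Z(2) finite_ordLess_Cinfinite[OF Z(1) ampleD(3)[OF \<kappa>]]])
    then show ?thesis by (auto simp: small_closed_def)
  qed
  show ?thesis unfolding system_colimit_def
  proof (intro conjI allI impI)
    show "system_cocone C (small_closed \<kappa> N) (\<subseteq>) cob tr Q (\<lambda>M. comparison M Q c)"
      using comp(1) tr_comparison[OF _ _ _ _ N.cocone] by (auto simp: system_cocone_def small_closed_def)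
  next
    fix R d assume d: "system_cocone C (small_closed \<kappa> N) (\<subseteq>) cob tr R d"
    have dh: "d M \<in> hom C (cob M) R" if "M \<in> small_closed \<kappa> N" for M using d that by (simp add: system_cocone_def)
    have dt: "Comp C (d M') (tr M M') = d M" if "M \<in> small_closed \<kappa> N" "M' \<in> small_closed \<kappa> N" "M \<subseteq> M'" for M M'
      using d that by (simp add: system_cocone_def)
    have sc: "closed M" "M \<subseteq> N" if "M \<in> small_closed \<kappa> N" for M using that by (auto simp: small_closed_def)
    have step: "Comp C (d M') (cleg M' j) = Comp C (d M) (cleg M j)"
      if M: "M \<in> small_closed \<kappa> N" "M' \<in> small_closed \<kappa> N" "M \<subseteq> M'" and j: "j \<in> Dom J ` M" for M M' j
      using dt[OF M] tr[OF sc(1)[OF M(1)] sc(1)[OF M(2)] M(3)] j dh[OF M(1)] dh[OF M(2)]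
        B.rewrite_left[OF dt[OF M], of "cleg M j"] cleg_hom[OF sc(1)[OF M(1)] j] by (simp add: hom_iff)
    have indep: "Comp C (d M) (cleg M j) = Comp C (d M') (cleg M' j)"
      if M: "M \<in> small_closed \<kappa> N" "M' \<in> small_closed \<kappa> N" and j: "j \<in> Dom J ` M" "j \<in> Dom J ` M'" for M M' j
    proof -
      obtain K where K: "K \<in> small_closed \<kappa> N" "M \<subseteq> K" "M' \<subseteq> K"
        using directed_index.directed[OF directed_system.axioms(1)[OF system_small_closed] M] by blast
      then show ?thesis using step[OF M(1) K(1,2) j(1)] step[OF M(2) K(1,3) j(2)] by simp
    qed
    \<comment> \<open>A cocone on the pieces becomes a cocone on the diagram by evaluation at any
      piece containing \<open>j\<close>; \<open>indep\<close> makes the choice immaterial.\<close>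
    define e where "e j = (let M = SOME M. M \<in> small_closed \<kappa> N \<and> j \<in> Dom J ` M in Comp C (d M) (cleg M j))" for j
    have e: "e j = Comp C (d M) (cleg M j)" if M: "M \<in> small_closed \<kappa> N" "j \<in> Dom J ` M" for M j
    proof -
      have "(SOME M. M \<in> small_closed \<kappa> N \<and> j \<in> Dom J ` M) \<in> small_closed \<kappa> N \<and>
          j \<in> Dom J ` (SOME M. M \<in> small_closed \<kappa> N \<and> j \<in> Dom J ` M)"
        by (rule someI[of _ M]) (use M in blast)
      then show ?thesis unfolding e_def Let_def using indep M by blast
    qed
    have "cocone C (sub N) D R e" unfolding cocone_def
    proof (intro conjI ballI)
      show "R \<in> Obj C" using d by (simp add: system_cocone_def)
      fix j assume "j \<in> Obj (sub N)"
      then obtain a where "a \<in> N" "j = Dom J a" by auto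
      moreover then obtain M where "M \<in> small_closed \<kappa> N" "{a} \<subseteq> M" using ex[of "{a}"] by auto
      ultimately show "e j \<in> hom C (OMap D j) R"
        using e[of M j] dh[of M] cleg_hom[OF sc(1), of M j] by (auto simp: hom_iff)
    next
      fix a assume a: "a \<in> Arr (sub N)"
      then obtain M where M: "M \<in> small_closed \<kappa> N" "{a} \<subseteq> M" using ex[of "{a}"] by auto
      interpret M: colimit "sub M" C D "cob M" "cleg M" by (rule colimit_cob[OF sc(1)[OF M(1)]])
      have o: "Dom J a \<in> Dom J ` M" "Cod J a \<in> Dom J ` M" "a \<in> M" "a \<in> Arr J"
        using M closed_cod[OF sc(1)[OF M(1)]] closedD(1)[OF sc(1)[OF M(1)]] by auto
      show "Comp C (e (Cod (sub N) a)) (AMap D a) = e (Dom (sub N) a)"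
        using e[OF M(1) o(1)] e[OF M(1) o(2)] dh[OF M(1)] M.leg_natural[of a] o
          cleg_hom[OF sc(1)[OF M(1)] o(1)] cleg_hom[OF sc(1)[OF M(1)] o(2)] by (simp add: hom_iff)
    qed
    then obtain h where h: "h \<in> hom C Q R" "\<forall>j \<in> Obj (sub N). Comp C h (c j) = e j" by (rule N.induced)
    show "\<exists>!h. h \<in> hom C Q R \<and> (\<forall>M \<in> small_closed \<kappa> N. Comp C h (comparison M Q c) = d M)"
    proof (rule ex1I[of _ h], intro conjI ballI h(1))
      fix M assume M: "M \<in> small_closed \<kappa> N"
      note c = comp[OF sc[OF M]]
      show "Comp C h (comparison M Q c) = d M"
      proof (rule cob_ext[OF sc(1)[OF M] _ dh[OF M]])
        show "Comp C h (comparison M Q c) \<in> hom C (cob M) R" using h c(1) by (auto simp: hom_iff)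
        fix j assume j: "j \<in> Dom J ` M"
        then have "j \<in> Obj (sub N)" using sc(2)[OF M] by auto
        then have "Comp C h (c j) = e j" using h(2) by blast
        then show "Comp C (Comp C h (comparison M Q c)) (cleg M j) = Comp C (d M) (cleg M j)"
          using h(1) c(1) c(2)[OF j] cleg_hom[OF sc(1)[OF M] j] e[OF M j] by (simp add: hom_iff)
      qed
    next
      fix k assume k: "k \<in> hom C Q R \<and> (\<forall>M \<in> small_closed \<kappa> N. Comp C k (comparison M Q c) = d M)"
      show "k = h"
      proof (rule N.joint_epi[OF _ h(1)])
        show "\<forall>j \<in> Obj (sub N). Comp C k (c j) = Comp C h (c j)"
        proof
          fix j assume j: "j \<in> Obj (sub N)"
          then obtain a where a: "a \<in> N" "j = Dom J a" by auto
          then obtain M where M: "M \<in> small_closed \<kappa> N" "{a} \<subseteq> M" using ex[of "{a}"] by auto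
          then have jM: "j \<in> Dom J ` M" using a by auto
          note c = comp[OF sc[OF M(1)]]
          have "Comp C k (c j) = Comp C (Comp C k (comparison M Q c)) (cleg M j)"
            using c(1) c(2)[OF jM] cleg_hom[OF sc(1)[OF M(1)] jM] k by (simp add: hom_iff)
          also have "\<dots> = e j" using k M(1) e[OF M(1) jM] by simp
          finally show "Comp C k (c j) = Comp C h (c j)" using bspec[OF h(2) j] by simp
        qed
      qed (use k in blast)
    qed
  qed
qed

end

lemma sub_Arr: "is_colimit C (sub (Arr J)) D L \<iota>"
proof -
  have "Dom J ` Arr J = Obj J" using A.dom_obj A.id_simps(1,2) by (metis image_eqI image_subsetI subsetI subset_antisym)
  then have "sub (Arr J) = J" by (simp add: subdiagram_def)
  then show ?thesis using colim by simp
qed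

end

section \<open>Subobjects in finitely accessible categories\<close>

definition (in category) factors :: "'a \<Rightarrow> 'a \<Rightarrow> bool" (infix "\<preceq>" 50) where
  "p \<preceq> q \<longleftrightarrow> (\<exists>h. h \<in> hom C (Dom C p) (Dom C q) \<and> Comp C q h = p)"

context category
begin

lemma factorsI: "h \<in> hom C (Dom C p) (Dom C q) \<Longrightarrow> Comp C q h = p \<Longrightarrow> p \<preceq> q"
  by (auto simp: factors_def)

lemma factors_refl: "p \<in> Arr C \<Longrightarrow> p \<preceq> p"
  using dom_obj by (intro factorsI[of "Id C (Dom C p)"]) (auto simp: hom_iff)

lemma factors_trans:
  assumes "r \<in> Arr C" "p \<preceq> q" "q \<preceq> r" shows "p \<preceq> r"
proof -
  obtain h k where "h \<in> hom C (Dom C p) (Dom C q)" "Comp C q h = p"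
    "k \<in> hom C (Dom C q) (Dom C r)" "Comp C r k = q" using assms unfolding factors_def by blast
  then show ?thesis using assms(1) rewrite_left[of r k q h]
    by (intro factorsI[of "Comp C k h"]) (auto simp: hom_iff)
qed

lemma comp_factors: "h \<in> Arr C \<Longrightarrow> q \<in> Arr C \<Longrightarrow> Cod C h = Dom C q \<Longrightarrow> Comp C q h \<preceq> q"
  by (auto simp: factors_def hom_iff)

lemma factors_comp: "p \<preceq> q \<Longrightarrow> q \<in> Arr C \<Longrightarrow> h \<in> Arr C \<Longrightarrow> Cod C h = Dom C p \<Longrightarrow> Comp C p h \<preceq> q"
proof -
  assume a: "p \<preceq> q" "q \<in> Arr C" "h \<in> Arr C" "Cod C h = Dom C p"
  then obtain k where k: "k \<in> hom C (Dom C p) (Dom C q)" "Comp C q k = p" unfolding factors_def by blast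
  then have e: "Comp C q (Comp C k h) = Comp C p h"
    using a(2-4) by (intro rewrite_left) (auto simp: hom_iff)
  have "p \<in> Arr C" using k a(2) by (auto simp: hom_iff)
  then have "Comp C k h \<in> hom C (Dom C (Comp C p h)) (Dom C q)" using k(1) a(3,4) by (simp add: hom_iff)
  then show ?thesis using e by (rule factorsI)
qed

lemma mono_arr: "monomorphism C m \<Longrightarrow> m \<in> Arr C"
  by (simp add: monomorphism_def)

lemma mono_cancel:
  assumes "monomorphism C m" "Comp C m f = Comp C m g" "f \<in> hom C x (Dom C m)" "g \<in> hom C x (Dom C m)"
  shows "f = g"
  using assms unfolding monomorphism_def by blast

lemma mono_equiv_inverse:
  assumes "monomorphism C m" "monomorphism C n" "m \<preceq> n" "n \<preceq> m"
  obtains h k where "h \<in> hom C (Dom C m) (Dom C n)" "k \<in> hom C (Dom C n) (Dom C m)"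
    "Comp C n h = m" "Comp C m k = n" "Comp C k h = Id C (Dom C m)" "Comp C h k = Id C (Dom C n)"
proof -
  have arr: "m \<in> Arr C" "n \<in> Arr C" using assms(1,2) mono_arr by auto
  obtain h k where hk: "h \<in> hom C (Dom C m) (Dom C n)" "Comp C n h = m"
    "k \<in> hom C (Dom C n) (Dom C m)" "Comp C m k = n" using assms(3,4) unfolding factors_def by blast
  have "Comp C k h = Id C (Dom C m)"
    by (rule mono_cancel[OF assms(1)])
      (use hk arr dom_obj rewrite_left[OF hk(4), of h] in \<open>auto simp: hom_iff\<close>)
  moreover have "Comp C h k = Id C (Dom C n)"
    by (rule mono_cancel[OF assms(2)])
      (use hk arr dom_obj rewrite_left[OF hk(2), of k] in \<open>auto simp: hom_iff\<close>)
  ultimately show ?thesis using that hk by blast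
qed

lemma mono_equiv_presentable:
  fixes \<kappa> :: "'u rel"
  assumes "inaccessible_type TYPE('u)" "monomorphism C m" "monomorphism C n" "m \<preceq> n" "n \<preceq> m"
    "presentable \<kappa> C (Dom C m)"
  shows "presentable \<kappa> C (Dom C n)"
proof -
  have c: "category C" by unfold_locales
  show ?thesis using mono_equiv_inverse[OF assms(2-5)] presentable_retract[OF assms(1) c assms(6)] by metis
qed

end

text \<open>The index of accessibility can be raised from \<open>\<mu>\<close> to
  \<open>\<kappa>\<close> because all filtered colimits exist. A closed subdiagram need only be
  filtered in the finitary sense, yet it has a colimit, and this is
  \<open>\<kappa>\<close>-presentable as a colimit over fewer than \<open>\<kappa>\<close> arrows of
  \<open>\<mu>\<close>-presentable objects.\<close>

lemma accessible_decomposition: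
  fixes \<mu> \<kappa> :: "'u rel"
  assumes inacc: "inaccessible_type TYPE('u)" and filt: "has_filtered_colimits TYPE('u) C"
    and acc: "accessible_at \<mu> C" and \<kappa>: "regular_cardinal \<kappa>" "natLeq <o \<kappa>" "\<mu> \<le>o \<kappa>"
    and V: "V \<in> Obj C"
  obtains I W t c where "directed_system TYPE('u) (I :: 'u set set) (\<subseteq>) C W t" "directed_below \<kappa> I (\<subseteq>)"
    "\<forall>i \<in> I. presentable \<kappa> C (W i)" "system_colimit C I (\<subseteq>) W t V c"
proof -
  obtain S where S: "\<forall>s \<in> S. presentable \<mu> C s" "\<forall>X \<in> Obj C. \<exists>J D \<iota>. filtered_diagram \<mu> C J D \<and>
      OMap D ` Obj J \<subseteq> S \<and> is_colimit C J D X \<iota>"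
    using acc unfolding accessible_at_def by blast
  then obtain J D \<iota> where D: "filtered_diagram \<mu> C J D" "OMap D ` Obj J \<subseteq> S" "is_colimit C J D V \<iota>"
    using V by blast
  interpret D: colimit J C D V \<iota> using D by (simp add: colimitI filtered_diagram_def)
  have \<mu>: "regular_cardinal \<mu>" using acc by (simp add: accessible_at_def)
  interpret P: presentation J C D V \<iota> "\<lambda>_. {}"
    using inacc filt filtered_diagram_mono[OF D(1) aleph0_least[OF inacc \<mu>]] by unfold_locales auto
  have "|{} :: 'u set| <o \<kappa>" by (rule finite_ordLess_Cinfinite[OF _ regular_cardinalD(1)[OF \<kappa>(1)]]) simp
  then have "P.ample \<kappa>" using \<kappa> by (simp add: P.ample_def)
  note K = this P.closed_Arr
  have "\<forall>j \<in> Obj J. presentable \<kappa> C (OMap D j)"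
  proof
    fix j assume "j \<in> Obj J"
    then have "presentable \<mu> C (OMap D j)" using S(1) D(2) by blast
    then show "presentable \<kappa> C (OMap D j)" by (rule presentable_mono[OF _ \<kappa>(3,1)])
  qed
  then have "\<forall>M \<in> P.small_closed \<kappa> (Arr J). presentable \<kappa> C (P.cob M)"
    using P.presentable_cob \<kappa>(1) by (auto simp: P.small_closed_def)
  then show ?thesis
    by (rule that[OF P.system_small_closed[OF K] P.directed_small_closed[OF K] _ P.colimit_small_closed[OF K P.sub_Arr]])
qed

locale finitely_accessible_category = category C for C :: "('o, 'a) cat" +
  fixes u :: "'u itself"
  assumes inacc: "inaccessible_type TYPE('u)"
    and finitely_accessible: "finitely_accessible TYPE('u) C"
begin

lemma filtered_colimits: "has_filtered_colimits TYPE('u) C"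
  using finitely_accessible by (simp add: finitely_accessible_def accessible_at_def has_filtered_colimits_def)

lemma ex_presentation:
  assumes "Q \<in> Obj C"
  obtains J D \<iota> where "filtered_diagram (aleph0 :: 'u rel) C J D" "is_colimit C J D Q \<iota>"
    "\<forall>j \<in> Obj J. presentable (aleph0 :: 'u rel) C (OMap D j)"
proof -
  obtain S where S: "\<forall>s \<in> S. presentable (aleph0 :: 'u rel) C s" "\<forall>X \<in> Obj C. \<exists>J D \<iota>. filtered_diagram (aleph0 :: 'u rel) C J D \<and>
      OMap D ` Obj J \<subseteq> S \<and> is_colimit C J D X \<iota>"
    using finitely_accessible unfolding finitely_accessible_def accessible_at_def by blast
  obtain J D \<iota> where D: "filtered_diagram (aleph0 :: 'u rel) C J D" "OMap D ` Obj J \<subseteq> S" "is_colimit C J D Q \<iota>"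
    using S(2) assms by blast
  have "\<forall>j \<in> Obj J. presentable (aleph0 :: 'u rel) C (OMap D j)" using S(1) D(2) by blast
  then show ?thesis by (rule that[OF D(1,3)])
qed

lemma isomorphicD:
  assumes "isomorphic C x y"
  obtains f g where "f \<in> hom C x y" "g \<in> hom C y x" "Comp C g f = Id C x" "Comp C f g = Id C y"
  using assms unfolding isomorphic_def isomorphism_def by (auto simp: hom_iff)

lemma isomorphic_refl: "x \<in> Obj C \<Longrightarrow> isomorphic C x x"
  unfolding isomorphic_def isomorphism_def by (intro bexI[of _ "Id C x"] conjI bexI[of _ "Id C x"]) (auto simp: hom_iff)

lemma ex_skeleton:
  assumes "presentable (aleph0 :: 'u rel) C Q"
  shows "\<exists>r \<in> Obj (fp TYPE('u) C). isomorphic C Q r"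
proof -
  have Q: "Q \<in> Obj C" using assms by (simp add: presentable_def)
  let ?r = "SOME Y. isomorphic C Q Y"
  have r: "isomorphic C Q ?r" using isomorphic_refl[OF Q] by (rule someI)
  then have "?r \<in> Obj C" using isomorphicD hom_obj by metis
  then have "?r \<in> Obj (fp TYPE('u) C)" using assms
    by (auto simp: fp_def full_subcategory_def finitely_presentable_def)
  then show ?thesis using r by blast
qed

lemma skeleton_presentable: "r \<in> Obj (fp TYPE('u) C) \<Longrightarrow> presentable (aleph0 :: 'u rel) C r"
proof -
  assume "r \<in> Obj (fp TYPE('u) C)"
  then obtain Q where Q: "presentable (aleph0 :: 'u rel) C Q" "r = (SOME Y. isomorphic C Q Y)"
    by (auto simp: fp_def full_subcategory_def finitely_presentable_def)
  then have "Q \<in> Obj C" by (simp add: presentable_def)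
  then have "isomorphic C Q r" unfolding Q(2) using isomorphic_refl by (metis someI)
  then obtain f g where "f \<in> hom C Q r" "g \<in> hom C r Q" "Comp C f g = Id C r" using isomorphicD by metis
  then show ?thesis using presentable_retract[OF inacc _ Q(1)] category_axioms by blast
qed

lemma skeleton_arr: "r \<in> Obj (fp TYPE('u) C) \<Longrightarrow> r' \<in> Obj (fp TYPE('u) C) \<Longrightarrow> hom C r r' \<subseteq> Arr (fp TYPE('u) C)"
  by (auto simp: fp_def full_subcategory_def hom_iff)

text \<open>Every object is a colimit of finitely presentable ones, and these are isomorphic to
  representatives in \<open>fp\<close>.\<close>

lemma skeleton_separates:
  assumes "f \<in> hom C Q Z" "g \<in> hom C Q Z" "\<And>r x. r \<in> Obj (fp TYPE('u) C) \<Longrightarrow> x \<in> hom C r Q \<Longrightarrow> Comp C f x = Comp C g x"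
  shows "f = g"
proof -
  obtain J D \<iota> where D: "filtered_diagram (aleph0 :: 'u rel) C J D" "is_colimit C J D Q \<iota>"
    "\<forall>j \<in> Obj J. presentable (aleph0 :: 'u rel) C (OMap D j)"
    using ex_presentation hom_obj(1)[OF assms(1)] by blast
  interpret D: colimit J C D Q \<iota> using D by (simp add: colimitI filtered_diagram_def)
  show ?thesis
  proof (rule D.joint_epi[OF assms(1,2)], rule ballI)
    fix j assume j: "j \<in> Obj J"
    then obtain r where r: "r \<in> Obj (fp TYPE('u) C)" "isomorphic C (OMap D j) r" using D(3) ex_skeleton by blast
    then obtain \<psi> \<phi> where i: "\<psi> \<in> hom C (OMap D j) r" "\<phi> \<in> hom C r (OMap D j)"
      "Comp C \<phi> \<psi> = Id C (OMap D j)" using isomorphicD by metis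
    have "Comp C f (Comp C (\<iota> j) \<phi>) = Comp C g (Comp C (\<iota> j) \<phi>)"
      by (rule assms(3)[OF r(1)]) (use i j in \<open>auto simp: hom_iff\<close>)
    then have "Comp C (Comp C f (Comp C (\<iota> j) \<phi>)) \<psi> = Comp C (Comp C g (Comp C (\<iota> j) \<phi>)) \<psi>" by simp
    then have "Comp C f (Comp C (\<iota> j) (Comp C \<phi> \<psi>)) = Comp C g (Comp C (\<iota> j) (Comp C \<phi> \<psi>))"
      using assms(1,2) i(1,2) j by (simp add: hom_iff)
    then show "Comp C f (\<iota> j) = Comp C g (\<iota> j)" unfolding i(3) using j D.omap_obj by simp
  qed
qed

text \<open>Two maps into \<open>L\<close> with equal composites are tested on representatives,
  where both factor through a common stage; there the hypothesis makes them equal further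
  on.\<close>

lemma mono_from_colimit:
  assumes diag: "filtered_diagram (aleph0 :: 'u rel) C J D" and col: "is_colimit C J D L \<iota>"
    and \<sigma>: "\<sigma> \<in> hom C L X"
    and eq: "\<And>j r x y. j \<in> Obj J \<Longrightarrow> r \<in> Obj (fp TYPE('u) C) \<Longrightarrow> x \<in> hom C r (OMap D j) \<Longrightarrow> y \<in> hom C r (OMap D j) \<Longrightarrow>
      Comp C \<sigma> (Comp C (\<iota> j) x) = Comp C \<sigma> (Comp C (\<iota> j) y) \<Longrightarrow>
      \<exists>u \<in> Arr J. Dom J u = j \<and> Comp C (AMap D u) x = Comp C (AMap D u) y"
  shows "monomorphism C \<sigma>"
  unfolding monomorphism_def
proof (intro conjI allI ballI impI)
  interpret D: colimit J C D L \<iota> using diag col by (simp add: colimitI filtered_diagram_def)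
  interpret J: filtered_category J aleph0 by (rule filtered_diagram_category[OF diag regular_aleph0[OF inacc]])
  show "\<sigma> \<in> Arr C" using \<sigma> by (simp add: hom_iff)
  fix Q f g assume "f \<in> hom C Q (Dom C \<sigma>)" "g \<in> hom C Q (Dom C \<sigma>)" and fg: "Comp C \<sigma> f = Comp C \<sigma> g"
  then have f: "f \<in> hom C Q L" and g: "g \<in> hom C Q L" using \<sigma> by (auto simp: hom_iff)
  show "f = g"
  proof (rule skeleton_separates[OF f g])
    fix r x assume r: "r \<in> Obj (fp TYPE('u) C)" and x: "x \<in> hom C r Q"
    have fac: "factorizes C r J D L \<iota>"
      using skeleton_presentable[OF r] diag col unfolding presentable_iff[OF inacc] by blast
    have "Comp C f x \<in> hom C r L" "Comp C g x \<in> hom C r L" using f g x by (auto simp: hom_iff)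
    then obtain i f' j g' where i: "i \<in> Obj J" "f' \<in> hom C r (OMap D i)" "Comp C (\<iota> i) f' = Comp C f x"
      and j: "j \<in> Obj J" "g' \<in> hom C r (OMap D j)" "Comp C (\<iota> j) g' = Comp C g x"
      using fac unfolding factorizes_def by meson
    obtain k u v where u: "u \<in> hom J i k" "v \<in> hom J j k" using J.bound_pair[OF i(1) j(1)] by blast
    let ?f = "Comp C (AMap D u) f'" and ?g = "Comp C (AMap D v) g'"
    have h: "?f \<in> hom C r (OMap D k)" "?g \<in> hom C r (OMap D k)" using u i j by (auto simp: hom_iff)
    have e: "Comp C (\<iota> k) ?f = Comp C f x" "Comp C (\<iota> k) ?g = Comp C g x"
      using D.leg_natural_comp[OF u(1)] D.leg_natural_comp[OF u(2)] i j by (auto simp: hom_iff)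
    have k: "k \<in> Obj J" using u D.A.hom_obj by blast
    have "Comp C \<sigma> (Comp C (\<iota> k) ?f) = Comp C \<sigma> (Comp C (\<iota> k) ?g)"
      unfolding e using rewrite_left[OF fg, of x] f g x \<sigma> by (simp add: hom_iff)
    then obtain w where w: "w \<in> Arr J" "Dom J w = k" "Comp C (AMap D w) ?f = Comp C (AMap D w) ?g"
      using eq[OF k r h] by blast
    have "Comp C (\<iota> k) ?f = Comp C (\<iota> (Cod J w)) (Comp C (AMap D w) ?f)"
      using D.leg_natural_comp[of w k "Cod J w" ?f] w h by (simp add: hom_iff)
    also have "\<dots> = Comp C (\<iota> k) ?g"
      unfolding w(3) using D.leg_natural_comp[of w k "Cod J w" ?g] w(1,2) h by (simp add: hom_iff)
    finally show "Comp C f x = Comp C g x" unfolding e .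
  qed
qed

end

text \<open>Purity makes the subdiagrams of \<open>X\<close> subobjects.\<close>

locale pure_presentation = presentation J C D X \<iota> extra + finitely_accessible_category C "TYPE('u)"
  for J :: "('u, 'u) cat" and C :: "('o, 'a) cat" and D X \<iota> extra +
  assumes presentable_obj: "j \<in> Obj J \<Longrightarrow> presentable (aleph0 :: 'u rel) C (OMap D j)"
    and pure: "closed M \<Longrightarrow> j \<in> Dom J ` M \<Longrightarrow> r \<in> Obj (fp TYPE('u) C) \<Longrightarrow>
      x \<in> hom C r (OMap D j) \<Longrightarrow> y \<in> hom C r (OMap D j) \<Longrightarrow> Comp C (\<iota> j) x = Comp C (\<iota> j) y \<Longrightarrow>
      \<exists>u \<in> M. Dom J u = j \<and> Comp C (AMap D u) x = Comp C (AMap D u) y"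
begin

definition s :: "'u set \<Rightarrow> 'a" where "s M = comparison M X \<iota>"

lemma s_hom: "closed M \<Longrightarrow> s M \<in> hom C (cob M) X"
  and s_cleg: "closed M \<Longrightarrow> j \<in> Dom J ` M \<Longrightarrow> Comp C (s M) (cleg M j) = \<iota> j"
  using comparison[OF _ closedD(1) colimit.cocone[of "sub (Arr J)"], of M X \<iota>] colimitI[OF functor_sub sub_Arr] closed_Arr
  unfolding s_def by auto

lemma s_simps [simp]: "closed M \<Longrightarrow> s M \<in> Arr C" "closed M \<Longrightarrow> Dom C (s M) = cob M" "closed M \<Longrightarrow> Cod C (s M) = X"
  using s_hom by (auto simp: hom_iff)

lemma s_mono:
  assumes M: "closed M" shows "monomorphism C (s M)"
proof (rule mono_from_colimit[OF filtered_diagram_sub[OF M] colimit.colim[OF colimit_cob[OF M]] s_hom[OF M]])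
  fix j r x y assume j: "j \<in> Obj (sub M)" and r: "r \<in> Obj (fp TYPE('u) C)" and x: "x \<in> hom C r (OMap D j)" "y \<in> hom C r (OMap D j)"
    and eq: "Comp C (s M) (Comp C (cleg M j) x) = Comp C (s M) (Comp C (cleg M j) y)"
  have "j \<in> Dom J ` M" using j by simp
  note c = s_cleg[OF M this] cleg_hom[OF M this]
  have "Comp C (\<iota> j) x = Comp C (\<iota> j) y"
    using eq B.rewrite_left[OF c(1), of x] B.rewrite_left[OF c(1), of y] x c s_hom[OF M] by (simp add: hom_iff)
  then show "\<exists>u \<in> Arr (sub M). Dom (sub M) u = j \<and> Comp C (AMap D u) x = Comp C (AMap D u) y"
    using pure[OF M _ r x] j by auto
qed

text \<open>As \<open>\<sigma>\<close> is monic, the factorizations of the legs are unique and so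
  form a cocone. Comparison of subobjects is thereby reduced to one index at a time, which is how
  unions are handled later.\<close>

lemma s_factors_iff:
  assumes M: "closed M" and \<sigma>: "monomorphism C \<sigma>" "Cod C \<sigma> = X"
  shows "B.factors (s M) \<sigma> \<longleftrightarrow> (\<forall>j \<in> Dom J ` M. B.factors (\<iota> j) \<sigma>)"
proof
  assume "B.factors (s M) \<sigma>"
  then show "\<forall>j \<in> Dom J ` M. B.factors (\<iota> j) \<sigma>"
    using B.factors_comp[of "s M" \<sigma>] s_cleg[OF M] cleg_hom[OF M] M B.mono_arr[OF \<sigma>(1)] by (metis hom_iff s_simps(2))
next
  interpret M: colimit "sub M" C D "cob M" "cleg M" by (rule colimit_cob[OF M])
  have arr: "\<sigma> \<in> Arr C" using B.mono_arr[OF \<sigma>(1)] .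
  have oJ: "j \<in> Obj J" if "j \<in> Dom J ` M" for j using that closedD(1)[OF M] A.dom_obj by auto
  assume "\<forall>j \<in> Dom J ` M. B.factors (\<iota> j) \<sigma>"
  then have "\<forall>j \<in> Dom J ` M. \<exists>h. h \<in> hom C (OMap D j) (Dom C \<sigma>) \<and> Comp C \<sigma> h = \<iota> j"
    using oJ by (simp add: B.factors_def)
  then obtain h where h: "\<forall>j \<in> Dom J ` M. h j \<in> hom C (OMap D j) (Dom C \<sigma>) \<and> Comp C \<sigma> (h j) = \<iota> j" by metis
  have "cocone C (sub M) D (Dom C \<sigma>) h" unfolding cocone_def
  proof (intro conjI ballI)
    show "Dom C \<sigma> \<in> Obj C" using arr B.dom_obj by blast
    fix a assume a: "a \<in> Arr (sub M)"
    then have o: "Dom J a \<in> Dom J ` M" "Cod J a \<in> Dom J ` M" "a \<in> Arr J"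
      using closed_cod[OF M] closedD(1)[OF M] by auto
    note ha = bspec[OF h o(1)] bspec[OF h o(2)]
    have "Comp C (h (Cod J a)) (AMap D a) = h (Dom J a)"
    proof (rule B.mono_cancel[OF \<sigma>(1)])
      have "Comp C \<sigma> (Comp C (h (Cod J a)) (AMap D a)) = Comp C (\<iota> (Cod J a)) (AMap D a)"
        using B.rewrite_left[of \<sigma> "h (Cod J a)" "\<iota> (Cod J a)" "AMap D a"] ha o arr by (simp add: hom_iff)
      then show "Comp C \<sigma> (Comp C (h (Cod J a)) (AMap D a)) = Comp C \<sigma> (h (Dom J a))"
        using leg_natural[OF o(3)] ha by simp
      show "Comp C (h (Cod J a)) (AMap D a) \<in> hom C (OMap D (Dom J a)) (Dom C \<sigma>)"
        "h (Dom J a) \<in> hom C (OMap D (Dom J a)) (Dom C \<sigma>)" using ha o by (auto simp: hom_iff)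
    qed
    then show "Comp C (h (Cod (sub M) a)) (AMap D a) = h (Dom (sub M) a)" by simp
  qed (use h in auto)
  then obtain k where k: "k \<in> hom C (cob M) (Dom C \<sigma>)" "\<forall>j \<in> Obj (sub M). Comp C k (cleg M j) = h j"
    by (rule M.induced)
  have "Comp C \<sigma> k = s M"
  proof (rule cob_ext[OF M _ s_hom[OF M]])
    show "Comp C \<sigma> k \<in> hom C (cob M) X" using k arr \<sigma>(2) by (auto simp: hom_iff)
    fix j assume j: "j \<in> Dom J ` M"
    then have "Comp C k (cleg M j) = h j" using bspec[OF k(2), of j] by simp
    then show "Comp C (Comp C \<sigma> k) (cleg M j) = Comp C (s M) (cleg M j)"
      using k(1) arr cleg_hom[OF M j] bspec[OF h j] s_cleg[OF M j] by (simp add: hom_iff)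
  qed
  then show "B.factors (s M) \<sigma>" using k(1) M by (intro B.factorsI[of k]) auto
qed

lemma s_subset:
  assumes "closed M" "closed N" "M \<subseteq> N" shows "B.factors (s M) (s N)"
proof -
  have "\<forall>j \<in> Dom J ` N. B.factors (\<iota> j) (s N)"
    using s_factors_iff[OF assms(2) s_mono[OF assms(2)]] B.factors_refl assms(2) by simp
  then show ?thesis using s_factors_iff[OF assms(1) s_mono[OF assms(2)]] assms(2,3) by auto
qed

lemma s_presentable:
  fixes \<kappa> :: "'u rel"
  assumes "closed M" "|M| <o \<kappa>" "regular_cardinal \<kappa>" shows "presentable \<kappa> C (Dom C (s M))"
  using presentable_cob[OF assms] presentable_mono[OF presentable_obj aleph0_least[OF inacc assms(3)] assms(3)] assms(1)
  by simp

text \<open>\<open>X\<close> is the \<open>\<kappa>\<close>-directed colimit of the objects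
  \<open>cob M\<close> with \<open>M\<close> small and closed.\<close>

lemma presentable_factors:
  fixes \<kappa> :: "'u rel"
  assumes "ample \<kappa>" "presentable \<kappa> C P" "p \<in> hom C P X"
  obtains M where "closed M" "|M| <o \<kappa>" "B.factors p (s M)"
proof -
  interpret S: directed_system "TYPE('u)" "small_closed \<kappa> (Arr J)" "(\<subseteq>)" C cob tr
    by (rule system_small_closed[OF assms(1) closed_Arr])
  obtain M g where "M \<in> small_closed \<kappa> (Arr J)" "g \<in> hom C P (cob M)" "Comp C (s M) g = p"
    using S.sys_factor[OF colimit_small_closed[OF assms(1) closed_Arr sub_Arr] assms(2)
      directed_small_closed[OF assms(1) closed_Arr] assms(3)] unfolding s_def by blast
  then show ?thesis using that assms(3) by (auto simp: small_closed_def B.factors_def hom_iff)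
qed

lemma presentable_factors_sub:
  fixes \<kappa> :: "'u rel"
  assumes "ample \<kappa>" "presentable \<kappa> C (Dom C p)" "p \<in> Arr C" "closed N" "B.factors p (s N)"
  obtains M where "closed M" "M \<subseteq> N" "|M| <o \<kappa>" "B.factors p (s M)"
proof -
  interpret S: directed_system "TYPE('u)" "small_closed \<kappa> N" "(\<subseteq>)" C cob tr
    by (rule system_small_closed[OF assms(1,4)])
  obtain h where h: "h \<in> hom C (Dom C p) (cob N)" "Comp C (s N) h = p"
    using assms(4,5) by (auto simp: B.factors_def)
  obtain M g where M: "M \<in> small_closed \<kappa> N" "g \<in> hom C (Dom C p) (cob M)" "Comp C (tr M N) g = h"
    using S.sys_factor[OF colimit_small_closed[OF assms(1,4) colimit.colim[OF colimit_cob[OF assms(4)]]] assms(2)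
      directed_small_closed[OF assms(1,4)] h(1)] unfolding tr_def by blast
  then have c: "closed M" "M \<subseteq> N" "|M| <o \<kappa>" by (auto simp: small_closed_def)
  have "Comp C (s N) (tr M N) = s M"
    using tr_comparison[OF c(1) assms(4) c(2) closedD(1)[OF assms(4)]
      colimit.cocone[OF colimitI[OF functor_sub[OF closed_Arr] sub_Arr]]] by (simp add: s_def)
  then have "Comp C (s M) g = p"
    using B.rewrite_left[of "s N" "tr M N" "s M" g] M(2,3) tr(1)[OF c(1) assms(4) c(2)] s_hom[OF assms(4)] h(2)
    by (simp add: hom_iff)
  then show ?thesis using that[OF c] M(2) c(1) by (auto simp: B.factors_def)
qed

end

context finitely_accessible_category
begin

text \<open>For each index object and each pair of maps into it from a representative, an arrow
  equalizing them is chosen if there is one. Transport along an isomorphism of \<open>D j\<close>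
  with a representative turns such pairs into pairs of arrows of \<open>fp\<close>, whose number
  bounds \<open>extra\<close>.\<close>

lemma ex_pure_presentation:
  assumes X: "X \<in> Obj C"
  obtains J D \<iota> extra where "pure_presentation (J :: ('u, 'u) cat) C D X \<iota> extra"
    "\<And>l \<kappa>. Cinfinite (\<kappa> :: 'u rel) \<Longrightarrow> |Arr (fp TYPE('u) C)| <o \<kappa> \<Longrightarrow> |extra l| <o \<kappa>"
proof -
  let ?A = "Arr (fp TYPE('u) C)"
  obtain J :: "('u, 'u) cat" and D \<iota> where D: "filtered_diagram (aleph0 :: 'u rel) C J D" "is_colimit C J D X \<iota>"
    "\<forall>j \<in> Obj J. presentable (aleph0 :: 'u rel) C (OMap D j)"
    using ex_presentation X by blast
  interpret D: colimit J C D X \<iota> using D by (simp add: colimitI filtered_diagram_def)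
  have "\<forall>j \<in> Obj J. \<exists>r \<phi> \<psi>. r \<in> Obj (fp TYPE('u) C) \<and> \<phi> \<in> hom C r (OMap D j) \<and> \<psi> \<in> hom C (OMap D j) r \<and>
      Comp C \<phi> \<psi> = Id C (OMap D j)"
    using ex_skeleton D(3) isomorphicD by metis
  then obtain R \<phi> \<psi> where R: "\<And>j. j \<in> Obj J \<Longrightarrow> R j \<in> Obj (fp TYPE('u) C)" "\<And>j. j \<in> Obj J \<Longrightarrow> \<phi> j \<in> hom C (R j) (OMap D j)"
      "\<And>j. j \<in> Obj J \<Longrightarrow> \<psi> j \<in> hom C (OMap D j) (R j)" "\<And>j. j \<in> Obj J \<Longrightarrow> Comp C (\<phi> j) (\<psi> j) = Id C (OMap D j)"
    by metis
  define good where "good j f g u \<longleftrightarrow> u \<in> Arr J \<and> Dom J u = j \<and>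
      Comp C (AMap D u) (Comp C (\<phi> j) f) = Comp C (AMap D u) (Comp C (\<phi> j) g)" for j f g u
  \<comment> \<open>The default \<open>Id J j\<close> keeps the value among the arrows of
    \<open>J\<close> when nothing equalizes.\<close>
  define eqz where "eqz j f g = (if \<exists>u. good j f g u then SOME u. good j f g u else Id J j)" for j f g
  define extra where "extra l = (\<lambda>(a, f, g). eqz (Dom J a) f g) ` ({a \<in> set l. a \<in> Arr J} \<times> ?A \<times> ?A)" for l
  have eqz: "good j f g (eqz j f g)" if "good j f g u" for j f g u
    using that unfolding eqz_def by (metis someI_ex)
  have eqz_arr: "eqz j f g \<in> Arr J" if "j \<in> Obj J" for j f g
    using eqz[of j f g] that by (cases "\<exists>u. good j f g u") (auto simp: good_def eqz_def)
  interpret P: presentation J C D X \<iota> extra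
    by unfold_locales (use inacc filtered_colimits D(1) eqz_arr D.A.dom_obj in \<open>auto simp: extra_def\<close>)
  have "pure_presentation J C D X \<iota> extra"
  proof unfold_locales
    show "presentable (aleph0 :: 'u rel) C (OMap D j)" if "j \<in> Obj J" for j using D(3) that by blast
    fix M j r x y assume M: "P.closed M" and j: "j \<in> Dom J ` M" and r: "r \<in> Obj (fp TYPE('u) C)"
      and x: "x \<in> hom C r (OMap D j)" "y \<in> hom C r (OMap D j)" and eq: "Comp C (\<iota> j) x = Comp C (\<iota> j) y"
    obtain a where a: "a \<in> M" "j = Dom J a" using j by auto
    then have aJ: "a \<in> Arr J" "j \<in> Obj J" using P.closedD(1)[OF M] D.A.dom_obj by auto
    let ?f = "Comp C (\<psi> j) x" and ?g = "Comp C (\<psi> j) y"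
    have "?f \<in> hom C r (R j)" "?g \<in> hom C r (R j)" using R(3)[OF aJ(2)] x by (auto simp: hom_iff)
    then have A: "?f \<in> ?A" "?g \<in> ?A" using skeleton_arr[OF r R(1)[OF aJ(2)]] by auto
    have fg: "Comp C (\<phi> j) ?f = x" "Comp C (\<phi> j) ?g = y"
      using R(2,3)[OF aJ(2)] rewrite_left[OF R(4)[OF aJ(2)], of x] rewrite_left[OF R(4)[OF aJ(2)], of y] x D.omap_obj[OF aJ(2)]
      by (auto simp: hom_iff)
    have "factorizes C r J D X \<iota>"
      using skeleton_presentable[OF r] D(1,2) unfolding presentable_iff[OF inacc] by blast
    then obtain u where "u \<in> Arr J" "Dom J u = j" "Comp C (AMap D u) x = Comp C (AMap D u) y"
      using aJ(2) x eq unfolding factorizes_def by blast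
    then have "good j ?f ?g u" by (simp add: good_def fg)
    then have g: "good j ?f ?g (eqz j ?f ?g)" by (rule eqz)
    have "eqz j ?f ?g \<in> extra [a]" unfolding extra_def using a aJ A
      by (intro image_eqI[of _ _ "(a, ?f, ?g)"]) auto
    moreover have "extra [a] \<subseteq> P.ops [a]" by (auto simp: P.ops_def)
    ultimately have "eqz j ?f ?g \<in> M" using P.closedD(2)[OF M, of "[a]"] a(1) by auto
    then show "\<exists>u \<in> M. Dom J u = j \<and> Comp C (AMap D u) x = Comp C (AMap D u) y"
      using g unfolding good_def fg by blast
  qed
  moreover have "|extra l| <o \<kappa>" if \<kappa>: "Cinfinite (\<kappa> :: 'u rel)" "|?A| <o \<kappa>" for l \<kappa>
    unfolding extra_def
    by (intro image_ordLess Times_ordLess_Cinfinite \<kappa> finite_ordLess_Cinfinite) auto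
  ultimately show ?thesis using that by blast
qed

end

section \<open>Structures on subobjects\<close>

lemma (in category) nat_system:
  assumes inacc: "inaccessible_type TYPE('u)"
    and W: "\<And>n. W n \<in> Obj C" and t: "\<And>n. t n \<in> hom C (W n) (W (Suc n))"
  obtains T where "directed_system TYPE('u) (UNIV :: nat set) (\<le>) C W T" "\<And>n. T n (Suc n) = t n"
    "\<And>m n. m \<le> n \<Longrightarrow> T m (Suc n) = Comp C (t n) (T m n)"
proof -
  define it where "it m = rec_nat (Id C (W m)) (\<lambda>d f. Comp C (t (m + d)) f)" for m
  define T where "T m n = it m (n - m)" for m n :: nat
  have it: "it m 0 = Id C (W m)" "it m (Suc d) = Comp C (t (m + d)) (it m d)" for m d by (simp_all add: it_def)
  have T: "T m m = Id C (W m)" "m \<le> n \<Longrightarrow> T m (Suc n) = Comp C (t n) (T m n)" for m n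
    by (simp_all add: T_def it Suc_diff_le)
  have hom: "T m n \<in> hom C (W m) (W n)" if "m \<le> n" for m n
    using that
  proof (induction n rule: dec_induct)
    case base then show ?case using T(1) W id_hom by simp
  next
    case (step n) then show ?case using T(2) t[of n] by (auto simp: hom_iff)
  qed
  have comp: "Comp C (T m n) (T l m) = T l n" if "l \<le> m" "m \<le> n" for l m n
    using that(2)
  proof (induction n rule: dec_induct)
    case base then show ?case using T(1) hom[OF that(1)] W by (simp add: hom_iff)
  next
    case (step n)
    then have "Comp C (T m (Suc n)) (T l m) = Comp C (t n) (Comp C (T m n) (T l m))"
      using T(2) hom[OF that(1)] hom[of m n] t[of n] by (simp add: hom_iff)
    then show ?case using step T(2)[of l n] that(1) by simp
  qed
  have "directed_system TYPE('u) (UNIV :: nat set) (\<le>) C W T"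
  proof unfold_locales
    show "|UNIV :: nat set| <o |UNIV :: 'u set|" using ordIso_ordLess_trans[OF card_of_nat inaccessibleD(1)[OF inacc]] .
    show "\<exists>k \<in> UNIV. i \<le> k \<and> j \<le> k" for i j :: nat by (rule bexI[of _ "max i j"]) auto
  qed (use inacc W T hom comp in auto)
  moreover have "T n (Suc n) = t n" for n using T[of n] t[of n] W by (simp add: hom_iff)
  ultimately show ?thesis using that T(2) by blast
qed

locale compactness_setting = is_functor A B F + PB: pure_presentation J B D X \<iota> extra
  for A :: "('o, 'a) cat" and B :: "('p, 'b) cat" and F and J :: "('u, 'u) cat" and D X \<iota> extra +
  fixes \<mu> :: "'u rel"
  assumes filtered_colimits: "has_filtered_colimits TYPE('u) A"
    and preserves: "preserves_filtered_colimits TYPE('u) A B F"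
    and accessible: "accessible_at \<mu> A"
    and presentable_image: "regular_cardinal (\<theta> :: 'u rel) \<Longrightarrow> \<mu> \<le>o \<theta> \<Longrightarrow> presentable \<theta> A U \<Longrightarrow> presentable \<theta> B (OMap F U)"
    and extend: "structures_extend_along_morphisms A B F"
begin

notation B.factors (infix "\<preceq>" 50)

abbreviation "closed \<equiv> PB.closed"
abbreviation "s \<equiv> PB.s"

lemma functor_F: "is_functor A B F" by unfold_locales

text \<open>\<open>V\<close> is a structure on the subobject \<open>s K\<close>.  Subobjects being equal only up to mutual
  factorization, the map \<open>\<sigma>\<close> to \<open>X\<close> replaces an isomorphism from \<open>F(V)\<close> to the domain of \<open>s K\<close>.\<close>

definition carries :: "'o \<Rightarrow> 'b \<Rightarrow> 'u set \<Rightarrow> bool" where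
  "carries V \<sigma> K \<longleftrightarrow> V \<in> Obj A \<and> \<sigma> \<in> hom B (OMap F V) X \<and> monomorphism B \<sigma> \<and> closed K \<and>
     \<sigma> \<preceq> s K \<and> s K \<preceq> \<sigma>"

text \<open>Both structures are existentially quantified because the constructions of lifts do not
  control which structure on \<open>K\<close> they produce; \<open>extend_carries\<close> replaces
  it by any other.\<close>

definition lifts :: "'u set \<Rightarrow> 'u set \<Rightarrow> bool" where
  "lifts K N \<longleftrightarrow> (\<exists>V \<sigma> V' \<sigma>' g. carries V \<sigma> K \<and> carries V' \<sigma>' N \<and> g \<in> hom A V V' \<and> Comp B \<sigma>' (AMap F g) = \<sigma>)"

lemma carriesD:
  assumes "carries V \<sigma> K"
  shows "V \<in> Obj A" "\<sigma> \<in> hom B (OMap F V) X" "monomorphism B \<sigma>" "closed K" "\<sigma> \<preceq> s K" "s K \<preceq> \<sigma>"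
    "\<sigma> \<in> Arr B" "Dom B \<sigma> = OMap F V" "Cod B \<sigma> = X"
  using assms by (auto simp: carries_def hom_iff)

text \<open>Two structures on \<open>K\<close> have isomorphic images under \<open>F\<close>, though
  they need not be isomorphic in \<open>A\<close>. This is exactly the situation in which structures
  extend along morphisms, here along the lift \<open>g\<close> with the isomorphism
  \<open>i\<close>.\<close>

lemma extend_carries:
  assumes V: "carries V \<sigma> K" and "lifts K N"
  obtains V' \<sigma>' g where "carries V' \<sigma>' N" "g \<in> hom A V V'" "Comp B \<sigma>' (AMap F g) = \<sigma>"
proof -
  obtain U \<tau> U' \<tau>' g where U: "carries U \<tau> K" and U': "carries U' \<tau>' N" and g: "g \<in> hom A U U'" "Comp B \<tau>' (AMap F g) = \<tau>"
    using assms(2) unfolding lifts_def by blast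
  note v = carriesD[OF V] and u = carriesD[OF U] and u' = carriesD[OF U']
  have "\<sigma> \<preceq> \<tau>" "\<tau> \<preceq> \<sigma>" using B.factors_trans u v by blast+
  then obtain i k where i: "i \<in> hom B (OMap F V) (OMap F U)" "k \<in> hom B (OMap F U) (OMap F V)"
    "Comp B \<tau> i = \<sigma>" "Comp B k i = Id B (OMap F V)" "Comp B i k = Id B (OMap F U)"
    using B.mono_equiv_inverse[OF v(3) u(3)] v(8) u(8) by metis
  then have "isomorphism B i" unfolding isomorphism_def by (auto simp: hom_iff)
  then obtain V' f j where f: "f \<in> hom A V V'" "j \<in> hom B (OMap F V') (OMap F U')" "isomorphism B j"
    "Comp B j (AMap F f) = Comp B (AMap F g) i"
    using extend[unfolded structures_extend_along_morphisms_def, rule_format, of V g U U' i] v(1) g(1) i(1) by blast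
  obtain l where l: "l \<in> hom B (OMap F U') (OMap F V')" "Comp B l j = Id B (OMap F V')" "Comp B j l = Id B (OMap F U')"
    using f(2,3) unfolding isomorphism_def by (auto simp: hom_iff)
  \<comment> \<open>\<open>F(V')\<close> is only isomorphic to \<open>F(U')\<close>, so the map to
    \<open>X\<close> is corrected by \<open>j\<close>.\<close>
  let ?\<sigma> = "Comp B \<tau>' j"
  have V'obj: "V' \<in> Obj A" using A.hom_obj f(1) by blast
  have h: "?\<sigma> \<in> hom B (OMap F V') X" using f(2) u'(2) by (auto simp: hom_iff)
  have mono: "monomorphism B ?\<sigma>" unfolding monomorphism_def
  proof (intro conjI allI ballI impI)
    fix Q x y assume x: "x \<in> hom B Q (Dom B ?\<sigma>)" "y \<in> hom B Q (Dom B ?\<sigma>)" and e: "Comp B ?\<sigma> x = Comp B ?\<sigma> y"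
    have "Comp B \<tau>' (Comp B j x) = Comp B \<tau>' (Comp B j y)" using e x f(2) u'(2) by (simp add: hom_iff)
    then have "Comp B j x = Comp B j y"
      by (rule B.mono_cancel[OF u'(3)]) (use x f(2) u'(2) in \<open>auto simp: hom_iff\<close>)
    then have "Comp B l (Comp B j x) = Comp B l (Comp B j y)" by simp
    then show "x = y"
      using B.rewrite_left[OF l(2), of x] B.rewrite_left[OF l(2), of y] l(1) f(2) x u'(2) omap_obj[OF V'obj]
      by (simp add: hom_iff)
  qed (use h in \<open>simp add: hom_iff\<close>)
  have "?\<sigma> \<preceq> \<tau>'" using f(2) u'(7,8) by (intro B.comp_factors) (auto simp: hom_iff)
  moreover have "Comp B ?\<sigma> l = \<tau>'" using f(2) l(1,3) u'(7,8) omap_obj[OF u'(1)] by (simp add: hom_iff)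
  then have "\<tau>' \<preceq> ?\<sigma>" using l(1) h u'(8) by (intro B.factorsI[of l]) (auto simp: hom_iff)
  ultimately have "?\<sigma> \<preceq> s N" "s N \<preceq> ?\<sigma>" using B.factors_trans u'(4-6) h by (auto simp: hom_iff)
  then have "carries V' ?\<sigma> N" using h mono V'obj u'(4) by (simp add: carries_def)
  moreover have "Comp B ?\<sigma> (AMap F f) = Comp B (Comp B \<tau>' (AMap F g)) i"
    using f u'(7,8) g(1) i(1) by (simp add: hom_iff)
  then have "Comp B ?\<sigma> (AMap F f) = \<sigma>" unfolding g(2) i(3) .
  ultimately show ?thesis using that f(1) by blast
qed

text \<open>Hypothesis \<open>mono\<close> says that the \<open>\<omega> i\<close> become monomorphisms in the colimit.\<close>

lemma colimit_carries:
  assumes "directed_system TYPE('u) I le A W t" and col: "system_colimit A I le W t Q c"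
    and \<omega>: "\<And>i. i \<in> I \<Longrightarrow> \<omega> i \<in> hom B (OMap F (W i)) X"
      "\<And>i j. i \<in> I \<Longrightarrow> j \<in> I \<Longrightarrow> le i j \<Longrightarrow> Comp B (\<omega> j) (AMap F (t i j)) = \<omega> i"
    and mono: "\<And>i. i \<in> I \<Longrightarrow> \<exists>j \<in> I. le i j \<and> (\<forall>Q. \<forall>x \<in> hom B Q (OMap F (W i)). \<forall>y \<in> hom B Q (OMap F (W i)).
      Comp B (\<omega> i) x = Comp B (\<omega> i) y \<longrightarrow> Comp B (AMap F (t i j)) x = Comp B (AMap F (t i j)) y)"
    and K: "closed K" "\<And>i. i \<in> I \<Longrightarrow> \<omega> i \<preceq> s K" "\<And>n. n \<in> Dom J ` K \<Longrightarrow> \<exists>i \<in> I. \<iota> n \<preceq> \<omega> i"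
  obtains \<sigma> where "carries Q \<sigma> K" "\<And>i. i \<in> I \<Longrightarrow> Comp B \<sigma> (AMap F (c i)) = \<omega> i"
proof -
  interpret S: directed_system "TYPE('u)" I le A W t by fact
  interpret FS: directed_system "TYPE('u)" I le B "OMap F \<circ> W" "\<lambda>i j. AMap F (t i j)"
    by (rule S.image_system[OF functor_F])
  have Fcol: "system_colimit B I le (OMap F \<circ> W) (\<lambda>i j. AMap F (t i j)) (OMap F Q) (\<lambda>i. AMap F (c i))"
    by (rule S.colimit_preserved[OF functor_F preserves col])
  note leg = FS.sys_leg[OF Fcol, unfolded o_def]
  have sK: "s K \<in> hom B (PB.cob K) X" by (rule PB.s_hom[OF K(1)])
  have "system_cocone B I le (OMap F \<circ> W) (\<lambda>i j. AMap F (t i j)) X \<omega>"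
    using \<omega> PB.tip by (simp add: system_cocone_def)
  then obtain \<sigma> where \<sigma>: "\<sigma> \<in> hom B (OMap F Q) X" "\<forall>i \<in> I. Comp B \<sigma> (AMap F (c i)) = \<omega> i"
    by (rule FS.sys_induced[OF Fcol])
  have \<sigma>x: "Comp B \<sigma> (Comp B (AMap F (c i)) x) = Comp B (\<omega> i) x" if "i \<in> I" "x \<in> hom B r (OMap F (W i))" for i x r
    using B.rewrite_left[OF bspec[OF \<sigma>(2) that(1)], of x] that leg[OF that(1)] \<sigma>(1) by (simp add: hom_iff)
  have "monomorphism B \<sigma>"
  proof (rule PB.mono_from_colimit[OF FS.filtered_diagram_aleph0 Fcol[unfolded FS.system_colimit_iff] \<sigma>(1)])
    fix j r x y assume j: "j \<in> Obj S.J" and x: "x \<in> hom B r (OMap FS.D j)" "y \<in> hom B r (OMap FS.D j)"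
      and eq: "Comp B \<sigma> (Comp B (AMap F (c (fst (pair_decode I j)))) x) = Comp B \<sigma> (Comp B (AMap F (c (fst (pair_decode I j)))) y)"
    obtain i where i: "i \<in> I" "j = S.code (i, i)" using j S.Obj_iff by blast
    have x': "x \<in> hom B r (OMap F (W i))" "y \<in> hom B r (OMap F (W i))" using x i by simp_all
    have "Comp B (\<omega> i) x = Comp B (\<omega> i) y" using eq i \<sigma>x[OF i(1) x'(1)] \<sigma>x[OF i(1) x'(2)] by simp
    then obtain k where "k \<in> I" "le i k" "Comp B (AMap F (t i k)) x = Comp B (AMap F (t i k)) y"
      using mono[OF i(1)] x' by blast
    then show "\<exists>u \<in> Arr S.J. Dom S.J u = j \<and> Comp B (AMap FS.D u) x = Comp B (AMap FS.D u) y"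
      using i S.Arr_iff by (intro bexI[of _ "S.code (i, k)"]) auto
  qed
  moreover have "s K \<preceq> \<sigma>"
  proof -
    have "\<iota> n \<preceq> \<sigma>" if n: "n \<in> Dom J ` K" for n
    proof -
      obtain i where i: "i \<in> I" "\<iota> n \<preceq> \<omega> i" using K(3)[OF n] by blast
      have "Comp B \<sigma> (AMap F (c i)) \<preceq> \<sigma>" using leg[OF i(1)] \<sigma>(1) by (intro B.comp_factors) (auto simp: hom_iff)
      then have "\<omega> i \<preceq> \<sigma>" unfolding bspec[OF \<sigma>(2) i(1)] .
      then show ?thesis using B.factors_trans[OF _ i(2)] \<sigma>(1) by (simp add: hom_iff)
    qed
    then show ?thesis using PB.s_factors_iff[OF K(1) calculation] \<sigma>(1) by (simp add: hom_iff)
  qed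
  \<comment> \<open>As \<open>s K\<close> is monic, the factorizations of the
    \<open>\<omega> i\<close> are compatible and induce a map out of the colimit
    \<open>F(Q)\<close>.\<close>
  moreover have "\<sigma> \<preceq> s K"
  proof -
    have "\<exists>h. h \<in> hom B (OMap F (W i)) (PB.cob K) \<and> Comp B (s K) h = \<omega> i" if "i \<in> I" for i
      using K(2)[OF that] \<omega>(1)[OF that] K(1) by (auto simp: B.factors_def hom_iff)
    then obtain h where h: "\<And>i. i \<in> I \<Longrightarrow> h i \<in> hom B (OMap F (W i)) (PB.cob K)"
      "\<And>i. i \<in> I \<Longrightarrow> Comp B (s K) (h i) = \<omega> i" by metis
    have "system_cocone B I le (OMap F \<circ> W) (\<lambda>i j. AMap F (t i j)) (PB.cob K) h"
      unfolding system_cocone_def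
    proof (intro conjI ballI impI)
      fix i j assume ij: "i \<in> I" "j \<in> I" "le i j"
      note tt = FS.map_hom[OF ij, unfolded o_def]
      show "Comp B (h j) (AMap F (t i j)) = h i"
      proof (rule B.mono_cancel[OF PB.s_mono[OF K(1)]])
        show "Comp B (s K) (Comp B (h j) (AMap F (t i j))) = Comp B (s K) (h i)"
          using B.rewrite_left[OF h(2)[OF ij(2)], of "AMap F (t i j)"] h(1)[OF ij(2)] sK tt \<omega>(2)[OF ij] h(2)[OF ij(1)]
          by (simp add: hom_iff)
      qed (use h(1) ij tt K(1) in \<open>auto simp: hom_iff\<close>)
    qed (use h(1) PB.cob_obj[OF K(1)] in auto)
    then obtain k where k: "k \<in> hom B (OMap F Q) (PB.cob K)" "\<forall>i \<in> I. Comp B k (AMap F (c i)) = h i"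
      by (rule FS.sys_induced[OF Fcol])
    have "Comp B (s K) k = \<sigma>"
    proof (rule FS.sys_joint_epi[OF Fcol _ \<sigma>(1)])
      show "\<forall>i \<in> I. Comp B (Comp B (s K) k) (AMap F (c i)) = Comp B \<sigma> (AMap F (c i))"
      proof
        fix i assume i: "i \<in> I"
        then show "Comp B (Comp B (s K) k) (AMap F (c i)) = Comp B \<sigma> (AMap F (c i))"
          using k(1) bspec[OF k(2) i] bspec[OF \<sigma>(2) i] h(2)[OF i] leg[OF i] sK by (simp add: hom_iff)
      qed
      show "Comp B (s K) k \<in> hom B (OMap F Q) X" using k(1) sK by (auto simp: hom_iff)
    qed
    then show ?thesis using k(1) \<sigma>(1) K(1) by (intro B.factorsI[of k]) (auto simp: hom_iff)
  qed
  ultimately have "carries Q \<sigma> K" using \<sigma>(1) K(1) S.sys_tip[OF col] by (simp add: carries_def)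
  then show ?thesis using that \<sigma>(2) by blast
qed

text \<open>What later arguments need of a countable colimit and of its image. Maps out of
  \<open>Q\<close> are only asked to exist in \<open>A\<close>; uniqueness is asked after applying
  \<open>F\<close>, where composites to \<open>X\<close> are compared. \<open>\<kappa>\<close> is
  uncountable because countably many objects are joined.\<close>

definition sequence_colimit where
  "sequence_colimit W t \<omega> K Q c \<sigma> \<longleftrightarrow> carries Q \<sigma> K \<and> (\<forall>n :: nat. c n \<in> hom A (W n) Q) \<and>
     (\<forall>n. Comp B \<sigma> (AMap F (c n)) = \<omega> n) \<and> (\<forall>n. Comp A (c (Suc n)) (t n) = c n) \<and>
     (\<forall>V d. V \<in> Obj A \<longrightarrow> (\<forall>n. d n \<in> hom A (W n) V) \<longrightarrow> (\<forall>n. Comp A (d (Suc n)) (t n) = d n) \<longrightarrow>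
        (\<exists>h. h \<in> hom A Q V \<and> (\<forall>n. Comp A h (c n) = d n))) \<and>
     (\<forall>Y. \<forall>h \<in> hom B (OMap F Q) Y. \<forall>h' \<in> hom B (OMap F Q) Y.
        (\<forall>n. Comp B h (AMap F (c n)) = Comp B h' (AMap F (c n))) \<longrightarrow> h = h') \<and>
     (\<forall>\<kappa> :: 'u rel. regular_cardinal \<kappa> \<longrightarrow> natLeq <o \<kappa> \<longrightarrow> (\<forall>n. presentable \<kappa> A (W n)) \<longrightarrow> presentable \<kappa> A Q)"

lemma sequence_colimitD:
  assumes "sequence_colimit W t \<omega> K Q c \<sigma>"
  shows "carries Q \<sigma> K" "c n \<in> hom A (W n) Q" "Comp B \<sigma> (AMap F (c n)) = \<omega> n"
    "Comp A (c (Suc n)) (t n) = c n"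
    "V \<in> Obj A \<Longrightarrow> (\<And>n. d n \<in> hom A (W n) V) \<Longrightarrow> (\<And>n. Comp A (d (Suc n)) (t n) = d n) \<Longrightarrow>
      \<exists>h. h \<in> hom A Q V \<and> (\<forall>n. Comp A h (c n) = d n)"
    "h \<in> hom B (OMap F Q) Y \<Longrightarrow> h' \<in> hom B (OMap F Q) Y \<Longrightarrow>
      (\<And>n. Comp B h (AMap F (c n)) = Comp B h' (AMap F (c n))) \<Longrightarrow> h = h'"
    "regular_cardinal (\<kappa> :: 'u rel) \<Longrightarrow> natLeq <o \<kappa> \<Longrightarrow> (\<And>n. presentable \<kappa> A (W n)) \<Longrightarrow> presentable \<kappa> A Q"
proof -
  note a = assms[unfolded sequence_colimit_def]
  show "carries Q \<sigma> K" "c n \<in> hom A (W n) Q" "Comp B \<sigma> (AMap F (c n)) = \<omega> n" "Comp A (c (Suc n)) (t n) = c n"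
    using a by simp_all
  show "V \<in> Obj A \<Longrightarrow> (\<And>n. d n \<in> hom A (W n) V) \<Longrightarrow> (\<And>n. Comp A (d (Suc n)) (t n) = d n) \<Longrightarrow>
      \<exists>h. h \<in> hom A Q V \<and> (\<forall>n. Comp A h (c n) = d n)"
    using a by blast
  show "h \<in> hom B (OMap F Q) Y \<Longrightarrow> h' \<in> hom B (OMap F Q) Y \<Longrightarrow>
      (\<And>n. Comp B h (AMap F (c n)) = Comp B h' (AMap F (c n))) \<Longrightarrow> h = h'"
    using a by blast
  show "regular_cardinal \<kappa> \<Longrightarrow> natLeq <o \<kappa> \<Longrightarrow> (\<And>n. presentable \<kappa> A (W n)) \<Longrightarrow> presentable \<kappa> A Q"
    using a by blast
qed

text \<open>The \<open>\<omega> n\<close> need not be monic, as maps out of approximations of a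
  structure are not: it is enough that whatever \<open>\<omega> n\<close> identifies is identified
  one step later, which is what \<open>interpolation\<close> delivers.\<close>

lemma sequence_carries:
  assumes W: "\<And>n. W n \<in> Obj A" and t: "\<And>n. t n \<in> hom A (W n) (W (Suc n))"
    and \<omega>: "\<And>n. \<omega> n \<in> hom B (OMap F (W n)) X" "\<And>n. Comp B (\<omega> (Suc n)) (AMap F (t n)) = \<omega> n"
    and mono: "\<And>n Q x y. x \<in> hom B Q (OMap F (W n)) \<Longrightarrow> y \<in> hom B Q (OMap F (W n)) \<Longrightarrow>
      Comp B (\<omega> n) x = Comp B (\<omega> n) y \<Longrightarrow> Comp B (AMap F (t n)) x = Comp B (AMap F (t n)) y"
    and K: "closed K" "\<And>n. \<omega> n \<preceq> s K" "\<And>n. n \<in> Dom J ` K \<Longrightarrow> \<exists>i. \<iota> n \<preceq> \<omega> i"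
  shows "\<exists>Q c \<sigma>. sequence_colimit W t \<omega> K Q c \<sigma>"
proof -
  obtain T where "directed_system TYPE('u) (UNIV :: nat set) (\<le>) A W T" and T: "\<And>n. T n (Suc n) = t n"
    "\<And>m n. m \<le> n \<Longrightarrow> T m (Suc n) = Comp A (t n) (T m n)"
    by (rule A.nat_system[where t = t, OF PB.inacc W t], rule that)
  then interpret S: directed_system "TYPE('u)" "UNIV :: nat set" "(\<le>)" A W T by simp
  obtain Q c where col: "system_colimit A UNIV (\<le>) W T Q c" using S.colimit_exists[OF filtered_colimits] by blast
  have Th: "T m n \<in> hom A (W m) (W n)" if "m \<le> n" for m n using S.map_hom that by simp
  have \<omega>T: "Comp B (\<omega> n) (AMap F (T m n)) = \<omega> m" if "m \<le> n" for m n
    using that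
  proof (induction n rule: dec_induct)
    case base
    then show ?case using S.map_id[of m] amap_id[OF W] \<omega>(1)[of m] omap_obj[OF W[of m]] by (simp add: hom_iff)
  next
    case (step n)
    have "Comp B (\<omega> (Suc n)) (AMap F (T m (Suc n))) = Comp B (\<omega> (Suc n)) (Comp B (AMap F (t n)) (AMap F (T m n)))"
      using T(2)[OF step(1)] amap_comp[OF Th[OF step(1)] t[of n]] by simp
    also have "\<dots> = \<omega> m"
      using B.rewrite_left[OF \<omega>(2)[of n], of "AMap F (T m n)"] step(3) amap_hom[OF t[of n]]
        amap_hom[OF Th[OF step(1)]] \<omega>(1)[of "Suc n"] by (simp add: hom_iff)
    finally show ?case .
  qed
  obtain \<sigma> where \<sigma>: "carries Q \<sigma> K" "\<And>n. Comp B \<sigma> (AMap F (c n)) = \<omega> n"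
  proof (rule colimit_carries[OF S.directed_system_axioms col, where \<omega> = \<omega> and K = K])
    fix i :: nat
    show "\<exists>j \<in> UNIV. i \<le> j \<and> (\<forall>Q. \<forall>x \<in> hom B Q (OMap F (W i)). \<forall>y \<in> hom B Q (OMap F (W i)).
      Comp B (\<omega> i) x = Comp B (\<omega> i) y \<longrightarrow> Comp B (AMap F (T i j)) x = Comp B (AMap F (T i j)) y)"
    proof (rule bexI[of _ "Suc i"], intro conjI allI ballI impI)
      fix Q x y assume "x \<in> hom B Q (OMap F (W i))" "y \<in> hom B Q (OMap F (W i))" "Comp B (\<omega> i) x = Comp B (\<omega> i) y"
      then show "Comp B (AMap F (T i (Suc i))) x = Comp B (AMap F (T i (Suc i))) y" unfolding T(1) by (rule mono)
    qed simp_all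
    show "\<omega> i \<in> hom B (OMap F (W i)) X" "closed K" "\<omega> i \<preceq> s K" by (rule \<omega>(1), rule K(1), rule K(2))
    show "Comp B (\<omega> j) (AMap F (T i j)) = \<omega> i" if "i \<le> j" for j by (rule \<omega>T[OF that])
    show "\<exists>i \<in> UNIV. \<iota> n \<preceq> \<omega> i" if "n \<in> Dom J ` K" for n using K(3)[OF that] by blast
  qed (rule that, assumption, simp)
  interpret FS: directed_system "TYPE('u)" "UNIV :: nat set" "(\<le>)" B "OMap F \<circ> W" "\<lambda>i j. AMap F (T i j)"
    by (rule S.image_system[OF functor_F])
  note Fcol = S.colimit_preserved[OF functor_F preserves col]
  have "sequence_colimit W t \<omega> K Q c \<sigma>"
    unfolding sequence_colimit_def
  proof (intro conjI allI ballI impI)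
    show "carries Q \<sigma> K" "Comp B \<sigma> (AMap F (c n)) = \<omega> n" for n by (rule \<sigma>)+
    show "c n \<in> hom A (W n) Q" for n using S.sys_leg[OF col] by simp
    show "Comp A (c (Suc n)) (t n) = c n" for n using S.sys_natural[OF col, of n "Suc n"] T(1) by simp
    show "h = h'" if "h \<in> hom B (OMap F Q) Y" "h' \<in> hom B (OMap F Q) Y"
      "\<forall>n. Comp B h (AMap F (c n)) = Comp B h' (AMap F (c n))" for h h' Y
      using FS.sys_joint_epi[OF Fcol that(1,2)] that(3) by simp
    show "presentable \<kappa> A Q" if "regular_cardinal \<kappa>" "natLeq <o \<kappa>" "\<forall>n. presentable \<kappa> A (W n)" for \<kappa> :: "'u rel"
      using S.sys_presentable[OF col that(1) ordIso_ordLess_trans[OF card_of_nat that(2)]] that(3) by simp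
    fix V d assume V: "V \<in> Obj A" and d: "\<forall>n. d n \<in> hom A (W n) V" "\<forall>n. Comp A (d (Suc n)) (t n) = d n"
    have "Comp A (d n) (T m n) = d m" if "m \<le> n" for m n
      using that
    proof (induction n rule: dec_induct)
      case base then show ?case using S.map_id[of m] d(1)[THEN spec, of m] by (simp add: hom_iff)
    next
      case (step n)
      then show ?case using T(2)[OF step(1)] A.rewrite_left[OF d(2)[THEN spec, of n], of "T m n"]
        d(1)[THEN spec, of "Suc n"] t[of n] Th[OF step(1)] by (simp add: hom_iff)
    qed
    then have "system_cocone A UNIV (\<le>) W T V d" using V d(1) by (simp add: system_cocone_def)
    then show "\<exists>h. h \<in> hom A Q V \<and> (\<forall>n. Comp A h (c n) = d n)" by (rule S.sys_induced[OF col]) auto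
  qed
  then show ?thesis by blast
qed

definition adequate :: "'u rel \<Rightarrow> bool" where
  "adequate \<kappa> \<longleftrightarrow> PB.ample \<kappa> \<and> \<mu> \<le>o \<kappa>"

lemma adequateD:
  assumes "adequate \<kappa>"
  shows "PB.ample \<kappa>" "regular_cardinal \<kappa>" "natLeq <o \<kappa>" "\<mu> \<le>o \<kappa>" "Cinfinite \<kappa>" "stable \<kappa>"
  using assms PB.ampleD by (auto simp: adequate_def)

lemma ex_presentable_over:
  assumes \<kappa>: "adequate \<kappa>" and V: "V \<in> Obj A"
  obtains W w where "presentable \<kappa> A W" "w \<in> hom A W V"
proof -
  obtain I W t c where S: "directed_system TYPE('u) (I :: 'u set set) (\<subseteq>) A W t"
    "\<forall>i \<in> I. presentable \<kappa> A (W i)" "system_colimit A I (\<subseteq>) W t V c"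
    by (rule accessible_decomposition[OF PB.inacc filtered_colimits accessible adequateD(2-4)[OF \<kappa>] V])
  interpret S: directed_system "TYPE('u)" I "(\<subseteq>)" A W t by fact
  obtain i where "i \<in> I" using S.nonempty by blast
  then show ?thesis using that S(2) S.sys_leg[OF S(3)] by blast
qed

text \<open>\<open>F(V)\<close> is a \<open>\<kappa>\<close>-directed colimit of images of
  presentable objects, so the map from the domain of \<open>m\<close> to \<open>F(V)\<close> factors
  through one of them. Moving on to a later stage, \<open>F(t)\<close> itself factors through
  \<open>m\<close>. Since \<open>m\<close> is monic, elements of \<open>F(W)\<close> that agree in
  \<open>X\<close> agree in \<open>m\<close> and hence in \<open>F(W')\<close>, although neither map
  to \<open>X\<close> need be monic.\<close>

lemma interpolation:
  assumes \<kappa>: "adequate \<kappa>" and V: "V \<in> Obj A" and \<sigma>: "\<sigma> \<in> hom B (OMap F V) X" "monomorphism B \<sigma>"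
    and W: "presentable \<kappa> A W" "w \<in> hom A W V"
    and m: "monomorphism B m" "presentable \<kappa> B (Dom B m)" "Comp B \<sigma> (AMap F w) \<preceq> m" "m \<preceq> \<sigma>"
  obtains W' w' t where "presentable \<kappa> A W'" "w' \<in> hom A W' V" "t \<in> hom A W W'" "Comp A w' t = w"
    "m \<preceq> Comp B \<sigma> (AMap F w')"
    "\<And>Q x y. x \<in> hom B Q (OMap F W) \<Longrightarrow> y \<in> hom B Q (OMap F W) \<Longrightarrow>
      Comp B (Comp B \<sigma> (AMap F w)) x = Comp B (Comp B \<sigma> (AMap F w)) y \<Longrightarrow>
      Comp B (AMap F t) x = Comp B (AMap F t) y"
proof -
  obtain I U T c where S: "directed_system TYPE('u) (I :: 'u set set) (\<subseteq>) A U T" "directed_below \<kappa> I (\<subseteq>)"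
    "\<forall>i \<in> I. presentable \<kappa> A (U i)" "system_colimit A I (\<subseteq>) U T V c"
    by (rule accessible_decomposition[OF PB.inacc filtered_colimits accessible adequateD(2-4)[OF \<kappa>] V])
  interpret S: directed_system "TYPE('u)" I "(\<subseteq>)" A U T by fact
  interpret FS: directed_system "TYPE('u)" I "(\<subseteq>)" B "OMap F \<circ> U" "\<lambda>i j. AMap F (T i j)"
    by (rule S.image_system[OF functor_F])
  note Fcol = S.colimit_preserved[OF functor_F preserves S(4)]
  note leg = S.sys_leg[OF S(4)] and nat = S.sys_natural[OF S(4)]
  have WA: "W \<in> Obj A" using W(2) A.hom_obj by blast
  have FW: "presentable \<kappa> B (OMap F W)" using presentable_image adequateD(2,4)[OF \<kappa>] W(1) by blast
  have Fw: "AMap F w \<in> hom B (OMap F W) (OMap F V)" using W(2) by (rule amap_hom)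
  obtain i t0 where i: "i \<in> I" "t0 \<in> hom A W (U i)" "Comp A (c i) t0 = w"
    by (rule S.sys_factor[OF S(4) W(1) S(2) W(2)])
  obtain p where p: "p \<in> hom B (Dom B m) (OMap F V)" "Comp B \<sigma> p = m"
    using m(4) \<sigma>(1) by (auto simp: B.factors_def hom_iff)
  obtain j q where j: "j \<in> I" "q \<in> hom B (Dom B m) (OMap F (U j))" "Comp B (AMap F (c j)) q = p"
    using FS.sys_factor[OF Fcol m(2) S(2) p(1)] by auto
  obtain h where h: "h \<in> hom B (OMap F W) (Dom B m)" "Comp B m h = Comp B \<sigma> (AMap F w)"
    using m(3) Fw \<sigma>(1) by (auto simp: B.factors_def hom_iff)
  have ph: "Comp B p h = AMap F w"
  proof (rule B.mono_cancel[OF \<sigma>(2)])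
    show "Comp B \<sigma> (Comp B p h) = Comp B \<sigma> (AMap F w)"
      using B.rewrite_left[OF p(2), of h] p(1) h \<sigma>(1) by (simp add: hom_iff)
  qed (use p h Fw \<sigma>(1) in \<open>auto simp: hom_iff\<close>)
  obtain k where k: "k \<in> I" "i \<subseteq> k" "j \<subseteq> k" using S.directed[OF i(1) j(1)] by blast
  note Tik = S.map_hom[OF i(1) k(1,2)] and Tjk = S.map_hom[OF j(1) k(1,3)]
  \<comment> \<open>Two maps from \<open>F(W)\<close> to stage \<open>k\<close>: one through
    \<open>m\<close>, the other the image of a map of \<open>A\<close>. They agree in
    \<open>F(V)\<close>, hence at a later stage.\<close>
  let ?a = "Comp B (Comp B (AMap F (T j k)) q) h" and ?b = "AMap F (Comp A (T i k) t0)"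
  have ab: "?a \<in> hom B (OMap F W) (OMap F (U k))" "?b \<in> hom B (OMap F W) (OMap F (U k))"
    using amap_hom[OF Tjk] j(2) h(1) amap_hom[OF A.comp_hom[OF i(2) Tik]] by (auto simp: hom_iff)
  have "Comp B (AMap F (c k)) ?a = Comp B (Comp B (Comp B (AMap F (c k)) (AMap F (T j k))) q) h"
    using amap_hom[OF Tjk] amap_hom[OF leg[OF k(1)]] j(2) h(1) by (simp add: hom_iff)
  also have "\<dots> = AMap F w"
    unfolding amap_comp[OF Tjk leg[OF k(1)], symmetric] nat[OF j(1) k(1,3)] j(3) ph ..
  also have "\<dots> = Comp B (AMap F (c k)) ?b"
  proof -
    have "Comp A (c k) (Comp A (T i k) t0) = w"
      using A.rewrite_left[OF nat[OF i(1) k(1,2)], of t0] i(2,3) Tik leg[OF k(1)] by (simp add: hom_iff)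
    then show ?thesis using amap_comp[OF A.comp_hom[OF i(2) Tik] leg[OF k(1)]] by simp
  qed
  finally have eq: "Comp B (AMap F (c k)) ?a = Comp B (AMap F (c k)) ?b" .
  obtain l where l: "l \<in> I" "k \<subseteq> l" "Comp B (AMap F (T k l)) ?a = Comp B (AMap F (T k l)) ?b"
    by (rule FS.sys_factor_eq[OF Fcol FW S(2) k(1) _ _ eq]) (use ab in auto)
  note Tkl = S.map_hom[OF k(1) l(1,2)]
  let ?t = "Comp A (T k l) (Comp A (T i k) t0)" and ?q = "Comp B (AMap F (T k l)) (Comp B (AMap F (T j k)) q)"
  have t: "?t \<in> hom A W (U l)" using Tkl Tik i(2) by (auto simp: hom_iff)
  have q: "?q \<in> hom B (Dom B m) (OMap F (U l))" using amap_hom[OF Tkl] amap_hom[OF Tjk] j(2) by (auto simp: hom_iff)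
  have Ft: "AMap F ?t = Comp B ?q h"
    using amap_comp[OF A.comp_hom[OF i(2) Tik] Tkl] l(3) amap_hom[OF Tkl] amap_hom[OF Tjk] j(2) h(1) by (simp add: hom_iff)
  show ?thesis
  proof (rule that[OF _ leg[OF l(1)] t])
    show "presentable \<kappa> A (U l)" using S(3) l(1) by blast
    show "Comp A (c l) ?t = w"
      using A.rewrite_left[OF nat[OF k(1) l(1,2)], of "Comp A (T i k) t0"]
        A.rewrite_left[OF nat[OF i(1) k(1,2)], of t0] i(2,3) Tik Tkl leg[OF k(1)] leg[OF l(1)] by (simp add: hom_iff)
    have c1: "Comp B (AMap F (c l)) (AMap F (T k l)) = AMap F (c k)"
      using amap_comp[OF Tkl leg[OF l(1)]] nat[OF k(1) l(1,2)] by simp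
    have c2: "Comp B (AMap F (c k)) (AMap F (T j k)) = AMap F (c j)"
      using amap_comp[OF Tjk leg[OF k(1)]] nat[OF j(1) k(1,3)] by simp
    note H = amap_hom[OF Tkl] amap_hom[OF Tjk] amap_hom[OF leg[OF l(1)]] amap_hom[OF leg[OF k(1)]]
    have "Comp B (AMap F (c l)) ?q = Comp B (AMap F (c k)) (Comp B (AMap F (T j k)) q)"
      by (rule B.rewrite_left[OF c1]) (use H j(2) in \<open>auto simp: hom_iff\<close>)
    also have "\<dots> = Comp B (AMap F (c j)) q"
      by (rule B.rewrite_left[OF c2]) (use H j(2) in \<open>auto simp: hom_iff\<close>)
    finally have cq: "Comp B (AMap F (c l)) ?q = p" using j(3) by simp
    have "Comp B (Comp B \<sigma> (AMap F (c l))) ?q = Comp B \<sigma> (Comp B (AMap F (c l)) ?q)"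
      using B.comp_assoc[OF q H(3) \<sigma>(1)] by simp
    then have "Comp B (Comp B \<sigma> (AMap F (c l))) ?q = m" unfolding cq p(2) .
    then show "m \<preceq> Comp B \<sigma> (AMap F (c l))" using q H(3) \<sigma>(1) by (intro B.factorsI[of ?q]) (auto simp: hom_iff)
    fix Q x y assume x: "x \<in> hom B Q (OMap F W)" "y \<in> hom B Q (OMap F W)"
      and e: "Comp B (Comp B \<sigma> (AMap F w)) x = Comp B (Comp B \<sigma> (AMap F w)) y"
    have marr: "m \<in> Arr B" using B.mono_arr[OF m(1)] .
    have "Comp B m (Comp B h x) = Comp B m (Comp B h y)"
      using e h marr x unfolding h(2)[symmetric] by (simp add: hom_iff)
    then have "Comp B h x = Comp B h y"
      by (rule B.mono_cancel[OF m(1)]) (use h(1) x in \<open>auto simp: hom_iff\<close>)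
    then show "Comp B (AMap F ?t) x = Comp B (AMap F ?t) y"
      unfolding Ft using B.comp_assoc[OF x(1) h(1) q] B.comp_assoc[OF x(2) h(1) q] by simp
  qed
qed

lemma leg_factors: "closed K \<Longrightarrow> n \<in> Dom J ` K \<Longrightarrow> \<iota> n \<preceq> s K"
  using B.comp_factors[of "PB.cleg K n" "s K"] PB.s_cleg PB.cleg_hom by (auto simp: hom_iff)

lemma ex_closure:
  assumes \<kappa>: "adequate \<kappa>" and Z: "Z \<subseteq> Arr J" "|Z| <o \<kappa>"
  obtains M where "closed M" "Z \<subseteq> M" "|M| <o \<kappa>"
  by (rule PB.ex_closure[OF adequateD(1)[OF \<kappa>] PB.closed_Arr Z], rule that)

lemma closed_capturing:
  assumes \<kappa>: "adequate \<kappa>" and "presentable \<kappa> B P" "p \<in> hom B P X" and Z: "Z \<subseteq> Arr J" "|Z| <o \<kappa>"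
  obtains M where "closed M" "Z \<subseteq> M" "|M| <o \<kappa>" "p \<preceq> s M"
proof -
  obtain N where N: "closed N" "|N| <o \<kappa>" "p \<preceq> s N" by (rule PB.presentable_factors[OF adequateD(1)[OF \<kappa>] assms(2,3)])
  have "|N \<union> Z| <o \<kappa>" "N \<union> Z \<subseteq> Arr J" using Un_Cinfinite_bound_strict[OF N(2) Z(2) adequateD(5)[OF \<kappa>]] PB.closedD(1)[OF N(1)] Z(1) by auto
  then obtain M where M: "closed M" "N \<union> Z \<subseteq> M" "|M| <o \<kappa>" using ex_closure[OF \<kappa>] by blast
  have "p \<preceq> s M" using B.factors_trans[OF _ N(3) PB.s_subset[OF N(1) M(1)]] M by auto
  then show ?thesis using that M by blast
qed

end

section \<open>Filters of subobjects and a positional game\<close>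

text \<open>Positional determinacy of the game in which a position \<open>K\<close> is answered, after a challenge
  \<open>Z\<close>, by some \<open>N\<close> with \<open>R K Z N\<close>, and in which infinite plays are won by the second player.
  Every position lost for the second player is so by some positional strategy \<open>f\<close> of
  challenges; using for each position the first such \<open>f\<close> in a well-order merges them into one.\<close>

lemma open_game_determinacy:
  fixes R :: "'k \<Rightarrow> 'z \<Rightarrow> 'k \<Rightarrow> bool"
  shows "\<exists>z G. (\<forall>K \<in> G. \<forall>Z. \<exists>N \<in> G. R K Z N) \<and>
    (\<forall>k :: nat \<Rightarrow> 'k. (\<forall>n. R (k n) (z (k n)) (k (Suc n))) \<longrightarrow> (\<exists>n. k n \<in> G))"
proof -
  \<comment> \<open>The positions from which every play against the challenges \<open>f\<close> is
    finite, as an accessible part.\<close>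
  define W where "W f = Wellfounded.acc {(N, K). R K (f K) N}" for f
  obtain r :: "('k \<Rightarrow> 'z) rel" where r: "well_order_on UNIV r" using well_order_on by blast
  have wf: "wf (r - Relation.Id)" using r by (simp add: well_order_on_def)
  define first where "first K = (SOME f. K \<in> W f \<and> (\<forall>h. (h, f) \<in> r - Relation.Id \<longrightarrow> K \<notin> W h))" for K
  have first: "K \<in> W (first K)" "\<And>h. K \<in> W h \<Longrightarrow> h = first K \<or> (first K, h) \<in> r - Relation.Id" if "K \<in> W f" for K f
  proof -
    have "f \<in> {f. K \<in> W f}" using that by simp
    then have "\<exists>f. K \<in> W f \<and> (\<forall>h. (h, f) \<in> r - Relation.Id \<longrightarrow> K \<notin> W h)"
      by (rule wfE_min[OF wf]) blast
    then have *: "K \<in> W (first K) \<and> (\<forall>h. (h, first K) \<in> r - Relation.Id \<longrightarrow> K \<notin> W h)"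
      unfolding first_def by (rule someI_ex)
    then show "K \<in> W (first K)" by blast
    fix h assume "K \<in> W h"
    then have "(h, first K) \<notin> r - Relation.Id" using * by blast
    moreover have "h = first K \<or> (h, first K) \<in> r \<or> (first K, h) \<in> r"
      using r by (auto simp: well_order_on_def linear_order_on_def total_on_def)
    ultimately show "h = first K \<or> (first K, h) \<in> r - Relation.Id" by blast
  qed
  define z where "z K = first K K" for K
  \<comment> \<open>A move under \<open>z\<close> from \<open>K\<close> is a move under
    \<open>f = first K\<close>. Either \<open>f\<close> is still the first strategy for the new
    position, and accessibility under \<open>f\<close> descends, or an earlier strategy takes over,
    and the well-order descends.\<close>
  have union: "K \<in> W z" if "K \<in> W f" "first K = f" for K f
    using that
  proof (induction f arbitrary: K rule: wf_induct_rule[OF wf])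
    case (1 f)
    from \<open>K \<in> W f\<close> have "K \<in> Wellfounded.acc {(N, K). R K (f K) N}" by (simp add: W_def)
    then show ?case using \<open>first K = f\<close>
    proof (induction K rule: acc.induct)
      case (accI K)
      show ?case unfolding W_def
      proof (rule acc.accI)
        fix N assume "(N, K) \<in> {(N, K). R K (z K) N}"
        then have N: "(N, K) \<in> {(N, K). R K (f K) N}" using accI.prems by (simp add: z_def)
        then have Nf: "N \<in> W f" using accI.hyps by (simp add: W_def)
        then consider "first N = f" | "(first N, f) \<in> r - Relation.Id" using first(2)[OF Nf Nf] by auto
        then have "N \<in> W z"
        proof cases
          case 1 then show ?thesis using accI.IH N by blast
        next
          case 2 then show ?thesis using 1(1) first(1)[OF Nf] by blast
        qed
        then show "N \<in> Wellfounded.acc {(N, K). R K (z K) N}" by (simp add: W_def)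
      qed
    qed
  qed
  \<comment> \<open>If every answer to \<open>Z\<close> at \<open>K\<close> led into
    \<open>W z\<close>, redefining \<open>z\<close> at \<open>K\<close> as \<open>Z\<close> would
    put \<open>K\<close> into the set of the new strategy, hence into \<open>W z\<close>. The
    redefinition affects no play from \<open>W z\<close>, since such a play never reaches
    \<open>K\<close>.\<close>
  have "\<exists>N. N \<notin> W z \<and> R K Z N" if K: "K \<notin> W z" for K Z
  proof (rule ccontr)
    assume no: "\<not> ?thesis"
    have upd: "N \<in> W (z(K := Z))" if "N \<in> W z" for N
    proof -
      have "N \<in> Wellfounded.acc {(N, K). R K (z K) N}" using that by (simp add: W_def)
      then show ?thesis
      proof (induction N rule: acc.induct)
        case (accI N)
        have "N \<in> W z" unfolding W_def by (rule acc.accI) (rule accI.hyps)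
        then have "N \<noteq> K" using K by blast
        show ?case unfolding W_def
        proof (rule acc.accI)
          fix M assume "(M, N) \<in> {(N, K'). R K' ((z(K := Z)) K') N}"
          then have "(M, N) \<in> {(N, K). R K (z K) N}" using \<open>N \<noteq> K\<close> by simp
          then show "M \<in> Wellfounded.acc {(N, K'). R K' ((z(K := Z)) K') N}" using accI.IH by (simp add: W_def)
        qed
      qed
    qed
    have "K \<in> W (z(K := Z))" unfolding W_def
    proof (rule acc.accI)
      fix N assume "(N, K) \<in> {(N, K'). R K' ((z(K := Z)) K') N}"
      then have "N \<in> W z" using no by auto
      then show "N \<in> Wellfounded.acc {(N, K'). R K' ((z(K := Z)) K') N}" using upd by (simp only: W_def)
    qed
    then show False using K union[OF first(1)] by blast
  qed
  moreover have "\<exists>n. k n \<notin> W z" if "\<And>n. R (k n) (z (k n)) (k (Suc n))" for k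
  proof -
    have "\<not> (\<forall>n. R (k n) (z (k n)) (k (Suc n)))" if "K \<in> Wellfounded.acc {(N, K). R K (z K) N}" "k 0 = K" for K k
      using that
    proof (induction K arbitrary: k rule: acc.induct)
      case (accI K)
      then show ?case using accI(2)[of "k (Suc 0)" "\<lambda>n. k (Suc n)"] by auto
    qed
    then show ?thesis using that unfolding W_def by blast
  qed
  ultimately show ?thesis by (intro exI[of _ z] exI[of _ "- W z"]) blast
qed

section \<open>Slices and the preorder of subobjects\<close>

lemma hom_slice: "x \<in> hom (slice C X) v w \<longleftrightarrow> v \<in> Arr C \<and> Cod C v = X \<and> w \<in> Arr C \<and> Cod C w = X \<and>
    (\<exists>h \<in> hom C (Dom C v) (Dom C w). Comp C w h = v \<and> x = (v, h, w))"
  by (auto simp: slice_def hom_iff)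

lemma (in category) category_slice: "category (slice C X)"
proof
  fix f x y g z assume "f \<in> hom (slice C X) x y" "g \<in> hom (slice C X) y z"
  then obtain h k where h: "f = (x, h, y)" "h \<in> hom C (Dom C x) (Dom C y)" "Comp C y h = x"
    and k: "g = (y, k, z)" "k \<in> hom C (Dom C y) (Dom C z)" "Comp C z k = y"
    and o: "x \<in> Arr C" "Cod C x = X" "z \<in> Arr C" "Cod C z = X" unfolding hom_slice by blast
  have c: "Comp (slice C X) g f = (x, Comp C k h, z)" using h(1) k(1) by (simp add: slice_def)
  have "Comp C z (Comp C k h) = x" using rewrite_left[OF k(3), of h] h(2,3) k(2) o by (simp add: hom_iff)
  then show "Comp (slice C X) g f \<in> hom (slice C X) x z"
    unfolding c hom_slice using comp_hom[OF h(2) k(2)] o by blast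
next
  fix f w x g y h z assume f: "f \<in> hom (slice C X) w x" and g: "g \<in> hom (slice C X) x y" and h: "h \<in> hom (slice C X) y z"
  obtain f' g' h' where *: "f = (w, f', x)" "f' \<in> hom C (Dom C w) (Dom C x)" "g = (x, g', y)" "g' \<in> hom C (Dom C x) (Dom C y)"
    "h = (y, h', z)" "h' \<in> hom C (Dom C y) (Dom C z)" using f g h unfolding hom_slice by blast
  show "Comp (slice C X) h (Comp (slice C X) g f) = Comp (slice C X) (Comp (slice C X) h g) f"
    unfolding *(1,3,5) using comp_assoc[OF *(2,4,6)] by (simp add: slice_def)
next
  fix x assume "x \<in> Obj (slice C X)"
  then show "Id (slice C X) x \<in> hom (slice C X) x x"
    unfolding hom_slice using id_hom[OF dom_obj, of x] by (auto simp: slice_def)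
next
  fix f x y assume "f \<in> hom (slice C X) x y"
  then show "Comp (slice C X) f (Id (slice C X) x) = f" "Comp (slice C X) (Id (slice C X) y) f = f"
    using comp_id id_comp unfolding hom_slice by (auto simp: slice_def)
qed (auto simp: slice_def)

lemma category_full_subcategory:
  assumes "category C" shows "category (full_subcategory C S)"
proof -
  interpret category C by fact
  show ?thesis
    by unfold_locales (auto simp: full_subcategory_def hom_iff dom_obj cod_obj)
qed

context category
begin

lemma Obj_Sub: "m \<in> Obj (Sub C X) \<longleftrightarrow> monomorphism C m \<and> Cod C m = X"
  by (auto simp: Sub_def full_subcategory_def slice_def monomorphism_def)

lemma hom_Sub: "x \<in> hom (Sub C X) v w \<longleftrightarrow> v \<in> Obj (Sub C X) \<and> w \<in> Obj (Sub C X) \<and>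
    (\<exists>h \<in> hom C (Dom C v) (Dom C w). Comp C w h = v \<and> x = (v, h, w))"
proof -
  have "x \<in> hom (Sub C X) v w \<longleftrightarrow> x \<in> hom (slice C X) v w \<and> monomorphism C v \<and> monomorphism C w"
    by (auto simp: Sub_def full_subcategory_def hom_iff)
  then show ?thesis unfolding hom_slice Obj_Sub using mono_arr by blast
qed

lemma contains_iff: "contains C X w v \<longleftrightarrow> v \<in> Obj (Sub C X) \<and> w \<in> Obj (Sub C X) \<and> factors v w"
  by (auto simp: contains_def hom_Sub factors_def ex_in_conv[symmetric])

lemma category_Sub: "category (Sub C X)"
  unfolding Sub_def by (intro category_full_subcategory category_slice)

lemma Sub_thin: "x \<in> hom (Sub C X) v w \<Longrightarrow> y \<in> hom (Sub C X) v w \<Longrightarrow> x = y"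
  by (auto simp: hom_Sub Obj_Sub dest: mono_cancel)

end

locale filter_setting = compactness_setting A B F J D X \<iota> extra \<mu>
  for A :: "('o, 'a) cat" and B :: "('p, 'b) cat" and F and J :: "('u, 'u) cat" and D X \<iota> extra \<mu> +
  fixes \<kappa> :: "'u rel" and \<F> :: "'b set"
  assumes \<kappa>: "adequate \<kappa>" and filter: "is_filter \<kappa> B X \<F>" and dense: "is_dense \<kappa> B X \<F>"
    and image: "U \<in> \<F> \<Longrightarrow> in_image A B F (Dom B U)"
begin

lemmas \<kappa>D = adequateD[OF \<kappa>]

lemma member: "m \<in> \<F> \<Longrightarrow> monomorphism B m" "m \<in> \<F> \<Longrightarrow> Cod B m = X" "m \<in> \<F> \<Longrightarrow> m \<in> Arr B"
  using filter B.Obj_Sub B.mono_arr unfolding is_filter_def by blast+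

lemma s_sub: "closed K \<Longrightarrow> s K \<in> Obj (Sub B X)"
  by (simp add: B.Obj_Sub PB.s_mono)

lemma ex_member:
  assumes "monomorphism B m" "Cod B m = X" "presentable \<kappa> B (Dom B m)"
  obtains U where "U \<in> \<F>" "presentable \<kappa> B (Dom B U)" "m \<preceq> U"
  using dense assms unfolding is_dense_def B.contains_iff by (auto simp: B.Obj_Sub)

lemma member_of_union:
  assumes "directed_index TYPE('u) I le" and card: "|I| \<le>o \<kappa>"
    and U: "\<And>i. i \<in> I \<Longrightarrow> U i \<in> \<F>" "\<And>i. i \<in> I \<Longrightarrow> presentable \<kappa> B (Dom B (U i))"
      "\<And>i j. i \<in> I \<Longrightarrow> j \<in> I \<Longrightarrow> le i j \<Longrightarrow> U i \<preceq> U j"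
    and K: "closed K" "\<And>i. i \<in> I \<Longrightarrow> U i \<preceq> s K" "\<And>n. n \<in> Dom J ` K \<Longrightarrow> \<exists>i \<in> I. \<iota> n \<preceq> U i"
  shows "\<exists>L \<in> \<F>. L \<preceq> s K \<and> s K \<preceq> L"
proof -
  interpret I: directed_index "TYPE('u)" I le by fact
  let ?S = "full_subcategory (Sub B X) \<F>"
  have o: "U i \<in> Obj (Sub B X)" if "i \<in> I" for i using member U(1)[OF that] by (simp add: B.Obj_Sub)
  have homS: "x \<in> hom ?S (U i) (U j) \<longleftrightarrow> x \<in> hom (Sub B X) (U i) (U j)" if "i \<in> I" "j \<in> I" for x i j
    using U(1) that by (auto simp: full_subcategory_def hom_iff)
  have "\<exists>h. h \<in> hom (Sub B X) (U i) (U j)" if "i \<in> I \<and> j \<in> I \<and> le i j" for i j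
    using U(3)[of i j] o that unfolding B.hom_Sub B.factors_def by blast
  then obtain t where t: "\<And>i j. i \<in> I \<and> j \<in> I \<and> le i j \<Longrightarrow> t i j \<in> hom (Sub B X) (U i) (U j)" by metis
  interpret Sub: category "Sub B X" by (rule B.category_Sub)
  have cS: "category ?S" by (intro category_full_subcategory B.category_Sub)
  interpret S: directed_system "TYPE('u)" I le ?S U t
  proof (rule directed_system.intro[OF I.directed_index_axioms cS], unfold_locales)
    fix i j k assume "i \<in> I" "j \<in> I" "k \<in> I" "le i j" "le j k"
    moreover then have "le i k" using I.trans by blast
    ultimately have "Comp (Sub B X) (t j k) (t i j) = t i k"
      by (intro B.Sub_thin[OF Sub.comp_hom[OF t t] t]) auto
    then show "Comp ?S (t j k) (t i j) = t i k" by (simp add: full_subcategory_def)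
  next
    fix i assume i: "i \<in> I"
    show "U i \<in> Obj ?S" using o[OF i] U(1)[OF i] by (simp add: full_subcategory_def)
    have "t i i = Id (Sub B X) (U i)" using B.Sub_thin[OF t Sub.id_hom[OF o[OF i]]] i I.refl by blast
    then show "t i i = Id ?S (U i)" by (simp add: full_subcategory_def)
  qed (use t homS in blast)
  have "|I \<times> I| \<le>o \<kappa>"
    using card_of_Times_ordLeq_infinite_Field[of \<kappa> I I] \<kappa>D(5) card by (simp add: cinfinite_def)
  moreover have "Arr I.J \<subseteq> I.code ` (I \<times> I)" by (auto simp: poset_cat_def)
  ultimately have "|Arr I.J| \<le>o \<kappa>"
    using ordLeq_transitive[OF card_of_mono1 ordLeq_transitive[OF card_of_image]] by blast
  then have "cat_card I.J \<le>o \<kappa>" unfolding cat_card_def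
    using natLeq_ordLeq_cinfinite \<kappa>D(5) by (intro csum_cinfinite_bound card_of_Card_order natLeq_Card_order)
  moreover have "\<forall>x \<in> Obj I.J. presentable \<kappa> B (Dom B (OMap S.D x))" using U(2) by (auto simp: I.Obj_iff)
  ultimately have "directed_poset I.J \<and> cat_card I.J \<le>o \<kappa> \<and> is_functor I.J ?S S.D \<and>
      (\<forall>x \<in> Obj I.J. presentable \<kappa> B (Dom B (OMap S.D x)))"
    using I.directed_poset_J S.functor_D by (intro conjI)
  note ex = filter[unfolded is_filter_def, THEN conjunct2, THEN spec, THEN spec, THEN mp, OF this]
  obtain L \<tau> where L: "is_colimit (Sub B X) I.J S.D L \<tau>" "L \<in> \<F>" by (insert ex, elim exE conjE, rule that)
  have "\<exists>h. h \<in> hom (Sub B X) (U i) (s K)" if "i \<in> I" for i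
    using K(2)[OF that] o[OF that] s_sub[OF K(1)] unfolding B.hom_Sub B.factors_def by blast
  then obtain d where d: "\<And>i. i \<in> I \<Longrightarrow> d i \<in> hom (Sub B X) (U i) (s K)" by metis
  have "cocone (Sub B X) I.J S.D (s K) (\<lambda>x. d (fst (pair_decode I x)))"
    unfolding cocone_def
  proof (intro conjI ballI)
    fix x assume "x \<in> Arr I.J"
    then obtain i j where ij: "i \<in> I" "j \<in> I" "le i j" "x = I.code (i, j)" by (auto simp: I.Arr_iff)
    then show "Comp (Sub B X) (d (fst (pair_decode I (Cod I.J x)))) (AMap S.D x) = d (fst (pair_decode I (Dom I.J x)))"
      using B.Sub_thin[OF Sub.comp_hom[OF t d] d, of i j] by simp
  qed (use d s_sub[OF K(1)] I.Obj_iff in auto)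
  then obtain h where "h \<in> hom (Sub B X) L (s K)" using L(1) unfolding is_colimit_def by blast
  then have 1: "L \<preceq> s K" unfolding B.hom_Sub B.factors_def by blast
  have UL: "U i \<preceq> L" if "i \<in> I" for i
  proof -
    have "\<tau> (I.code (i, i)) \<in> hom (Sub B X) (OMap S.D (I.code (i, i))) L"
      using L(1)[unfolded is_colimit_def cocone_def] I.Obj_iff that by blast
    then show ?thesis using that unfolding B.hom_Sub B.factors_def by auto
  qed
  have "\<iota> n \<preceq> L" if n: "n \<in> Dom J ` K" for n
    using K(3)[OF n] UL B.factors_trans[OF member(3)[OF L(2)]] by blast
  then have "s K \<preceq> L" using PB.s_factors_iff[OF K(1) member(1,2)[OF L(2)]] by blast
  then show ?thesis using 1 L(2) by blast
qed

definition in_filter :: "'u set \<Rightarrow> bool" where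
  "in_filter K \<longleftrightarrow> closed K \<and> (\<exists>U \<in> \<F>. U \<preceq> s K \<and> s K \<preceq> U)"

definition nice :: "'u set \<Rightarrow> bool" where
  "nice K \<longleftrightarrow> in_filter K \<and> |K| <o \<kappa>"

lemma niceD: "nice K \<Longrightarrow> closed K" "nice K \<Longrightarrow> |K| <o \<kappa>" "nice K \<Longrightarrow> in_filter K"
  by (auto simp: nice_def in_filter_def)

text \<open>\<open>U\<close> and \<open>s K\<close> represent the same subobject, so the isomorphism
  between the domain of \<open>U\<close> and some \<open>F(V)\<close> gives a structure on
  \<open>K\<close>.\<close>

lemma in_filter_carries:
  assumes "in_filter K" obtains V \<sigma> where "carries V \<sigma> K"
proof -
  obtain U where K: "closed K" and U: "U \<in> \<F>" "U \<preceq> s K" "s K \<preceq> U" using assms unfolding in_filter_def by blast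
  obtain V where V: "V \<in> Obj A" "isomorphic B (Dom B U) (OMap F V)" using image[OF U(1)] unfolding in_image_def by blast
  obtain f g where f: "f \<in> hom B (Dom B U) (OMap F V)" "g \<in> hom B (OMap F V) (Dom B U)"
    "Comp B g f = Id B (Dom B U)" "Comp B f g = Id B (OMap F V)" using PB.isomorphicD[OF V(2)] by blast
  note m = member[OF U(1)]
  let ?\<sigma> = "Comp B U g"
  have h: "?\<sigma> \<in> hom B (OMap F V) X" using f m by (auto simp: hom_iff)
  have "monomorphism B ?\<sigma>" unfolding monomorphism_def
  proof (intro conjI allI ballI impI)
    fix Q x y assume x: "x \<in> hom B Q (Dom B ?\<sigma>)" "y \<in> hom B Q (Dom B ?\<sigma>)" and e: "Comp B ?\<sigma> x = Comp B ?\<sigma> y"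
    have "Comp B U (Comp B g x) = Comp B U (Comp B g y)" using e x f m by (simp add: hom_iff)
    then have "Comp B g x = Comp B g y"
      by (rule B.mono_cancel[OF m(1)]) (use x f m in \<open>auto simp: hom_iff\<close>)
    then have "Comp B f (Comp B g x) = Comp B f (Comp B g y)" by simp
    then show "x = y"
      using B.rewrite_left[OF f(4), of x] B.rewrite_left[OF f(4), of y] f(1,2) x m omap_obj[OF V(1)]
      by (simp add: hom_iff)
  qed (use h in \<open>simp add: hom_iff\<close>)
  moreover have "?\<sigma> \<preceq> U" using f m by (intro B.comp_factors) (auto simp: hom_iff)
  moreover have "Comp B ?\<sigma> f = U" using f m B.dom_obj by (simp add: hom_iff)
  then have "U \<preceq> ?\<sigma>" using f h by (intro B.factorsI[of f]) (auto simp: hom_iff)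
  ultimately have "carries V ?\<sigma> K"
    using B.factors_trans[of "s K" ?\<sigma> U] B.factors_trans[of ?\<sigma> "s K" U] U h V(1) K
    by (auto simp: carries_def hom_iff)
  then show ?thesis by (rule that)
qed

lemma in_filter_Union:
  assumes nice: "\<And>M. M \<in> \<M> \<Longrightarrow> nice M" and ne: "\<M> \<noteq> {}"
    and chain: "\<And>M N. M \<in> \<M> \<Longrightarrow> N \<in> \<M> \<Longrightarrow> M \<subseteq> N \<or> N \<subseteq> M" and card: "|\<M>| \<le>o \<kappa>"
  shows "in_filter (\<Union>\<M>)"
proof -
  have cl: "closed (\<Union>\<M>)"
  proof (rule PB.closed_Union[OF niceD(1)[OF nice] ne])
    fix M N assume MN: "M \<in> \<M>" "N \<in> \<M>"
    from chain[OF this] show "\<exists>K \<in> \<M>. M \<union> N \<subseteq> K"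
    proof
      assume "M \<subseteq> N" then show ?thesis using MN(2) by (intro bexI[of _ N]) auto
    next
      assume "N \<subseteq> M" then show ?thesis using MN(1) by (intro bexI[of _ M]) auto
    qed
  qed
  have "|\<M>| <o |UNIV :: 'u set|" using ordLeq_ordLess_trans[OF card] regular_cardinalD(4)[OF \<kappa>D(2)] by blast
  then have I: "directed_index TYPE('u) \<M> (\<subseteq>)"
  proof unfold_locales
    fix M N assume MN: "M \<in> \<M>" "N \<in> \<M>"
    from chain[OF this] show "\<exists>K \<in> \<M>. M \<subseteq> K \<and> N \<subseteq> K" using MN by blast
  qed (use ne PB.inacc in auto)
  have "\<exists>U. U \<in> \<F> \<and> U \<preceq> s M \<and> s M \<preceq> U" if "M \<in> \<M>" for M
    using niceD(3)[OF nice[OF that]] by (auto simp: in_filter_def)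
  then obtain U where U: "\<And>M. M \<in> \<M> \<Longrightarrow> U M \<in> \<F>" "\<And>M. M \<in> \<M> \<Longrightarrow> U M \<preceq> s M" "\<And>M. M \<in> \<M> \<Longrightarrow> s M \<preceq> U M" by metis
  have "\<exists>L \<in> \<F>. L \<preceq> s (\<Union>\<M>) \<and> s (\<Union>\<M>) \<preceq> L"
  proof (rule member_of_union[OF I card, of U])
    fix M assume M: "M \<in> \<M>"
    note c = niceD(1)[OF nice[OF M]]
    show "U M \<in> \<F>" using U(1)[OF M] .
    show "presentable \<kappa> B (Dom B (U M))"
      using B.mono_equiv_presentable[OF PB.inacc PB.s_mono[OF c] member(1)[OF U(1)[OF M]] U(3)[OF M] U(2)[OF M]]
        PB.s_presentable[OF c niceD(2)[OF nice[OF M]] \<kappa>D(2)] by blast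
    show "U M \<preceq> s (\<Union>\<M>)" using B.factors_trans[OF _ U(2)[OF M] PB.s_subset[OF c cl]] M cl by auto
    fix N assume N: "N \<in> \<M>" "M \<subseteq> N"
    note c' = niceD(1)[OF nice[OF N(1)]]
    have "U M \<preceq> s N" using B.factors_trans[OF _ U(2)[OF M] PB.s_subset[OF c c' N(2)]] c' by simp
    then show "U M \<preceq> U N" using B.factors_trans[OF member(3)[OF U(1)[OF N(1)]] _ U(3)[OF N(1)]] by blast
  next
    fix n assume "n \<in> Dom J ` \<Union>\<M>"
    then obtain M where M: "M \<in> \<M>" "n \<in> Dom J ` M" by blast
    then have "\<iota> n \<preceq> U M"
      using B.factors_trans[OF member(3)[OF U(1)[OF M(1)]] leg_factors[OF niceD(1)[OF nice[OF M(1)]] M(2)] U(3)[OF M(1)]] by blast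
    then show "\<exists>M \<in> \<M>. \<iota> n \<preceq> U M" using M(1) by blast
  qed (rule cl)
  then show ?thesis using cl by (simp add: in_filter_def)
qed

lemma nice_Union:
  assumes "\<And>M. M \<in> \<M> \<Longrightarrow> nice M" "\<M> \<noteq> {}" "\<And>M N. M \<in> \<M> \<Longrightarrow> N \<in> \<M> \<Longrightarrow> M \<subseteq> N \<or> N \<subseteq> M" "|\<M>| <o \<kappa>"
  shows "nice (\<Union>\<M>)"
proof -
  have "|\<Union>M \<in> \<M>. M| <o \<kappa>" using niceD(2)[OF assms(1)] by (intro stable_UNION \<kappa>D(6) assms(4))
  then show ?thesis using in_filter_Union[OF assms(1-3) ordLess_imp_ordLeq[OF assms(4)]] by (simp add: nice_def)
qed

text \<open>Closed sets and filter members dominate each other alternately, by density and by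
  presentability; after countably many steps the union of the sets and that of the members are the
  same subobject.\<close>

lemma ex_nice:
  assumes Z: "Z \<subseteq> Arr J" "|Z| <o \<kappa>" obtains K where "nice K" "Z \<subseteq> K"
proof -
  define P where "P x \<longleftrightarrow> closed (fst x) \<and> Z \<subseteq> fst x \<and> |fst x| <o \<kappa> \<and> snd x \<in> \<F> \<and>
    presentable \<kappa> B (Dom B (snd x)) \<and> s (fst x) \<preceq> snd x" for x
  have ext: "\<exists>U. P (M, U)" if M: "closed M" "Z \<subseteq> M" "|M| <o \<kappa>" for M
  proof -
    obtain U where "U \<in> \<F>" "presentable \<kappa> B (Dom B U)" "s M \<preceq> U"
      using ex_member[OF PB.s_mono[OF M(1)] _ PB.s_presentable[OF M(1,3) \<kappa>D(2)]] M(1) by auto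
    then show ?thesis using M by (auto simp: P_def)
  qed
  have "\<exists>f. \<forall>n :: nat. P (f n) \<and> (fst (f n) \<subseteq> fst (f (Suc n)) \<and> snd (f n) \<preceq> s (fst (f (Suc n))))"
  proof (rule dependent_nat_choice)
    obtain M where "closed M" "Z \<subseteq> M" "|M| <o \<kappa>" using ex_closure[OF \<kappa> Z] by blast
    then show "\<exists>x. P x" using ext by blast
  next
    fix x and n :: nat assume x: "P x"
    have "snd x \<in> hom B (Dom B (snd x)) X" using x member by (auto simp: P_def hom_iff)
    moreover have "fst x \<subseteq> Arr J" using x PB.closedD(1) by (auto simp: P_def)
    ultimately obtain M where M: "closed M" "fst x \<subseteq> M" "|M| <o \<kappa>" "snd x \<preceq> s M"
      using closed_capturing[OF \<kappa>, of "Dom B (snd x)" "snd x" "fst x"] x unfolding P_def by blast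
    then obtain U where "P (M, U)" using ext[of M] x by (auto simp: P_def)
    then show "\<exists>y. P y \<and> fst x \<subseteq> fst y \<and> snd x \<preceq> s (fst y)" using M by (intro exI[of _ "(M, U)"]) auto
  qed
  then obtain f where f: "\<And>n. P (f n)" "\<And>n. fst (f n) \<subseteq> fst (f (Suc n))" "\<And>n. snd (f n) \<preceq> s (fst (f (Suc n)))" by blast
  define K U where "K n = fst (f n)" and "U n = snd (f n)" for n
  have K: "closed (K n)" "Z \<subseteq> K n" "|K n| <o \<kappa>" "U n \<in> \<F>" "presentable \<kappa> B (Dom B (U n))" "s (K n) \<preceq> U n"
    "U n \<preceq> s (K (Suc n))" "K n \<subseteq> K (Suc n)" for n using f unfolding P_def K_def U_def by auto
  have mono: "K n \<subseteq> K m" if "n \<le> m" for n m by (rule lift_Suc_mono_le[where f = K, OF K(8) that])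
  let ?K = "\<Union>n. K n"
  have nat: "|UNIV :: nat set| <o \<kappa>" by (rule ordIso_ordLess_trans[OF card_of_nat \<kappa>D(3)])
  have card: "|?K| <o \<kappa>" by (intro stable_UNION[OF \<kappa>D(6) nat] K(3))
  have cl: "closed ?K"
  proof (rule PB.closed_Union)
    fix M N assume "M \<in> range K" "N \<in> range K"
    then obtain m n where "M = K m" "N = K n" by blast
    then show "\<exists>L \<in> range K. M \<union> N \<subseteq> L" using mono[of m "max m n"] mono[of n "max m n"] by auto
  qed (use K(1) in auto)
  have UU: "U i \<preceq> U (Suc i)" for i using B.factors_trans[OF member(3)[OF K(4)] K(7) K(6)] .
  have "\<exists>L \<in> \<F>. L \<preceq> s ?K \<and> s ?K \<preceq> L"
  proof (rule member_of_union[of "UNIV :: nat set" "(\<le>)" U])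
    have "|UNIV :: nat set| <o |UNIV :: 'u set|" using ordIso_ordLess_trans[OF card_of_nat inaccessibleD(1)[OF PB.inacc]] .
    moreover have "\<exists>k \<in> UNIV. i \<le> k \<and> j \<le> k" for i j :: nat by (rule bexI[of _ "max i j"]) auto
    ultimately show "directed_index TYPE('u) (UNIV :: nat set) (\<le>)" by unfold_locales (use PB.inacc in auto)
    show "|UNIV :: nat set| \<le>o \<kappa>" using nat by (rule ordLess_imp_ordLeq)
    show "U i \<preceq> U j" if "i \<le> j" for i j
      using that
    proof (induction j rule: dec_induct)
      case base show ?case by (rule B.factors_refl[OF member(3)[OF K(4)]])
    next
      case (step j) then show ?case using B.factors_trans[OF member(3)[OF K(4)] _ UU] by blast
    qed
    show "U i \<preceq> s ?K" for i using B.factors_trans[OF _ K(7) PB.s_subset[OF K(1) cl]] cl by auto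
    fix n assume "n \<in> Dom J ` ?K"
    then obtain i where "n \<in> Dom J ` K i" by blast
    then have "\<iota> n \<preceq> U i" using B.factors_trans[OF member(3)[OF K(4)] leg_factors[OF K(1)] K(6)] by blast
    then show "\<exists>i \<in> UNIV. \<iota> n \<preceq> U i" by blast
  qed (use K cl in auto)
  then have "nice ?K" using cl card by (simp add: nice_def in_filter_def)
  then show ?thesis using that K(2) by blast
qed

end

section \<open>Good subobjects\<close>

context filter_setting
begin

lemma \<kappa>_order:
  shows \<kappa>_wf: "wf (\<kappa> - Relation.Id)"
    and \<kappa>_refl: "a \<in> Field \<kappa> \<Longrightarrow> (a, a) \<in> \<kappa>"
    and \<kappa>_trans: "(a, b) \<in> \<kappa> \<Longrightarrow> (b, c) \<in> \<kappa> \<Longrightarrow> (a, c) \<in> \<kappa>"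
    and \<kappa>_antisym: "(a, b) \<in> \<kappa> \<Longrightarrow> (b, a) \<in> \<kappa> \<Longrightarrow> a = b"
    and \<kappa>_total: "a \<in> Field \<kappa> \<Longrightarrow> b \<in> Field \<kappa> \<Longrightarrow> (a, b) \<in> \<kappa> \<or> (b, a) \<in> \<kappa>"
proof -
  have "well_order_on (Field \<kappa>) \<kappa>" using \<kappa>D(5) by (simp add: card_order_on_def)
  then have w: "wf (\<kappa> - Relation.Id)" "Refl \<kappa>" "trans \<kappa>" "antisym \<kappa>" "Total \<kappa>"
    by (auto simp: well_order_on_def linear_order_on_def partial_order_on_def preorder_on_def)
  show "wf (\<kappa> - Relation.Id)" by (rule w)
  show refl: "a \<in> Field \<kappa> \<Longrightarrow> (a, a) \<in> \<kappa>" for a using w(2) by (auto simp: refl_on_def)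
  show "(a, b) \<in> \<kappa> \<Longrightarrow> (b, c) \<in> \<kappa> \<Longrightarrow> (a, c) \<in> \<kappa>" using w(3) by (rule transD)
  show "(a, b) \<in> \<kappa> \<Longrightarrow> (b, a) \<in> \<kappa> \<Longrightarrow> a = b" using w(4) by (rule antisymD)
  show "a \<in> Field \<kappa> \<Longrightarrow> b \<in> Field \<kappa> \<Longrightarrow> (a, b) \<in> \<kappa> \<or> (b, a) \<in> \<kappa>"
    using w(5) refl by (cases "a = b") (auto simp: total_on_def)
qed

lemma above:
  assumes "a \<in> Field \<kappa>" "b \<in> Field \<kappa>"
  obtains c where "c \<in> Field \<kappa>" "(a, c) \<in> \<kappa>" "a \<noteq> c" "(b, c) \<in> \<kappa>"
proof -
  have "\<exists>d. d \<in> Field \<kappa> \<and> (a, d) \<in> \<kappa> \<and> (b, d) \<in> \<kappa>"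
    using \<kappa>_total[OF assms] \<kappa>_refl assms by blast
  then obtain d where d: "d \<in> Field \<kappa>" "(a, d) \<in> \<kappa>" "(b, d) \<in> \<kappa>" by blast
  obtain c where c: "c \<in> Field \<kappa>" "d \<noteq> c" "(d, c) \<in> \<kappa>"
    using infinite_Card_order_limit[of \<kappa> d] \<kappa>D(5) d(1) by (auto simp: cinfinite_def)
  have "a \<noteq> c" using c(2,3) d(2) \<kappa>_antisym by blast
  then show ?thesis using that c(1) \<kappa>_trans[OF d(2) c(3)] \<kappa>_trans[OF d(3) c(3)] by blast
qed

text \<open>As \<open>K \<subseteq> g K\<close> for nice \<open>K\<close>, this single formula covers both successor and limit steps.\<close>

definition chain :: "'u set \<Rightarrow> ('u set \<Rightarrow> 'u set) \<Rightarrow> 'u \<Rightarrow> 'u set" where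
  "chain K0 g = wfrec (\<kappa> - Relation.Id) (\<lambda>f a. K0 \<union> (\<Union>b \<in> underS \<kappa> a. g (f b)))"

lemma chain_unfold: "chain K0 g a = K0 \<union> (\<Union>b \<in> underS \<kappa> a. g (chain K0 g b))"
proof -
  have "chain K0 g a = K0 \<union> (\<Union>b \<in> underS \<kappa> a. g (cut (chain K0 g) (\<kappa> - Relation.Id) a b))"
    unfolding chain_def by (subst wfrec[OF \<kappa>_wf]) simp
  also have "(\<Union>b \<in> underS \<kappa> a. g (cut (chain K0 g) (\<kappa> - Relation.Id) a b)) = (\<Union>b \<in> underS \<kappa> a. g (chain K0 g b))"
    by (rule SUP_cong) (auto simp: underS_def cut_apply)
  finally show ?thesis .
qed

context
  fixes K0 g
  assumes K0: "nice K0" and g: "\<And>K. nice K \<Longrightarrow> nice (g K)" "\<And>K. nice K \<Longrightarrow> K \<subseteq> g K"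
begin

abbreviation c where "c \<equiv> chain K0 g"

lemma chain_mono:
  assumes "(a, b) \<in> \<kappa>" shows "c a \<subseteq> c b"
proof -
  have "underS \<kappa> a \<subseteq> underS \<kappa> b"
    using assms \<kappa>_trans \<kappa>_antisym unfolding underS_def by blast
  then show ?thesis unfolding chain_unfold[of K0 g a] chain_unfold[of K0 g b] by blast
qed

lemma chain_step: "(b, a) \<in> \<kappa> \<Longrightarrow> b \<noteq> a \<Longrightarrow> g (c b) \<subseteq> c a"
  unfolding chain_unfold[of K0 g a] by (auto simp: underS_def)

lemma chain_base: "K0 \<subseteq> c a"
  unfolding chain_unfold[of K0 g a] by blast

lemma nice_chain: "nice (c a)"
proof (induction a rule: wf_induct_rule[OF \<kappa>_wf])
  case (1 a)
  let ?M = "insert K0 ((\<lambda>b. g (c b)) ` underS \<kappa> a)"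
  have IH: "nice (c b)" if "b \<in> underS \<kappa> a" for b using 1 that by (auto simp: underS_def)
  have "nice (\<Union>?M)"
  proof (rule nice_Union)
    show "nice M" if "M \<in> ?M" for M using that K0 g(1) IH by blast
    show "?M \<noteq> {}" by blast
    have "|underS \<kappa> a| <o \<kappa>"
    proof (cases "a \<in> Field \<kappa>")
      case True then show ?thesis using \<kappa>D(5) by (intro card_of_underS) auto
    next
      case False
      then have "underS \<kappa> a = {}" by (auto simp: underS_def Field_def)
      show ?thesis unfolding \<open>underS \<kappa> a = {}\<close> by (rule finite_ordLess_Cinfinite[OF finite.emptyI \<kappa>D(5)])
    qed
    then show "|?M| <o \<kappa>" by (intro insert_ordLess image_ordLess \<kappa>D(5))
    have base: "K0 \<subseteq> g (c b)" if "b \<in> underS \<kappa> a" for b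
      using chain_base g(2)[OF IH[OF that]] by blast
    have "g (c b) \<subseteq> g (c d) \<or> g (c d) \<subseteq> g (c b)" if b: "b \<in> underS \<kappa> a" "d \<in> underS \<kappa> a" for b d
    proof (cases "b = d")
      case False
      have "b \<in> Field \<kappa>" "d \<in> Field \<kappa>" using b by (auto simp: underS_def Field_def)
      then have "(b, d) \<in> \<kappa> \<or> (d, b) \<in> \<kappa>" by (rule \<kappa>_total)
      then show ?thesis using chain_step[of b d] chain_step[of d b] False g(2)[OF IH[OF b(1)]] g(2)[OF IH[OF b(2)]] by blast
    qed simp
    then show "M \<subseteq> N \<or> N \<subseteq> M" if "M \<in> ?M" "N \<in> ?M" for M N using that base by blast
  qed
  then show ?case unfolding chain_unfold[of K0 g a] by simp
qed

abbreviation top_set where "top_set \<equiv> \<Union>a \<in> Field \<kappa>. c a"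

text \<open>The union of the whole chain may have \<open>\<kappa>\<close> elements and fail to be
  nice, but filters admit systems of that size. A structure on this union is the common target from
  which lifts between members of the chain are obtained.\<close>

lemma in_filter_top: "in_filter top_set"
proof (rule in_filter_Union)
  show "c ` Field \<kappa> \<noteq> {}" using \<kappa>D(5) by (auto simp: cinfinite_def)
  show "M \<subseteq> N \<or> N \<subseteq> M" if "M \<in> c ` Field \<kappa>" "N \<in> c ` Field \<kappa>" for M N
    using that \<kappa>_total chain_mono by blast
  show "|c ` Field \<kappa>| \<le>o \<kappa>"
    using ordLeq_ordIso_trans[OF card_of_image card_of_Field_ordIso] \<kappa>D(5) by blast
qed (use nice_chain in auto)

lemma closed_top: "closed top_set"
  using in_filter_top by (simp add: in_filter_def)

text \<open>Regularity of \<open>\<kappa>\<close>: a set of fewer than \<open>\<kappa>\<close>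
  elements is absorbed before the end of a chain of length \<open>\<kappa>\<close>.\<close>

lemma small_subset_chain:
  assumes "M \<subseteq> top_set" "|M| <o \<kappa>" obtains a where "a \<in> Field \<kappa>" "M \<subseteq> c a"
proof -
  have "relChain \<kappa> c" unfolding relChain_def using chain_mono by blast
  then show ?thesis
    using regularCard_UNION[OF regular_cardinalD(2,3)[OF \<kappa>D(2)] _ assms] that by blast
qed

text \<open>Approximations of \<open>V\<close> and members of the chain overtake each other by
  \<open>interpolation\<close>; after countably many steps the colimit of the approximations is a
  structure on a limit member. It comes with a map to \<open>V\<close>, so the procedure can be
  restarted from it.\<close>

lemma back_and_forth:
  assumes V: "carries V \<sigma> top_set" and W: "presentable \<kappa> A W" "w \<in> hom A W V"
    and a: "a \<in> Field \<kappa>" "Comp B \<sigma> (AMap F w) \<preceq> s (c a)"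
  obtains W' w' t a' where "presentable \<kappa> A W'" "w' \<in> hom A W' V" "t \<in> hom A W W'" "Comp A w' t = w"
    "a' \<in> Field \<kappa>" "(a, a') \<in> \<kappa>" "a \<noteq> a'" "carries W' (Comp B \<sigma> (AMap F w')) (c a')"
proof -
  note v = carriesD[OF V]
  note cl = niceD(1)[OF nice_chain]
  \<comment> \<open>The clause for \<open>n = 0\<close> fixes the start, since the conclusion asks
    for a map out of the given \<open>W\<close>.\<close>
  define P where "P n x \<longleftrightarrow> (case x of (W', w', a') \<Rightarrow> presentable \<kappa> A W' \<and> w' \<in> hom A W' V \<and> a' \<in> Field \<kappa> \<and>
    Comp B \<sigma> (AMap F w') \<preceq> s (c a') \<and> (n = 0 \<longrightarrow> x = (W, w, a)))" for n :: nat and x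
  define Q where "Q x y \<longleftrightarrow> (case (x, y) of ((W, w, a), (W', w', a')) \<Rightarrow>
    (\<exists>t. t \<in> hom A W W' \<and> Comp A w' t = w \<and> (a, a') \<in> \<kappa> \<and> a \<noteq> a' \<and> s (c a) \<preceq> Comp B \<sigma> (AMap F w') \<and>
      (\<forall>Q x y. x \<in> hom B Q (OMap F W) \<longrightarrow> y \<in> hom B Q (OMap F W) \<longrightarrow>
        Comp B (Comp B \<sigma> (AMap F w)) x = Comp B (Comp B \<sigma> (AMap F w)) y \<longrightarrow>
        Comp B (AMap F t) x = Comp B (AMap F t) y)))" for x y
  have "\<exists>f. \<forall>n. P n (f n) \<and> Q (f n) (f (Suc n))"
  proof (rule dependent_nat_choice)
    show "\<exists>x. P 0 x" using W a by (intro exI[of _ "(W, w, a)"]) (simp add: P_def)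
  next
    fix x and n :: nat assume "P n x"
    then obtain W w a where x: "x = (W, w, a)" and W: "presentable \<kappa> A W" "w \<in> hom A W V" "a \<in> Field \<kappa>"
      "Comp B \<sigma> (AMap F w) \<preceq> s (c a)" by (auto simp: P_def)
    have "s (c a) \<preceq> s top_set" using a W(3) by (intro PB.s_subset cl closed_top) blast
    then have "s (c a) \<preceq> \<sigma>" by (rule B.factors_trans[OF v(7) _ v(6)])
    moreover have "presentable \<kappa> B (Dom B (s (c a)))"
      by (rule PB.s_presentable[OF cl niceD(2)[OF nice_chain] \<kappa>D(2)])
    ultimately obtain W' w' t where W': "presentable \<kappa> A W'" "w' \<in> hom A W' V" "t \<in> hom A W W'" "Comp A w' t = w"
      "s (c a) \<preceq> Comp B \<sigma> (AMap F w')"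
      "\<And>Q x y. x \<in> hom B Q (OMap F W) \<Longrightarrow> y \<in> hom B Q (OMap F W) \<Longrightarrow>
        Comp B (Comp B \<sigma> (AMap F w)) x = Comp B (Comp B \<sigma> (AMap F w)) y \<Longrightarrow>
        Comp B (AMap F t) x = Comp B (AMap F t) y"
      using interpolation[OF \<kappa> v(1-3) W(1,2) PB.s_mono[OF cl] _ W(4)] by metis
    let ?p = "Comp B \<sigma> (AMap F w')"
    have p: "?p \<in> hom B (OMap F W') X" using amap_hom[OF W'(2)] v(2) by (auto simp: hom_iff)
    have "?p \<preceq> \<sigma>" using amap_hom[OF W'(2)] v(2) by (intro B.comp_factors) (auto simp: hom_iff)
    then have "?p \<preceq> s top_set" using B.factors_trans[OF _ _ v(5)] closed_top by simp
    moreover have "presentable \<kappa> B (Dom B ?p)"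
      using presentable_image[OF \<kappa>D(2,4) W'(1)] p by (simp add: hom_iff)
    moreover have "?p \<in> Arr B" using p by (simp add: hom_iff)
    ultimately obtain M where M: "closed M" "M \<subseteq> top_set" "|M| <o \<kappa>" "?p \<preceq> s M"
      using PB.presentable_factors_sub[OF \<kappa>D(1) _ _ closed_top] by metis
    obtain b where b: "b \<in> Field \<kappa>" "M \<subseteq> c b" by (rule small_subset_chain[OF M(2,3)])
    obtain a' where a': "a' \<in> Field \<kappa>" "(a, a') \<in> \<kappa>" "a \<noteq> a'" "(b, a') \<in> \<kappa>" by (rule above[OF W(3) b(1)])
    have "s M \<preceq> s (c a')" using b(2) chain_mono[OF a'(4)] by (intro PB.s_subset M(1) cl) blast
    then have "?p \<preceq> s (c a')" using B.factors_trans[OF _ M(4)] cl by simp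
    then have "P (Suc n) (W', w', a')" using W'(1,2) a'(1) by (simp add: P_def)
    moreover have "Q x (W', w', a')" unfolding Q_def x using W'(3-6) a'(2,3) by auto
    ultimately show "\<exists>y. P (Suc n) y \<and> Q x y" by blast
  qed
  then obtain f where f: "\<And>n. P n (f n)" "\<And>n. Q (f n) (f (Suc n))" by blast
  define Ws ws as where "Ws n = fst (f n)" and "ws n = fst (snd (f n))" and "as n = snd (snd (f n))" for n
  have f_eq: "f n = (Ws n, ws n, as n)" for n by (simp add: Ws_def ws_def as_def)
  have P: "presentable \<kappa> A (Ws n)" "ws n \<in> hom A (Ws n) V" "as n \<in> Field \<kappa>"
    "Comp B \<sigma> (AMap F (ws n)) \<preceq> s (c (as n))" for n using f(1)[of n] unfolding P_def f_eq by auto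
  have start: "Ws 0 = W" "ws 0 = w" "as 0 = a" using f(1)[of 0] unfolding P_def f_eq by auto
  have "\<exists>t. \<forall>n. t n \<in> hom A (Ws n) (Ws (Suc n)) \<and> Comp A (ws (Suc n)) (t n) = ws n \<and>
    (as n, as (Suc n)) \<in> \<kappa> \<and> as n \<noteq> as (Suc n) \<and> s (c (as n)) \<preceq> Comp B \<sigma> (AMap F (ws (Suc n))) \<and>
      (\<forall>Q x y. x \<in> hom B Q (OMap F (Ws n)) \<longrightarrow> y \<in> hom B Q (OMap F (Ws n)) \<longrightarrow>
        Comp B (Comp B \<sigma> (AMap F (ws n))) x = Comp B (Comp B \<sigma> (AMap F (ws n))) y \<longrightarrow>
        Comp B (AMap F (t n)) x = Comp B (AMap F (t n)) y)"
    using f(2) unfolding Q_def f_eq by (intro choice allI) simp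
  then obtain t where t: "\<And>n. t n \<in> hom A (Ws n) (Ws (Suc n))" "\<And>n. Comp A (ws (Suc n)) (t n) = ws n"
    and as: "\<And>n. (as n, as (Suc n)) \<in> \<kappa>" "\<And>n. as n \<noteq> as (Suc n)" "\<And>n. s (c (as n)) \<preceq> Comp B \<sigma> (AMap F (ws (Suc n)))"
    and weak: "\<And>n Q x y. x \<in> hom B Q (OMap F (Ws n)) \<Longrightarrow> y \<in> hom B Q (OMap F (Ws n)) \<Longrightarrow>
        Comp B (Comp B \<sigma> (AMap F (ws n))) x = Comp B (Comp B \<sigma> (AMap F (ws n))) y \<Longrightarrow>
        Comp B (AMap F (t n)) x = Comp B (AMap F (t n)) y" by blast
  have nat: "|UNIV :: nat set| <o \<kappa>" by (rule ordIso_ordLess_trans[OF card_of_nat \<kappa>D(3)])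
  have "\<exists>b \<in> Field \<kappa>. range as \<subseteq> {x. (x, b) \<in> \<kappa>}"
  proof (rule regularCard_UNION[OF regular_cardinalD(2,3)[OF \<kappa>D(2)]])
    show "relChain \<kappa> (\<lambda>b. {x. (x, b) \<in> \<kappa>})" unfolding relChain_def using \<kappa>_trans by blast
    show "range as \<subseteq> (\<Union>i \<in> Field \<kappa>. {x. (x, i) \<in> \<kappa>})" using P(3) \<kappa>_refl by blast
    show "|range as| <o \<kappa>" by (rule image_ordLess[OF nat])
  qed
  \<comment> \<open>The indices are bounded because \<open>\<kappa>\<close> is regular and
    uncountable. At their least bound \<open>d\<close> the chain equals the union of the members
    already visited.\<close>
  then obtain b0 where "b0 \<in> {b \<in> Field \<kappa>. \<forall>n. (as n, b) \<in> \<kappa>}" by blast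
  then have "\<exists>d \<in> {b \<in> Field \<kappa>. \<forall>n. (as n, b) \<in> \<kappa>}. \<forall>y. (y, d) \<in> \<kappa> - Relation.Id \<longrightarrow>
      y \<notin> {b \<in> Field \<kappa>. \<forall>n. (as n, b) \<in> \<kappa>}"
    by (rule wfE_min[OF \<kappa>_wf]) blast
  then obtain d where d: "d \<in> {b \<in> Field \<kappa>. \<forall>n. (as n, b) \<in> \<kappa>}"
    "\<forall>y. (y, d) \<in> \<kappa> - Relation.Id \<longrightarrow> y \<notin> {b \<in> Field \<kappa>. \<forall>n. (as n, b) \<in> \<kappa>}" by blast
  have cd: "c d = (\<Union>n. c (as n))"
  proof
    show "(\<Union>n. c (as n)) \<subseteq> c d" using chain_mono d(1) by blast
    have "g (c b) \<subseteq> (\<Union>n. c (as n))" if b: "b \<in> underS \<kappa> d" for b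
    proof -
      have bF: "b \<in> Field \<kappa>" using b by (auto simp: underS_def Field_def)
      have "b \<notin> {b \<in> Field \<kappa>. \<forall>n. (as n, b) \<in> \<kappa>}" using d(2) b by (auto simp: underS_def)
      then obtain n where "(as n, b) \<notin> \<kappa>" using bF by blast
      then have "(b, as n) \<in> \<kappa>" "b \<noteq> as n" using \<kappa>_total[OF bF P(3)] \<kappa>_refl[OF bF] by auto
      then show ?thesis using chain_step by blast
    qed
    then show "c d \<subseteq> (\<Union>n. c (as n))" unfolding chain_unfold[of K0 g d] using chain_base by blast
  qed
  define \<omega> where "\<omega> n = Comp B \<sigma> (AMap F (ws n))" for n
  have wsF: "AMap F (ws n) \<in> hom B (OMap F (Ws n)) (OMap F V)" for n using P(2) by (rule amap_hom)
  have \<omega>h: "\<omega> n \<in> hom B (OMap F (Ws n)) X" for n using wsF[of n] v(2) by (auto simp: \<omega>_def hom_iff)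
  have \<omega>s: "\<omega> n \<preceq> s (c d)" for n
    using B.factors_trans[OF _ P(4)[of n] PB.s_subset[OF cl cl]] chain_mono d(1) cl by (simp add: \<omega>_def)
  have "\<exists>Q cc \<tau>. sequence_colimit Ws t \<omega> (c d) Q cc \<tau>"
  proof (rule sequence_carries[of Ws t \<omega> "c d"])
    show "Ws n \<in> Obj A" for n using P(2) A.hom_obj by blast
    show "t n \<in> hom A (Ws n) (Ws (Suc n))" "\<omega> n \<in> hom B (OMap F (Ws n)) X" "\<omega> n \<preceq> s (c d)" for n by (rule t \<omega>h \<omega>s)+
    show "Comp B (\<omega> (Suc n)) (AMap F (t n)) = \<omega> n" for n
      using amap_comp[OF t(1)[of n] P(2)[of "Suc n"]] t(2)[of n] wsF[of "Suc n"] amap_hom[OF t(1)[of n]] v(2)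
      by (simp add: \<omega>_def hom_iff)
    show "closed (c d)" by (rule cl)
    show "\<exists>i. \<iota> n \<preceq> \<omega> i" if n: "n \<in> Dom J ` c d" for n
    proof -
      obtain i where "n \<in> Dom J ` c (as i)" using n unfolding cd by blast
      then have "\<iota> n \<preceq> \<omega> (Suc i)"
        using B.factors_trans[OF _ leg_factors[OF cl] as(3)[of i]] \<omega>h[of "Suc i"] by (simp add: \<omega>_def hom_iff)
      then show ?thesis by blast
    qed
    show "Comp B (AMap F (t n)) x = Comp B (AMap F (t n)) y" if "x \<in> hom B Q (OMap F (Ws n))"
      "y \<in> hom B Q (OMap F (Ws n))" "Comp B (\<omega> n) x = Comp B (\<omega> n) y" for n Q x y
      using that weak unfolding \<omega>_def by blast
  qed
  then obtain Q cc \<tau> where "sequence_colimit Ws t \<omega> (c d) Q cc \<tau>" by blast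
  note Q = sequence_colimitD[OF this]
  obtain h where h: "h \<in> hom A Q V" "\<And>n. Comp A h (cc n) = ws n"
    using Q(5)[OF v(1) P(2) t(2)] by blast
  have \<tau>: "\<tau> = Comp B \<sigma> (AMap F h)"
  proof (rule Q(6)[OF carriesD(2)[OF Q(1)]])
    show "Comp B \<sigma> (AMap F h) \<in> hom B (OMap F Q) X" using amap_hom[OF h(1)] v(2) by (auto simp: hom_iff)
    fix n
    show "Comp B \<tau> (AMap F (cc n)) = Comp B (Comp B \<sigma> (AMap F h)) (AMap F (cc n))"
      using Q(3)[of n] h(2)[of n] amap_comp[OF Q(2)[of n] h(1)] amap_hom[OF h(1)] amap_hom[OF Q(2)[of n]] v(2)
      by (simp add: \<omega>_def hom_iff)
  qed
  show ?thesis
  proof (rule that[of Q h "cc 0" d])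
    show "presentable \<kappa> A Q" by (rule Q(7)[OF \<kappa>D(2,3) P(1)])
    show "cc 0 \<in> hom A W Q" "Comp A h (cc 0) = w" using Q(2)[of 0] h(2)[of 0] start by auto
    show "d \<in> Field \<kappa>" "(a, d) \<in> \<kappa>" using d(1) start by auto
    have "(as 1, d) \<in> \<kappa>" using d(1) by blast
    then show "a \<noteq> d" using as(1,2)[of 0] \<kappa>_antisym[of "as 0" "as 1"] start by auto
    show "carries Q (Comp B \<sigma> (AMap F h)) (c d)" using Q(1) unfolding \<tau> .
  qed (rule h(1))
qed

text \<open>Each application of \<open>back_and_forth\<close> starts from the structure found by the
  previous one; the maps between consecutive structures, all lying over \<open>V\<close>, are the
  lifts.\<close>

lemma infinitely_many_lifts:
  "\<exists>k. \<forall>n :: nat. (k n, k (Suc n)) \<in> \<kappa> \<and> k n \<noteq> k (Suc n) \<and> lifts (c (k n)) (c (k (Suc n)))"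
proof -
  obtain V \<sigma> where V: "carries V \<sigma> top_set" by (rule in_filter_carries[OF in_filter_top])
  note v = carriesD[OF V]
  note cl = niceD(1)[OF nice_chain]
  define P where "P x \<longleftrightarrow> (case x of (W, w, a) \<Rightarrow> presentable \<kappa> A W \<and> w \<in> hom A W V \<and> a \<in> Field \<kappa> \<and>
    carries W (Comp B \<sigma> (AMap F w)) (c a))" for x
  define Q where "Q x y \<longleftrightarrow> (case (x, y) of ((W, w, a), (W', w', a')) \<Rightarrow>
    (\<exists>t. t \<in> hom A W W' \<and> Comp A w' t = w) \<and> (a, a') \<in> \<kappa> \<and> a \<noteq> a')" for x y
  have step: "\<exists>W' w' t a'. P (W', w', a') \<and> t \<in> hom A W W' \<and> Comp A w' t = w \<and> (a, a') \<in> \<kappa> \<and> a \<noteq> a'"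
    if "presentable \<kappa> A W" "w \<in> hom A W V" "a \<in> Field \<kappa>" "Comp B \<sigma> (AMap F w) \<preceq> s (c a)" for W w a
    using back_and_forth[OF V that] unfolding P_def by (metis (no_types, lifting) case_prodI)
  have "\<exists>f. \<forall>n :: nat. P (f n) \<and> Q (f n) (f (Suc n))"
  proof (rule dependent_nat_choice)
    obtain W w where W: "presentable \<kappa> A W" "w \<in> hom A W V" by (rule ex_presentable_over[OF \<kappa> v(1)])
    let ?p = "Comp B \<sigma> (AMap F w)"
    have p: "?p \<in> hom B (OMap F W) X" using amap_hom[OF W(2)] v(2) by (auto simp: hom_iff)
    have "?p \<preceq> \<sigma>" using amap_hom[OF W(2)] v(2) by (intro B.comp_factors) (auto simp: hom_iff)
    then have "?p \<preceq> s top_set" using B.factors_trans[OF _ _ v(5)] closed_top by simp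
    moreover have "presentable \<kappa> B (Dom B ?p)" using presentable_image[OF \<kappa>D(2,4) W(1)] p by (simp add: hom_iff)
    moreover have "?p \<in> Arr B" using p by (simp add: hom_iff)
    ultimately obtain M where M: "closed M" "M \<subseteq> top_set" "|M| <o \<kappa>" "?p \<preceq> s M"
      using PB.presentable_factors_sub[OF \<kappa>D(1) _ _ closed_top] by metis
    obtain b where b: "b \<in> Field \<kappa>" "M \<subseteq> c b" by (rule small_subset_chain[OF M(2,3)])
    have "?p \<preceq> s (c b)" using B.factors_trans[OF _ M(4) PB.s_subset[OF M(1) cl b(2)]] cl by simp
    then show "\<exists>x. P x" using step[OF W b(1)] by blast
  next
    fix x and n :: nat assume "P x"
    then obtain W w a where x: "x = (W, w, a)" "presentable \<kappa> A W" "w \<in> hom A W V" "a \<in> Field \<kappa>"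
      "Comp B \<sigma> (AMap F w) \<preceq> s (c a)" using carriesD(5) by (auto simp: P_def)
    then obtain W' w' t a' where "P (W', w', a')" "t \<in> hom A W W'" "Comp A w' t = w" "(a, a') \<in> \<kappa>" "a \<noteq> a'"
      using step by metis
    then show "\<exists>y. P y \<and> Q x y" unfolding Q_def x(1) by (intro exI[of _ "(W', w', a')"]) auto
  qed
  then obtain f where f: "\<And>n. P (f n)" "\<And>n. Q (f n) (f (Suc n))" by blast
  show ?thesis
  proof (rule exI[of _ "\<lambda>n. snd (snd (f n))"], intro allI conjI)
    fix n
    obtain W w a where x: "f n = (W, w, a)" by (cases "f n")
    obtain W' w' a' where y: "f (Suc n) = (W', w', a')" by (cases "f (Suc n)")
    have n: "presentable \<kappa> A W" "w \<in> hom A W V" "a \<in> Field \<kappa>" "carries W (Comp B \<sigma> (AMap F w)) (c a)"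
      using f(1)[of n] unfolding P_def x by auto
    have n': "w' \<in> hom A W' V" "carries W' (Comp B \<sigma> (AMap F w')) (c a')"
      using f(1)[of "Suc n"] unfolding P_def y by auto
    obtain t where t: "t \<in> hom A W W'" "Comp A w' t = w" "(a, a') \<in> \<kappa>" "a \<noteq> a'"
      using f(2)[of n] unfolding Q_def x y by auto
    show "(snd (snd (f n)), snd (snd (f (Suc n)))) \<in> \<kappa>"
      "snd (snd (f n)) \<noteq> snd (snd (f (Suc n)))" using n t x y by auto
    have "Comp B (Comp B \<sigma> (AMap F w')) (AMap F t) = Comp B \<sigma> (AMap F w)"
      using amap_comp[OF t(1) n'(1)] t(2) amap_hom[OF t(1)] amap_hom[OF n'(1)] v(2) by (simp add: hom_iff)
    then show "lifts (c (snd (snd (f n)))) (c (snd (snd (f (Suc n)))))"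
      unfolding lifts_def x y snd_conv using n(4) n'(2) t(1) by blast
  qed
qed

end

text \<open>If no nice position of \<open>G\<close> contained \<open>Z\<close>, one takes a chain
  each of whose steps answers the challenge \<open>z\<close> at the current member. Every later
  member then contains that answer, so the subsequence from \<open>infinitely_many_lifts\<close> is
  a play against \<open>z\<close> however far it jumps, and it must meet \<open>G\<close>.\<close>

lemma good_family_filter:
  obtains \<G> where "\<And>K. K \<in> \<G> \<Longrightarrow> nice K"
    "\<And>Z. Z \<subseteq> Arr J \<Longrightarrow> |Z| <o \<kappa> \<Longrightarrow> \<exists>K \<in> \<G>. Z \<subseteq> K"
    "\<And>K Z. K \<in> \<G> \<Longrightarrow> Z \<subseteq> Arr J \<Longrightarrow> |Z| <o \<kappa> \<Longrightarrow> \<exists>N \<in> \<G>. Z \<subseteq> N \<and> K \<subseteq> N \<and> lifts K N"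
proof -
  define R where "R K Z N \<longleftrightarrow> nice N \<and> (Z \<subseteq> Arr J \<and> |Z| <o \<kappa> \<longrightarrow> Z \<subseteq> N) \<and> K \<subseteq> N \<and> lifts K N" for K Z N
  obtain z G where G: "\<forall>K \<in> G. \<forall>Z. \<exists>N \<in> G. R K Z N"
    and play: "\<forall>k :: nat \<Rightarrow> 'u set. (\<forall>n. R (k n) (z (k n)) (k (Suc n))) \<longrightarrow> (\<exists>n. k n \<in> G)"
    by (insert open_game_determinacy[of R], elim exE conjE, rule that)
  have dense: "\<exists>K \<in> G. nice K \<and> Z \<subseteq> K" if Z: "Z \<subseteq> Arr J" "|Z| <o \<kappa>" for Z
  proof (rule ccontr)
    assume no: "\<not> ?thesis"
    obtain K0 where K0: "nice K0" "Z \<subseteq> K0" by (rule ex_nice[OF Z])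
    \<comment> \<open>\<open>z\<close> may name a set that is too large or not made of arrows;
      \<open>R\<close> then demands nothing, and the empty set serves as its substitute.\<close>
    define zz where "zz K = (if z K \<subseteq> Arr J \<and> |z K| <o \<kappa> then z K else {})" for K
    have "\<exists>N. nice N \<and> K \<union> zz K \<subseteq> N" if K: "nice K" for K
    proof -
      have "K \<union> zz K \<subseteq> Arr J" using PB.closedD(1)[OF niceD(1)[OF K]] by (auto simp: zz_def)
      moreover have "|{} :: 'u set| <o \<kappa>" by (rule finite_ordLess_Cinfinite[OF finite.emptyI \<kappa>D(5)])
      then have "|zz K| <o \<kappa>" by (simp add: zz_def)
      then have "|K \<union> zz K| <o \<kappa>" by (rule Un_Cinfinite_bound_strict[OF niceD(2)[OF K] _ \<kappa>D(5)])
      ultimately show ?thesis using ex_nice by metis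
    qed
    then obtain g where g: "\<And>K. nice K \<Longrightarrow> nice (g K)" "\<And>K. nice K \<Longrightarrow> K \<union> zz K \<subseteq> g K" by metis
    have g': "\<And>K. nice K \<Longrightarrow> K \<subseteq> g K" using g(2) by blast
    note ch = K0(1) g(1) g'
    obtain k where "\<forall>n :: nat. (k n, k (Suc n)) \<in> \<kappa> \<and> k n \<noteq> k (Suc n) \<and>
        lifts (chain K0 g (k n)) (chain K0 g (k (Suc n)))"
      using infinitely_many_lifts[OF ch] by blast
    then have k: "(k n, k (Suc n)) \<in> \<kappa>" "k n \<noteq> k (Suc n)" "lifts (chain K0 g (k n)) (chain K0 g (k (Suc n)))" for n
      by blast+
    have "R (chain K0 g (k n)) (z (chain K0 g (k n))) (chain K0 g (k (Suc n)))" for n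
    proof -
      have n: "nice (chain K0 g (k n))" "nice (chain K0 g (k (Suc n)))"
        by (rule nice_chain[OF ch], assumption+, rule nice_chain[OF ch])
      have "g (chain K0 g (k n)) \<subseteq> chain K0 g (k (Suc n))" by (rule chain_step[OF ch k(1,2)])
      then have "chain K0 g (k n) \<union> zz (chain K0 g (k n)) \<subseteq> chain K0 g (k (Suc n))" using g(2)[OF n(1)] by blast
      then show ?thesis using n(2) k(3) by (auto simp: R_def zz_def)
    qed
    then obtain n where "chain K0 g (k n) \<in> G" using play[THEN spec, of "\<lambda>n. chain K0 g (k n)"] by blast
    moreover have "nice (chain K0 g (k n))" by (rule nice_chain[OF ch])
    moreover have "Z \<subseteq> chain K0 g (k n)" using K0(2) chain_base[OF ch, of "k n"] by blast
    ultimately show False using no by blast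
  qed
  show ?thesis
  proof (rule that[of "{K \<in> G. nice K}"])
    fix K Z assume "K \<in> {K \<in> G. nice K}" and Z: "Z \<subseteq> Arr J" "|Z| <o \<kappa>"
    then obtain N where "N \<in> G" "R K Z N" using G by blast
    then show "\<exists>N \<in> {K \<in> G. nice K}. Z \<subseteq> N \<and> K \<subseteq> N \<and> lifts K N" using Z by (auto simp: R_def)
  qed (use dense in blast)+
qed

end

text \<open>The outcome of the game with the filter eliminated: cofinal positions in which every
  small challenge has an answer that lifts and stays within the family.\<close>

lemma (in compactness_setting) good_family:
  assumes "adequate \<kappa>" "image_contains_dense_filter \<kappa> A B F X"
  shows "\<exists>\<G>. (\<forall>K \<in> \<G>. closed K \<and> |K| <o \<kappa> \<and> (\<exists>V \<sigma>. carries V \<sigma> K)) \<and>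
      (\<forall>Z. Z \<subseteq> Arr J \<longrightarrow> |Z| <o \<kappa> \<longrightarrow> (\<exists>K \<in> \<G>. Z \<subseteq> K)) \<and>
      (\<forall>K \<in> \<G>. \<forall>Z. Z \<subseteq> Arr J \<longrightarrow> |Z| <o \<kappa> \<longrightarrow> (\<exists>N \<in> \<G>. Z \<subseteq> N \<and> K \<subseteq> N \<and> lifts K N))"
proof -
  obtain \<F> where \<F>: "is_filter \<kappa> B X \<F>" "is_dense \<kappa> B X \<F>" "\<forall>U \<in> \<F>. in_image A B F (Dom B U)"
    using assms(2) unfolding image_contains_dense_filter_def by blast
  interpret filter_setting A B F J D X \<iota> extra \<mu> \<kappa> \<F>
    by unfold_locales (use assms(1) \<F> in auto)
  obtain \<G> where G: "\<And>K. K \<in> \<G> \<Longrightarrow> nice K"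
    "\<And>Z. Z \<subseteq> Arr J \<Longrightarrow> |Z| <o \<kappa> \<Longrightarrow> \<exists>K \<in> \<G>. Z \<subseteq> K"
    "\<And>K Z. K \<in> \<G> \<Longrightarrow> Z \<subseteq> Arr J \<Longrightarrow> |Z| <o \<kappa> \<Longrightarrow> \<exists>N \<in> \<G>. Z \<subseteq> N \<and> K \<subseteq> N \<and> lifts K N"
    by (rule good_family_filter, rule that)
  show ?thesis
  proof (rule exI[of _ \<G>], intro conjI ballI allI impI)
    fix K assume K: "K \<in> \<G>"
    show "closed K" "|K| <o \<kappa>" using niceD(1,2)[OF G(1)[OF K]] .
    show "\<exists>V \<sigma>. carries V \<sigma> K" using in_filter_carries[OF niceD(3)[OF G(1)[OF K]]] by metis
  qed (rule G(2,3); assumption)+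
qed

section \<open>Interleaving countably many stages\<close>

context compactness_setting
begin

lemma closed_Un_sequence:
  assumes "\<And>n :: nat. closed (K n)" "\<And>n. K n \<subseteq> K (Suc n)" shows "closed (\<Union>n. K n)"
proof (rule PB.closed_Union)
  fix M N assume "M \<in> range K" "N \<in> range K"
  then obtain m n where "M = K m" "N = K n" by blast
  moreover have "K i \<subseteq> K j" if "i \<le> j" for i j by (rule lift_Suc_mono_le[where f = K, OF assms(2) that])
  ultimately show "\<exists>L \<in> range K. M \<union> N \<subseteq> L" by (intro bexI[of _ "K (max m n)"]) auto
qed (use assms(1) in auto)

lemma sequence_of_carriers:
  assumes V: "\<And>n. carries (V n) (\<sigma> n) (K n)" and f: "\<And>n. f n \<in> hom A (V n) (V (Suc n))"
    and \<sigma>: "\<And>n. Comp B (\<sigma> (Suc n)) (AMap F (f n)) = \<sigma> n" and K: "\<And>n. K n \<subseteq> K (Suc n)"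
  shows "\<exists>Q c \<tau>. sequence_colimit V f \<sigma> (\<Union>n. K n) Q c \<tau>"
proof (rule sequence_carries)
  note v = carriesD[OF V]
  show cl: "closed (\<Union>n. K n)" by (rule closed_Un_sequence[where K = K, OF v(4) K])
  show "V n \<in> Obj A" "f n \<in> hom A (V n) (V (Suc n))" "\<sigma> n \<in> hom B (OMap F (V n)) X"
    "Comp B (\<sigma> (Suc n)) (AMap F (f n)) = \<sigma> n" for n by (rule v f \<sigma>)+
  show "\<sigma> n \<preceq> s (\<Union>n. K n)" for n
    using B.factors_trans[OF _ v(5)[of n] PB.s_subset[OF v(4) cl]] cl by auto
  show "Comp B (AMap F (f n)) x = Comp B (AMap F (f n)) y"
    if "x \<in> hom B Q (OMap F (V n))" "y \<in> hom B Q (OMap F (V n))" "Comp B (\<sigma> n) x = Comp B (\<sigma> n) y" for n Q x y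
  proof -
    have "x = y" by (rule B.mono_cancel[OF v(3)[of n] that(3)]) (use that(1,2) v(8)[of n] in simp_all)
    then show ?thesis by simp
  qed
  fix n assume "n \<in> Dom J ` (\<Union>n. K n)"
  then obtain i where "n \<in> Dom J ` K i" by blast
  then have "\<iota> n \<preceq> \<sigma> i" using B.factors_trans[OF v(7) leg_factors[OF v(4)] v(6)] by blast
  then show "\<exists>i. \<iota> n \<preceq> \<sigma> i" by blast
qed

text \<open>A structure on the union of the \<open>R n\<close> is cut out of the one on the union of
  the \<open>K n\<close>. The approximations \<open>W n\<close> interleave with the
  \<open>R n\<close>, so their colimit carries the union, and the maps \<open>w n\<close> induce its
  map to the larger structure. Any other structure known on the smaller union is not
  involved.\<close>

lemma lifts_limit:
  assumes V: "\<And>n. carries (V n) (\<sigma> n) (K n)" and f: "\<And>n. f n \<in> hom A (V n) (V (Suc n))"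
    and \<sigma>: "\<And>n. Comp B (\<sigma> (Suc n)) (AMap F (f n)) = \<sigma> n" and K: "\<And>n. K n \<subseteq> K (Suc n)"
    and w: "\<And>n. w n \<in> hom A (W n) (V n)" and t: "\<And>n. t n \<in> hom A (W n) (W (Suc n))"
    and wt: "\<And>n. Comp A (w (Suc n)) (t n) = Comp A (f n) (w n)"
    and R: "\<And>n. closed (R n)" "\<And>n. R n \<subseteq> R (Suc n)" "\<And>n. Comp B (\<sigma> n) (AMap F (w n)) \<preceq> s (R n)"
      "\<And>n. s (R n) \<preceq> Comp B (\<sigma> (Suc n)) (AMap F (w (Suc n)))"
    and weak: "\<And>n Q x y. x \<in> hom B Q (OMap F (W n)) \<Longrightarrow> y \<in> hom B Q (OMap F (W n)) \<Longrightarrow>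
      Comp B (Comp B (\<sigma> n) (AMap F (w n))) x = Comp B (Comp B (\<sigma> n) (AMap F (w n))) y \<Longrightarrow>
      Comp B (AMap F (t n)) x = Comp B (AMap F (t n)) y"
  shows "lifts (\<Union>n. R n) (\<Union>n. K n)"
proof -
  note v = carriesD[OF V]
  obtain Q c \<tau> where "sequence_colimit V f \<sigma> (\<Union>n. K n) Q c \<tau>"
    using sequence_of_carriers[where V = V and \<sigma> = \<sigma> and K = K and f = f, OF V f \<sigma> K] by blast
  note Q = sequence_colimitD[OF this]
  define \<omega> where "\<omega> n = Comp B (\<sigma> n) (AMap F (w n))" for n
  note wF = amap_hom[OF w] and tF = amap_hom[OF t] and fF = amap_hom[OF f]
  have \<omega>h: "\<omega> n \<in> hom B (OMap F (W n)) X" for n using wF[of n] v(2)[of n] by (auto simp: \<omega>_def hom_iff)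
  have cl: "closed (\<Union>n. R n)" by (rule closed_Un_sequence[where K = R, OF R(1,2)])
  have "\<exists>P d \<upsilon>. sequence_colimit W t \<omega> (\<Union>n. R n) P d \<upsilon>"
  proof (rule sequence_carries[where W = W and t = t and \<omega> = \<omega>, OF _ t \<omega>h _ _ cl])
    show "W n \<in> Obj A" for n using w A.hom_obj by blast
    show "Comp B (\<omega> (Suc n)) (AMap F (t n)) = \<omega> n" for n
    proof -
      have "Comp B (\<omega> (Suc n)) (AMap F (t n)) = Comp B (\<sigma> (Suc n)) (AMap F (Comp A (w (Suc n)) (t n)))"
        using amap_comp[OF t w] wF[of "Suc n"] tF[of n] v(2)[of "Suc n"] by (simp add: \<omega>_def hom_iff)
      also have "\<dots> = Comp B (Comp B (\<sigma> (Suc n)) (AMap F (f n))) (AMap F (w n))"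
        unfolding wt using amap_comp[OF w f] wF[of n] fF[of n] v(2)[of "Suc n"] by (simp add: hom_iff)
      finally show ?thesis unfolding \<sigma> \<omega>_def .
    qed
    show "\<omega> n \<preceq> s (\<Union>n. R n)" for n
      using B.factors_trans[OF _ R(3)[of n] PB.s_subset[OF R(1) cl]] cl by (auto simp: \<omega>_def)
    show "Comp B (AMap F (t n)) x = Comp B (AMap F (t n)) y"
      if "x \<in> hom B Q (OMap F (W n))" "y \<in> hom B Q (OMap F (W n))" "Comp B (\<omega> n) x = Comp B (\<omega> n) y" for n Q x y
      using weak that unfolding \<omega>_def by blast
    fix n assume "n \<in> Dom J ` (\<Union>n. R n)"
    then obtain i where "n \<in> Dom J ` R i" by blast
    then have "\<iota> n \<preceq> \<omega> (Suc i)"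
      using B.factors_trans[OF _ leg_factors[OF R(1)] R(4)[of i]] \<omega>h[of "Suc i"] by (simp add: \<omega>_def hom_iff)
    then show "\<exists>i. \<iota> n \<preceq> \<omega> i" by blast
  qed
  then obtain P d \<upsilon> where "sequence_colimit W t \<omega> (\<Union>n. R n) P d \<upsilon>" by blast
  note P = sequence_colimitD[OF this]
  have ch: "Comp A (c n) (w n) \<in> hom A (W n) Q" for n using Q(2)[of n] w[of n] by (auto simp: hom_iff)
  have "Comp A (Comp A (c (Suc n)) (w (Suc n))) (t n) = Comp A (c n) (w n)" for n
    using A.rewrite_left[OF Q(4)[of n], of "w n"] Q(2)[of "Suc n"] Q(2)[of n] w[of n] w[of "Suc n"] t[of n] f[of n] wt[of n]
    by (simp add: hom_iff)
  then obtain h where h: "h \<in> hom A P Q" "\<And>n. Comp A h (d n) = Comp A (c n) (w n)"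
    using P(5)[OF carriesD(1)[OF Q(1)] ch] by blast
  have hF: "AMap F h \<in> hom B (OMap F P) (OMap F Q)" using h(1) by (rule amap_hom)
  have "Comp B \<tau> (AMap F h) = \<upsilon>"
  proof (rule P(6)[OF _ carriesD(2)[OF P(1)]])
    show "Comp B \<tau> (AMap F h) \<in> hom B (OMap F P) X" using hF carriesD(2)[OF Q(1)] by (auto simp: hom_iff)
    fix n
    have "Comp B (Comp B \<tau> (AMap F h)) (AMap F (d n)) = Comp B \<tau> (AMap F (Comp A h (d n)))"
      using amap_comp[OF P(2) h(1)] hF amap_hom[OF P(2)[of n]] carriesD(2)[OF Q(1)] by (simp add: hom_iff)
    also have "\<dots> = Comp B (Comp B \<tau> (AMap F (c n))) (AMap F (w n))"
      unfolding h(2) using amap_comp[OF w Q(2)] wF[of n] amap_hom[OF Q(2)[of n]] carriesD(2)[OF Q(1)] by (simp add: hom_iff)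
    finally show "Comp B (Comp B \<tau> (AMap F h)) (AMap F (d n)) = Comp B \<upsilon> (AMap F (d n))"
      unfolding Q(3) P(3) \<omega>_def .
  qed
  then show ?thesis unfolding lifts_def using P(1) Q(1) h(1) by blast
qed

text \<open>All games advance together, one move per index in each round. The hypothesis on
  \<open>kf i\<close> makes it the successor of the cardinality of \<open>E i\<close>, so that
  nonempty sets below \<open>kf i\<close> are those that \<open>E i\<close> can enumerate; having
  fewer than \<open>kf i\<close> indices keeps the joint demands of a round admissible. The last
  conclusion transfers continuity from \<open>E\<close> to \<open>N\<close>.\<close>

lemma singular_stages:
  fixes I :: "'u set" and r :: "'u rel" and kf :: "'u \<Rightarrow> 'u rel" and E :: "'u \<Rightarrow> 'u set"
  assumes nx: "\<And>i. i \<in> I \<Longrightarrow> nx i \<in> I" "\<And>i. i \<in> I \<Longrightarrow> (i, nx i) \<in> r"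
    and r: "\<And>i. i \<in> I \<Longrightarrow> (i, i) \<in> r"
    and kf: "\<And>i. i \<in> I \<Longrightarrow> adequate (kf i)"
      "\<And>i Y. i \<in> I \<Longrightarrow> |Y :: 'u set| <o kf i \<longleftrightarrow> |Y| \<le>o |E i|"
      "\<And>i. i \<in> I \<Longrightarrow> |I| <o kf i"
    and E: "\<And>i j. i \<in> I \<Longrightarrow> j \<in> I \<Longrightarrow> (i, j) \<in> r \<Longrightarrow> E i \<subseteq> E j"
    and filters: "\<And>i. i \<in> I \<Longrightarrow> image_contains_dense_filter (kf i) A B F X"
    and e: "\<And>i. i \<in> I \<Longrightarrow> e ` E i \<subseteq> Arr J"
  shows "\<exists>N. \<forall>i \<in> I. closed (N i) \<and> (\<exists>V \<sigma>. carries V \<sigma> (N i)) \<and> lifts (N i) (N (nx i)) \<and>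
    (\<forall>j \<in> I. (i, j) \<in> r \<longrightarrow> N i \<subseteq> N j) \<and> e ` E i \<subseteq> N i \<and>
    (\<forall>x \<in> N i. \<exists>\<xi> \<in> E i. \<forall>j \<in> I. (j, i) \<in> r \<longrightarrow> \<xi> \<in> E j \<longrightarrow> x \<in> N j)"
proof -
  have "\<forall>i \<in> I. \<exists>\<G>. (\<forall>K \<in> \<G>. closed K \<and> |K| <o kf i \<and> (\<exists>V \<sigma>. carries V \<sigma> K)) \<and>
      (\<forall>Z. Z \<subseteq> Arr J \<longrightarrow> |Z| <o kf i \<longrightarrow> (\<exists>K \<in> \<G>. Z \<subseteq> K)) \<and>
      (\<forall>K \<in> \<G>. \<forall>Z. Z \<subseteq> Arr J \<longrightarrow> |Z| <o kf i \<longrightarrow> (\<exists>N \<in> \<G>. Z \<subseteq> N \<and> K \<subseteq> N \<and> lifts K N))"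
    by (intro ballI good_family kf(1) filters)
  from bchoice[OF this] obtain \<G> where G: "\<forall>i \<in> I. (\<forall>K \<in> \<G> i. closed K \<and> |K| <o kf i \<and> (\<exists>V \<sigma>. carries V \<sigma> K)) \<and>
      (\<forall>Z. Z \<subseteq> Arr J \<longrightarrow> |Z| <o kf i \<longrightarrow> (\<exists>K \<in> \<G> i. Z \<subseteq> K)) \<and>
      (\<forall>K \<in> \<G> i. \<forall>Z. Z \<subseteq> Arr J \<longrightarrow> |Z| <o kf i \<longrightarrow> (\<exists>N \<in> \<G> i. Z \<subseteq> N \<and> K \<subseteq> N \<and> lifts K N))" ..
  have G1: "closed K" "|K| <o kf i" "\<exists>V \<sigma>. carries V \<sigma> K" if "i \<in> I" "K \<in> \<G> i" for i K
    using bspec[OF bspec[OF G that(1), THEN conjunct1] that(2)] by simp_all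
  have G2: "\<exists>K \<in> \<G> i. Z \<subseteq> K" if "i \<in> I" "Z \<subseteq> Arr J" "|Z| <o kf i" for i Z
    using bspec[OF G that(1), THEN conjunct2, THEN conjunct1] that(2,3) by simp
  have G3: "\<exists>N \<in> \<G> i. Z \<subseteq> N \<and> K \<subseteq> N \<and> lifts K N" if "i \<in> I" "K \<in> \<G> i" "Z \<subseteq> Arr J" "|Z| <o kf i" for i K Z
    using bspec[OF bspec[OF G that(1), THEN conjunct2, THEN conjunct2] that(2)] that(3,4) by simp
  \<comment> \<open>At each stage the enumeration of \<open>R i\<close> by \<open>E i\<close> feeds every earlier \<open>j\<close> the part of \<open>R i\<close>
    indexed by \<open>E j\<close>; this makes the final chain continuous where \<open>E\<close> is.\<close>
  define en where "en i R = (SOME g. g ` E i = R)" for i and R :: "'u set"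
  have en: "en i R ` E i = R" if "i \<in> I" "closed R" "|R| <o kf i" for i R
  proof -
    have "|R| \<le>o |E i|" using kf(2)[OF that(1)] that(3) by blast
    then have "\<exists>g. g ` E i = R" using card_of_ordLeq2[OF PB.closed_nonempty[OF that(2)]] by blast
    then show ?thesis unfolding en_def by (rule someI_ex)
  qed
  have small_image: "|g ` E i| <o kf i" if "i \<in> I" for i and g :: "'u \<Rightarrow> 'u"
    using kf(2)[OF that] card_of_image by blast
  \<comment> \<open>A state: for each \<open>i\<close> the current position \<open>K i\<close> with
    its structure \<open>V i\<close>, an approximation \<open>W i\<close> of the structure at the
    next index, and a closed set \<open>R i\<close> holding what the next position must
    absorb.\<close>
  define P where "P x \<longleftrightarrow> (case x of (K, V, \<sigma>, W, w, R) \<Rightarrow> \<forall>i \<in> I. K i \<in> \<G> i \<and> carries (V i) (\<sigma> i) (K i) \<and>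
      presentable (kf i) A (W i) \<and> w i \<in> hom A (W i) (V (nx i)) \<and> closed (R i) \<and> |R i| <o kf i \<and>
      K i \<subseteq> R i \<and> Comp B (\<sigma> (nx i)) (AMap F (w i)) \<preceq> s (R i) \<and> e ` E i \<subseteq> R i)" for x
  define Q where "Q x x' \<longleftrightarrow> (case (x, x') of ((K, V, \<sigma>, W, w, R), (K', V', \<sigma>', W', w', R')) \<Rightarrow>
      \<exists>f t. \<forall>i \<in> I. (\<forall>j \<in> I. (j, i) \<in> r \<longrightarrow> R j \<subseteq> K' i) \<and> (\<forall>j \<in> I. (i, j) \<in> r \<longrightarrow> en j (R j) ` E i \<subseteq> K' i) \<and>
        f i \<in> hom A (V i) (V' i) \<and> Comp B (\<sigma>' i) (AMap F (f i)) = \<sigma> i \<and>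
        t i \<in> hom A (W i) (W' i) \<and> Comp A (w' i) (t i) = Comp A (f (nx i)) (w i) \<and>
        s (R i) \<preceq> Comp B (\<sigma>' (nx i)) (AMap F (w' i)) \<and>
        (\<forall>Q x y. x \<in> hom B Q (OMap F (W i)) \<longrightarrow> y \<in> hom B Q (OMap F (W i)) \<longrightarrow>
          Comp B (Comp B (\<sigma> (nx i)) (AMap F (w i))) x = Comp B (Comp B (\<sigma> (nx i)) (AMap F (w i))) y \<longrightarrow>
          Comp B (AMap F (t i)) x = Comp B (AMap F (t i)) y))"
    for x x' :: "('u \<Rightarrow> 'u set) \<times> ('u \<Rightarrow> 'o) \<times> ('u \<Rightarrow> 'b) \<times> ('u \<Rightarrow> 'o) \<times> ('u \<Rightarrow> 'a) \<times> ('u \<Rightarrow> 'u set)"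
  have capture: "\<exists>R. closed R \<and> |R| <o kf i \<and> K \<subseteq> R \<and> Comp B \<sigma> (AMap F w) \<preceq> s R \<and> e ` E i \<subseteq> R"
    if i: "i \<in> I" and K: "K \<in> \<G> i" and V: "carries V \<sigma> N" and W: "presentable (kf i) A W" "w \<in> hom A W V" for i K V \<sigma> N W w
  proof -
    note k = adequateD[OF kf(1)[OF i]]
    have "Comp B \<sigma> (AMap F w) \<in> hom B (OMap F W) X" using amap_hom[OF W(2)] carriesD(2)[OF V] by (auto simp: hom_iff)
    moreover have "K \<union> e ` E i \<subseteq> Arr J" using PB.closedD(1)[OF G1(1)[OF i K]] e[OF i] by blast
    moreover have "|K \<union> e ` E i| <o kf i"
      by (rule Un_Cinfinite_bound_strict[OF G1(2)[OF i K] small_image[OF i] k(5)])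
    ultimately obtain R where "closed R" "K \<union> e ` E i \<subseteq> R" "|R| <o kf i" "Comp B \<sigma> (AMap F w) \<preceq> s R"
      using closed_capturing[OF kf(1)[OF i] presentable_image[OF k(2,4) W(1)]] by metis
    then show ?thesis by blast
  qed
  have "\<exists>x. \<forall>n :: nat. P (x n) \<and> Q (x n) (x (Suc n))"
  proof (rule dependent_nat_choice)
    have "\<forall>i \<in> I. \<exists>K V \<sigma>. K \<in> \<G> i \<and> carries V \<sigma> K"
    proof
      fix i assume i: "i \<in> I"
      have "|{} :: 'u set| <o kf i" by (rule finite_ordLess_Cinfinite[OF finite.emptyI adequateD(5)[OF kf(1)[OF i]]])
      then obtain K where "K \<in> \<G> i" using G2[OF i] by blast
      then show "\<exists>K V \<sigma>. K \<in> \<G> i \<and> carries V \<sigma> K" using G1(3)[OF i] by blast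
    qed
    then obtain K V \<sigma> where K: "\<forall>i \<in> I. K i \<in> \<G> i \<and> carries (V i) (\<sigma> i) (K i)" by metis
    have "\<forall>i \<in> I. \<exists>W w. presentable (kf i) A W \<and> w \<in> hom A W (V (nx i))"
      using ex_presentable_over[OF kf(1)] carriesD(1) K nx(1) by metis
    then obtain W w where W: "\<forall>i \<in> I. presentable (kf i) A (W i) \<and> w i \<in> hom A (W i) (V (nx i))" by metis
    have "\<forall>i \<in> I. \<exists>R. closed R \<and> |R| <o kf i \<and> K i \<subseteq> R \<and> Comp B (\<sigma> (nx i)) (AMap F (w i)) \<preceq> s R \<and> e ` E i \<subseteq> R"
      using capture K W nx(1) by blast
    then obtain R where "\<forall>i \<in> I. closed (R i) \<and> |R i| <o kf i \<and> K i \<subseteq> R i \<and>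
      Comp B (\<sigma> (nx i)) (AMap F (w i)) \<preceq> s (R i) \<and> e ` E i \<subseteq> R i" by metis
    then have "P (K, V, \<sigma>, W, w, R)" using K W unfolding P_def by simp
    then show "\<exists>x. P x" ..
  next
    fix x and n :: nat assume "P x"
    then obtain K V \<sigma> W w R where x: "x = (K, V, \<sigma>, W, w, R)" and K: "\<forall>i \<in> I. K i \<in> \<G> i \<and> carries (V i) (\<sigma> i) (K i)"
      and W: "\<forall>i \<in> I. presentable (kf i) A (W i) \<and> w i \<in> hom A (W i) (V (nx i))"
      and R: "\<forall>i \<in> I. closed (R i) \<and> |R i| <o kf i \<and> K i \<subseteq> R i \<and>
        Comp B (\<sigma> (nx i)) (AMap F (w i)) \<preceq> s (R i) \<and> e ` E i \<subseteq> R i"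
      by (cases x) (simp add: P_def)
    \<comment> \<open>The challenge at \<open>i\<close>: every \<open>R j\<close> with
      \<open>j\<close> up to \<open>i\<close>, and from each \<open>j\<close> beyond only the part
      enumerated by \<open>E i\<close>. The latter parts are small enough for \<open>i\<close>,
      although \<open>R j\<close> itself may not be.\<close>
    define Y where "Y i = (\<Union>j \<in> {j \<in> I. (j, i) \<in> r}. R j) \<union> (\<Union>j \<in> {j \<in> I. (i, j) \<in> r}. en j (R j) ` E i)" for i
    have Y: "Y i \<subseteq> Arr J" "|Y i| <o kf i" if i: "i \<in> I" for i
    proof -
      note k = adequateD[OF kf(1)[OF i]]
      have RJ: "R j \<subseteq> Arr J" if "j \<in> I" for j using PB.closedD(1) bspec[OF R that] by simp
      have "en j (R j) ` E i \<subseteq> Arr J" if j: "j \<in> I" "(i, j) \<in> r" for j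
      proof -
        have "en j (R j) ` E i \<subseteq> en j (R j) ` E j" by (rule image_mono[OF E[OF i j]])
        also have "\<dots> = R j" using en[OF j(1), of "R j"] bspec[OF R j(1)] by simp
        finally show ?thesis using RJ[OF j(1)] by simp
      qed
      then show "Y i \<subseteq> Arr J" unfolding Y_def using RJ by (intro Un_least UN_least) simp_all
      have "|{j \<in> I. (j, i) \<in> r}| <o kf i" "|{j \<in> I. (i, j) \<in> r}| <o kf i"
        by (rule subset_ordLess[OF kf(3)[OF i]]; blast)+
      moreover have "|R j| <o kf i" if "j \<in> {j \<in> I. (j, i) \<in> r}" for j
      proof -
        have j: "j \<in> I" "(j, i) \<in> r" using that by auto
        have "|R j| \<le>o |E j|" using kf(2)[OF j(1)] R j(1) by blast
        then have "|R j| \<le>o |E i|" using card_of_mono1[OF E[OF j(1) i j(2)]] ordLeq_transitive by blast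
        then show ?thesis using kf(2)[OF i] by blast
      qed
      ultimately show "|Y i| <o kf i" unfolding Y_def
        by (intro Un_Cinfinite_bound_strict[OF _ _ k(5)] stable_UNION[OF k(6)] small_image[OF i])
    qed
    have "\<forall>i \<in> I. \<exists>K' V' \<sigma>' f. K' \<in> \<G> i \<and> Y i \<subseteq> K' \<and> carries V' \<sigma>' K' \<and> f \<in> hom A (V i) V' \<and> Comp B \<sigma>' (AMap F f) = \<sigma> i"
    proof
      fix i assume i: "i \<in> I"
      then obtain K' where K': "K' \<in> \<G> i" "Y i \<subseteq> K'" "lifts (K i) K'" using G3[OF i _ Y[OF i]] K by blast
      have "carries (V i) (\<sigma> i) (K i)" using K i by blast
      from extend_carries[OF this K'(3)] obtain V' \<sigma>' f where "carries V' \<sigma>' K'" "f \<in> hom A (V i) V'"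
        "Comp B \<sigma>' (AMap F f) = \<sigma> i" by blast
      then show "\<exists>K' V' \<sigma>' f. K' \<in> \<G> i \<and> Y i \<subseteq> K' \<and> carries V' \<sigma>' K' \<and> f \<in> hom A (V i) V' \<and> Comp B \<sigma>' (AMap F f) = \<sigma> i"
        using K' by blast
    qed
    then obtain K' V' \<sigma>' f where K': "\<forall>i \<in> I. K' i \<in> \<G> i \<and> Y i \<subseteq> K' i \<and> carries (V' i) (\<sigma>' i) (K' i) \<and>
      f i \<in> hom A (V i) (V' i) \<and> Comp B (\<sigma>' i) (AMap F (f i)) = \<sigma> i" by metis
    define over where "over i W' w' t \<longleftrightarrow> presentable (kf i) A W' \<and> w' \<in> hom A W' (V' (nx i)) \<and> t \<in> hom A (W i) W' \<and>
        Comp A w' t = Comp A (f (nx i)) (w i) \<and> s (R i) \<preceq> Comp B (\<sigma>' (nx i)) (AMap F w') \<and>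
        (\<forall>Q x y. x \<in> hom B Q (OMap F (W i)) \<longrightarrow> y \<in> hom B Q (OMap F (W i)) \<longrightarrow>
          Comp B (Comp B (\<sigma> (nx i)) (AMap F (w i))) x = Comp B (Comp B (\<sigma> (nx i)) (AMap F (w i))) y \<longrightarrow>
          Comp B (AMap F t) x = Comp B (AMap F t) y)" for i W' w' t
    have "\<exists>W' w' t. over i W' w' t" if i: "i \<in> I" for i
    proof -
      note k = adequateD[OF kf(1)[OF i]] and n = nx[OF i]
      have V': "carries (V' (nx i)) (\<sigma>' (nx i)) (K' (nx i))" and f: "f (nx i) \<in> hom A (V (nx i)) (V' (nx i))"
        "Comp B (\<sigma>' (nx i)) (AMap F (f (nx i))) = \<sigma> (nx i)" using K' n by blast+
      note v' = carriesD[OF V']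
      have Wi: "presentable (kf i) A (W i)" "w i \<in> hom A (W i) (V (nx i))" using W i by blast+
      have Ri: "closed (R i)" "|R i| <o kf i" "Comp B (\<sigma> (nx i)) (AMap F (w i)) \<preceq> s (R i)" using R i by blast+
      \<comment> \<open>The structure at \<open>nx i\<close> has just been extended, so the old
        approximation is carried along that extension before it is enlarged.\<close>
      have fw: "Comp A (f (nx i)) (w i) \<in> hom A (W i) (V' (nx i))" using f(1) Wi(2) by (auto simp: hom_iff)
      have \<sigma>fw: "Comp B (\<sigma>' (nx i)) (AMap F (Comp A (f (nx i)) (w i))) = Comp B (\<sigma> (nx i)) (AMap F (w i))"
        using B.rewrite_left[OF f(2), of "AMap F (w i)"] amap_comp[OF Wi(2) f(1)] amap_hom[OF Wi(2)] amap_hom[OF f(1)] v'(2)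
        by (simp add: hom_iff)
      have "R i \<subseteq> Y (nx i)" unfolding Y_def using i n(2) by blast
      then have "R i \<subseteq> K' (nx i)" using K' n(1) by blast
      then have "s (R i) \<preceq> \<sigma>' (nx i)" using B.factors_trans[OF v'(7) PB.s_subset[OF Ri(1) v'(4)] v'(6)] by blast
      from interpolation[OF kf(1)[OF i] v'(1-3) Wi(1) fw PB.s_mono[OF Ri(1)] PB.s_presentable[OF Ri(1,2) k(2)] _ this, unfolded \<sigma>fw, OF Ri(3)]
      obtain W' w' t where "presentable (kf i) A W'" "w' \<in> hom A W' (V' (nx i))" "t \<in> hom A (W i) W'"
        "Comp A w' t = Comp A (f (nx i)) (w i)" "s (R i) \<preceq> Comp B (\<sigma>' (nx i)) (AMap F w')"
        "\<And>Q x y. x \<in> hom B Q (OMap F (W i)) \<Longrightarrow> y \<in> hom B Q (OMap F (W i)) \<Longrightarrow>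
          Comp B (Comp B (\<sigma> (nx i)) (AMap F (w i))) x = Comp B (Comp B (\<sigma> (nx i)) (AMap F (w i))) y \<Longrightarrow>
          Comp B (AMap F t) x = Comp B (AMap F t) y" by metis
      then show "\<exists>W' w' t. over i W' w' t" unfolding over_def by (intro exI conjI allI impI)
    qed
    then obtain W' w' t where "\<And>i. i \<in> I \<Longrightarrow> over i (W' i) (w' i) (t i)" by metis
    note W' = this[unfolded over_def]
    have "\<forall>i \<in> I. \<exists>R'. closed R' \<and> |R'| <o kf i \<and> K' i \<subseteq> R' \<and> Comp B (\<sigma>' (nx i)) (AMap F (w' i)) \<preceq> s R' \<and> e ` E i \<subseteq> R'"
      proof
      fix i assume i: "i \<in> I"
      show "\<exists>R'. closed R' \<and> |R'| <o kf i \<and> K' i \<subseteq> R' \<and> Comp B (\<sigma>' (nx i)) (AMap F (w' i)) \<preceq> s R' \<and> e ` E i \<subseteq> R'"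
        using capture[OF i, of "K' i"] bspec[OF K' i] bspec[OF K' nx(1)[OF i]] W'[OF i] by blast
    qed
    then obtain R' where R': "\<forall>i \<in> I. closed (R' i) \<and> |R' i| <o kf i \<and> K' i \<subseteq> R' i \<and>
      Comp B (\<sigma>' (nx i)) (AMap F (w' i)) \<preceq> s (R' i) \<and> e ` E i \<subseteq> R' i" by metis
    have YK: "(\<forall>j \<in> I. (j, i) \<in> r \<longrightarrow> R j \<subseteq> K' i) \<and> (\<forall>j \<in> I. (i, j) \<in> r \<longrightarrow> en j (R j) ` E i \<subseteq> K' i)" if "i \<in> I" for i
    proof -
      have "Y i \<subseteq> K' i" using K' that by blast
      then show ?thesis unfolding Y_def by blast
    qed
    have "P (K', V', \<sigma>', W', w', R')" unfolding P_def using K' W' R' by simp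
    moreover have "Q x (K', V', \<sigma>', W', w', R')" unfolding Q_def x prod.case
      by (rule exI[of _ f], rule exI[of _ t], rule ballI)
        (frule YK, frule bspec[OF K'], frule W', elim conjE, intro conjI; assumption)
    ultimately show "\<exists>y. P y \<and> Q x y" by blast
  qed
  then obtain x where x: "\<And>n. P (x n)" "\<And>n. Q (x n) (x (Suc n))" by blast
  define K V \<sigma> W w R where "K n = fst (x n)" and "V n = fst (snd (x n))" and "\<sigma> n = fst (snd (snd (x n)))"
    and "W n = fst (snd (snd (snd (x n))))" and "w n = fst (snd (snd (snd (snd (x n)))))"
    and "R n = snd (snd (snd (snd (snd (x n)))))" for n
  have x_eq: "x n = (K n, V n, \<sigma> n, W n, w n, R n)" for n
    by (simp add: K_def V_def \<sigma>_def W_def w_def R_def)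
  have st: "K n i \<in> \<G> i" "carries (V n i) (\<sigma> n i) (K n i)" "w n i \<in> hom A (W n i) (V n (nx i))" "closed (R n i)"
    "|R n i| <o kf i" "K n i \<subseteq> R n i" "Comp B (\<sigma> n (nx i)) (AMap F (w n i)) \<preceq> s (R n i)" "e ` E i \<subseteq> R n i"
    if "i \<in> I" for n i using x(1)[of n] that unfolding P_def x_eq prod.case by blast+
  define step where "step n f t \<longleftrightarrow> (\<forall>i \<in> I. (\<forall>j \<in> I. (j, i) \<in> r \<longrightarrow> R n j \<subseteq> K (Suc n) i) \<and>
        (\<forall>j \<in> I. (i, j) \<in> r \<longrightarrow> en j (R n j) ` E i \<subseteq> K (Suc n) i) \<and>
        f i \<in> hom A (V n i) (V (Suc n) i) \<and> Comp B (\<sigma> (Suc n) i) (AMap F (f i)) = \<sigma> n i \<and>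
        t i \<in> hom A (W n i) (W (Suc n) i) \<and> Comp A (w (Suc n) i) (t i) = Comp A (f (nx i)) (w n i) \<and>
        s (R n i) \<preceq> Comp B (\<sigma> (Suc n) (nx i)) (AMap F (w (Suc n) i)) \<and>
        (\<forall>Q x y. x \<in> hom B Q (OMap F (W n i)) \<longrightarrow> y \<in> hom B Q (OMap F (W n i)) \<longrightarrow>
          Comp B (Comp B (\<sigma> n (nx i)) (AMap F (w n i))) x = Comp B (Comp B (\<sigma> n (nx i)) (AMap F (w n i))) y \<longrightarrow>
          Comp B (AMap F (t i)) x = Comp B (AMap F (t i)) y))" for n f t
  have "\<exists>f t. step n f t" for n
    using x(2)[of n] unfolding Q_def x_eq prod.case step_def .
  then obtain f t where "\<And>n. step n (f n) (t n)" by metis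
  note ft = this[unfolded step_def, THEN bspec]
  have RK: "R n j \<subseteq> K (Suc n) i" if "i \<in> I" "j \<in> I" "(j, i) \<in> r" for n i j using ft[OF that(1), of n] that by simp
  have enK: "en j (R n j) ` E i \<subseteq> K (Suc n) i" if "i \<in> I" "j \<in> I" "(i, j) \<in> r" for n i j using ft[OF that(1), of n] that by simp
  have f: "f n i \<in> hom A (V n i) (V (Suc n) i)" "Comp B (\<sigma> (Suc n) i) (AMap F (f n i)) = \<sigma> n i" if "i \<in> I" for n i
    using ft[OF that, of n] by simp_all
  have t: "t n i \<in> hom A (W n i) (W (Suc n) i)" "Comp A (w (Suc n) i) (t n i) = Comp A (f n (nx i)) (w n i)"
    "s (R n i) \<preceq> Comp B (\<sigma> (Suc n) (nx i)) (AMap F (w (Suc n) i))" if "i \<in> I" for n i using ft[OF that, of n] by simp_all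
  have weak: "Comp B (AMap F (t n i)) x = Comp B (AMap F (t n i)) y" if "i \<in> I" "x \<in> hom B Q (OMap F (W n i))"
    "y \<in> hom B Q (OMap F (W n i))"
    "Comp B (Comp B (\<sigma> n (nx i)) (AMap F (w n i))) x = Comp B (Comp B (\<sigma> n (nx i)) (AMap F (w n i))) y" for n i Q x y
    using ft[OF that(1), of n] that(2-4) by blast
  \<comment> \<open>Each \<open>R n i\<close> lies between \<open>K n i\<close> and
    \<open>K (Suc n) i\<close>, the latter because \<open>i\<close> is among the indices up to
    \<open>i\<close>. A lift obtained for the \<open>R n i\<close> is thus one for the
    positions.\<close>
  have KR: "(\<Union>n. K n i) = (\<Union>n. R n i)" if "i \<in> I" for i
    using st(6)[OF that] RK[OF that that r[OF that]] by blast
  have Ksuc: "K n i \<subseteq> K (Suc n) i" and Rsuc: "R n i \<subseteq> R (Suc n) i" if "i \<in> I" for n i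
    using st(6)[OF that] RK[OF that that r[OF that]] by blast+
  show ?thesis
  proof (rule exI[of _ "\<lambda>i. \<Union>n. K n i"], intro ballI conjI impI)
    fix i assume i: "i \<in> I"
    have cl: "closed (K n i)" for n using G1(1)[OF i st(1)[OF i]] .
    show "closed (\<Union>n. K n i)" by (rule closed_Un_sequence[where K = "\<lambda>n. K n i", OF cl Ksuc[OF i]])
    show "\<exists>V \<sigma>. carries V \<sigma> (\<Union>n. K n i)"
      using sequence_of_carriers[of "\<lambda>n. V n i" "\<lambda>n. \<sigma> n i" "\<lambda>n. K n i" "\<lambda>n. f n i", OF st(2)[OF i] f[OF i] Ksuc[OF i]]
        sequence_colimitD(1) by blast
    have "lifts (\<Union>n. R n i) (\<Union>n. K n (nx i))"
      by (rule lifts_limit[of "\<lambda>n. V n (nx i)" "\<lambda>n. \<sigma> n (nx i)" "\<lambda>n. K n (nx i)" "\<lambda>n. f n (nx i)" "\<lambda>n. w n i" "\<lambda>n. W n i"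
          "\<lambda>n. t n i" "\<lambda>n. R n i", OF st(2)[OF nx(1)[OF i]] f[OF nx(1)[OF i]] Ksuc[OF nx(1)[OF i]] st(3)[OF i] t(1,2)[OF i]
          st(4)[OF i] Rsuc[OF i] st(7)[OF i] t(3)[OF i] weak[OF i]])
    then show "lifts (\<Union>n. K n i) (\<Union>n. K n (nx i))" using KR[OF i] by simp
    show "e ` E i \<subseteq> (\<Union>n. K n i)" unfolding KR[OF i] using st(8)[OF i, of 0] by blast
    show "(\<Union>n. K n i) \<subseteq> (\<Union>n. K n j)" if "j \<in> I" "(i, j) \<in> r" for j
      using st(6)[OF i] RK[OF that(1) i that(2)] by blast
    fix x assume "x \<in> (\<Union>n. K n i)"
    then obtain n where "x \<in> R n i" using st(6)[OF i] by blast
    then obtain \<xi> where \<xi>: "\<xi> \<in> E i" "x = en i (R n i) \<xi>" using en[OF i st(4,5)[OF i]] by blast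
    then have "x \<in> (\<Union>n. K n j)" if "j \<in> I" "(j, i) \<in> r" "\<xi> \<in> E j" for j
      using enK[OF that(1) i that(2), of n] that(3) by blast
    then show "\<exists>\<xi> \<in> E i. \<forall>j \<in> I. (j, i) \<in> r \<longrightarrow> \<xi> \<in> E j \<longrightarrow> x \<in> (\<Union>n. K n j)" using \<xi>(1) by blast
  qed
qed

end

section \<open>Transfinite composition and the theorem\<close>

context compactness_setting
begin

text \<open>The maps to \<open>X\<close> are already monic, so \<open>colimit_carries\<close>
  applies with the later index equal to the given one. The legs and their compatibility are kept
  because the recursion in \<open>transfinite_carries\<close> continues from them.\<close>

lemma limit_of_carriers:
  fixes S :: "'u set" and r :: "'u rel"
  assumes ne: "S \<noteq> {}"
    and r: "\<And>i. i \<in> S \<Longrightarrow> (i, i) \<in> r" "\<And>i j k. (i, j) \<in> r \<Longrightarrow> (j, k) \<in> r \<Longrightarrow> (i, k) \<in> r"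
      "\<And>i j. (i, j) \<in> r \<Longrightarrow> (j, i) \<in> r \<Longrightarrow> i = j" "\<And>i j. i \<in> S \<Longrightarrow> j \<in> S \<Longrightarrow> (i, j) \<in> r \<or> (j, i) \<in> r"
    and small: "|S| <o |UNIV :: 'u set|"
    and V: "\<And>i. i \<in> S \<Longrightarrow> carries (V i) (\<sigma> i) (N i)"
    and f: "\<And>i j. i \<in> S \<Longrightarrow> j \<in> S \<Longrightarrow> (j, i) \<in> r \<Longrightarrow> j \<noteq> i \<Longrightarrow> f i j \<in> hom A (V j) (V i)"
      "\<And>i j. i \<in> S \<Longrightarrow> j \<in> S \<Longrightarrow> (j, i) \<in> r \<Longrightarrow> j \<noteq> i \<Longrightarrow> Comp B (\<sigma> i) (AMap F (f i j)) = \<sigma> j"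
      "\<And>i j k. i \<in> S \<Longrightarrow> j \<in> S \<Longrightarrow> k \<in> S \<Longrightarrow> (j, i) \<in> r \<Longrightarrow> j \<noteq> i \<Longrightarrow> (k, j) \<in> r \<Longrightarrow> k \<noteq> j \<Longrightarrow>
        Comp A (f i j) (f j k) = f i k"
    and N: "\<And>i j. i \<in> S \<Longrightarrow> j \<in> S \<Longrightarrow> (i, j) \<in> r \<Longrightarrow> N i \<subseteq> N j"
  shows "\<exists>Q c \<tau>. carries Q \<tau> (\<Union>i \<in> S. N i) \<and> (\<forall>i \<in> S. c i \<in> hom A (V i) Q \<and> Comp B \<tau> (AMap F (c i)) = \<sigma> i \<and>
    (\<forall>j \<in> S. (j, i) \<in> r \<longrightarrow> j \<noteq> i \<longrightarrow> Comp A (c i) (f i j) = c j))"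
proof -
  note v = carriesD[OF V]
  define t where "t j i = (if j = i then Id A (V i) else f i j)" for j i
  have t: "t j i \<in> hom A (V j) (V i)" "Comp B (\<sigma> i) (AMap F (t j i)) = \<sigma> j" if "i \<in> S" "j \<in> S" "(j, i) \<in> r" for i j
  proof -
    show "t j i \<in> hom A (V j) (V i)" using f(1)[OF that] A.id_hom[OF v(1)[OF that(1)]] by (simp add: t_def)
    show "Comp B (\<sigma> i) (AMap F (t j i)) = \<sigma> j"
      using f(2)[OF that] amap_id[OF v(1)[OF that(1)]] v(7,8)[OF that(1)] by (simp add: t_def)
  qed
  have tid: "t i i = Id A (V i)" for i by (simp add: t_def)
  have "directed_system TYPE('u) S (\<lambda>j i. (j, i) \<in> r) A V t"
  proof unfold_locales
    show "inaccessible_type TYPE('u)" by (rule PB.inacc)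
    fix i j assume ij: "i \<in> S" "j \<in> S"
    show "\<exists>k \<in> S. (i, k) \<in> r \<and> (j, k) \<in> r" using r(4)[OF ij] r(1)[OF ij(1)] r(1)[OF ij(2)] ij by blast
  next
    fix i j k assume ijk: "i \<in> S" "j \<in> S" "k \<in> S" "(i, j) \<in> r" "(j, k) \<in> r"
    note ik = r(2)[OF ijk(4,5)]
    show "Comp A (t j k) (t i j) = t i k"
    proof (cases "i = j \<or> j = k")
      case True
      then show ?thesis
      proof
        assume "i = j"
        then show ?thesis using t(1)[OF ijk(3,2,5)] v(1)[OF ijk(2)] tid[of j] by (simp add: hom_iff)
      next
        assume "j = k"
        then show ?thesis using t(1)[OF ijk(2,1,4)] v(1)[OF ijk(2)] tid[of k] by (simp add: hom_iff)
      qed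
    next
      case False
      then have "i \<noteq> k" using r(3) ijk(4,5) by blast
      then show ?thesis using f(3)[OF ijk(3,2,1,5) _ ijk(4)] False by (simp add: t_def)
    qed
  next
    fix i assume "i \<in> S"
    then show "t i i = Id A (V i)" by (simp add: t_def)
  qed (fact ne small r(1) r(2) r(3) v(1) t(1) | (rule r(2), assumption, assumption) | (rule r(3), assumption, assumption)
      | (rule t(1), assumption+))+
  then interpret S: directed_system "TYPE('u)" S "\<lambda>j i. (j, i) \<in> r" A V t .
  obtain Q c where col: "system_colimit A S (\<lambda>j i. (j, i) \<in> r) V t Q c" using S.colimit_exists[OF filtered_colimits] by blast
  have cl: "closed (\<Union>i \<in> S. N i)"
  proof (rule PB.closed_Union)
    fix M M' assume "M \<in> N ` S" "M' \<in> N ` S"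
    then obtain i j where ij: "i \<in> S" "j \<in> S" "M = N i" "M' = N j" by blast
    then show "\<exists>K \<in> N ` S. M \<union> M' \<subseteq> K" using r(4)[OF ij(1,2)] N[OF ij(1,2)] N[OF ij(2,1)] by blast
  qed (use ne v(4) in auto)
  have "\<exists>\<tau>. carries Q \<tau> (\<Union>i \<in> S. N i) \<and> (\<forall>i \<in> S. Comp B \<tau> (AMap F (c i)) = \<sigma> i)"
  proof (rule colimit_carries[where \<omega> = \<sigma> and K = "\<Union>i \<in> S. N i", OF S.directed_system_axioms col])
    fix i assume i: "i \<in> S"
    show "\<sigma> i \<in> hom B (OMap F (V i)) X" by (rule v(2)[OF i])
    show "Comp B (\<sigma> j) (AMap F (t i j)) = \<sigma> i" if "j \<in> S" "(i, j) \<in> r" for j by (rule t(2)[OF that(1) i that(2)])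
    show "\<exists>j \<in> S. (i, j) \<in> r \<and> (\<forall>Q. \<forall>x \<in> hom B Q (OMap F (V i)). \<forall>y \<in> hom B Q (OMap F (V i)).
      Comp B (\<sigma> i) x = Comp B (\<sigma> i) y \<longrightarrow> Comp B (AMap F (t i j)) x = Comp B (AMap F (t i j)) y)"
    proof (rule bexI[OF _ i], intro conjI allI ballI impI)
      fix Q x y assume "x \<in> hom B Q (OMap F (V i))" "y \<in> hom B Q (OMap F (V i))" "Comp B (\<sigma> i) x = Comp B (\<sigma> i) y"
      then have "x = y" using B.mono_cancel[OF v(3)[OF i]] v(8)[OF i] by metis
      then show "Comp B (AMap F (t i i)) x = Comp B (AMap F (t i i)) y" by simp
    qed (rule r(1)[OF i])
    show "\<sigma> i \<preceq> s (\<Union>i \<in> S. N i)"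
      using B.factors_trans[OF _ v(5)[OF i] PB.s_subset[OF v(4)[OF i] cl]] cl i by auto
  next
    fix n assume "n \<in> Dom J ` (\<Union>i \<in> S. N i)"
    then obtain i where i: "i \<in> S" "n \<in> Dom J ` N i" by blast
    then have "\<iota> n \<preceq> \<sigma> i" using B.factors_trans[OF v(7) leg_factors[OF v(4)] v(6)] by blast
    then show "\<exists>i \<in> S. \<iota> n \<preceq> \<sigma> i" using i(1) by blast
  qed (use cl in blast)+
  then obtain \<tau> where \<tau>: "carries Q \<tau> (\<Union>i \<in> S. N i)" "\<forall>i \<in> S. Comp B \<tau> (AMap F (c i)) = \<sigma> i" by blast
  have "Comp A (c i) (f i j) = c j" if "i \<in> S" "j \<in> S" "(j, i) \<in> r" "j \<noteq> i" for i j
    using S.sys_natural[OF col that(2,1,3)] that(4) by (simp add: t_def)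
  then show ?thesis using \<tau> S.sys_leg[OF col] by blast
qed

text \<open>Structures on the \<open>N i\<close> are chosen by well-founded recursion together with
  the maps from all earlier ones. Coherence of these maps belongs to the induction, as a colimit at
  a limit index requires a functor; at a successor the new maps are composites through the extension
  from the predecessor.\<close>

lemma transfinite_carries:
  fixes I :: "'u set" and r :: "'u rel"
  assumes ne: "I \<noteq> {}" and wf: "wf (r - Relation.Id)"
    and r: "\<And>i. i \<in> I \<Longrightarrow> (i, i) \<in> r" "\<And>i j k. (i, j) \<in> r \<Longrightarrow> (j, k) \<in> r \<Longrightarrow> (i, k) \<in> r"
      "\<And>i j. (i, j) \<in> r \<Longrightarrow> (j, i) \<in> r \<Longrightarrow> i = j" "\<And>i j. i \<in> I \<Longrightarrow> j \<in> I \<Longrightarrow> (i, j) \<in> r \<or> (j, i) \<in> r"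
    and small: "|I| <o |UNIV :: 'u set|"
    and nx: "\<And>i. i \<in> I \<Longrightarrow> nx i \<in> I" "\<And>i. i \<in> I \<Longrightarrow> (i, nx i) \<in> r" "\<And>i. i \<in> I \<Longrightarrow> nx i \<noteq> i"
      "\<And>i j. i \<in> I \<Longrightarrow> j \<in> I \<Longrightarrow> (i, j) \<in> r \<Longrightarrow> i \<noteq> j \<Longrightarrow> (nx i, j) \<in> r"
    and N: "\<And>i. i \<in> I \<Longrightarrow> \<exists>V \<sigma>. carries V \<sigma> (N i)" "\<And>i. i \<in> I \<Longrightarrow> lifts (N i) (N (nx i))"
      "\<And>i j. i \<in> I \<Longrightarrow> j \<in> I \<Longrightarrow> (i, j) \<in> r \<Longrightarrow> N i \<subseteq> N j"
    and limit: "\<And>i. i \<in> I \<Longrightarrow> \<exists>j \<in> I. (j, i) \<in> r \<and> j \<noteq> i \<Longrightarrow>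
      \<forall>j \<in> I. (j, i) \<in> r \<and> j \<noteq> i \<longrightarrow> (\<exists>k \<in> I. (j, k) \<in> r \<and> j \<noteq> k \<and> (k, i) \<in> r \<and> k \<noteq> i) \<Longrightarrow>
      N i \<subseteq> (\<Union>j \<in> {j \<in> I. (j, i) \<in> r \<and> j \<noteq> i}. N j)"
  shows "\<exists>V \<sigma>. carries V \<sigma> (\<Union>i \<in> I. N i)"
proof -
  \<comment> \<open>A value is a triple: a structure, the maps into it from the earlier structures,
    and its map to \<open>X\<close>. Outside \<open>I\<close> nothing is required.\<close>
  define P where "P h i x \<longleftrightarrow> (i \<in> I \<longrightarrow> (case x of (V, f, \<sigma>) \<Rightarrow> carries V \<sigma> (N i) \<and>
    (\<forall>j \<in> I. (j, i) \<in> r - Relation.Id \<longrightarrow> f j \<in> hom A (fst (h j)) V \<and> Comp B \<sigma> (AMap F (f j)) = snd (snd (h j)) \<and>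
      (\<forall>k \<in> I. (k, j) \<in> r - Relation.Id \<longrightarrow> Comp A (f j) (fst (snd (h j)) k) = f k))))"
    for h :: "'u \<Rightarrow> 'o \<times> ('u \<Rightarrow> 'a) \<times> 'b" and i x
  have "\<exists>h. \<forall>i. P h i (h i)"
  proof (rule dependent_wf_choice[OF wf])
    fix h h' :: "'u \<Rightarrow> 'o \<times> ('u \<Rightarrow> 'a) \<times> 'b" and i x
    assume "\<And>z. (z, i) \<in> r - Relation.Id \<Longrightarrow> h z = h' z"
    then show "P h i x = P h' i x" unfolding P_def by (auto split: prod.splits)
  next
    fix i and h :: "'u \<Rightarrow> 'o \<times> ('u \<Rightarrow> 'a) \<times> 'b"
    assume IH: "\<And>y. (y, i) \<in> r - Relation.Id \<Longrightarrow> P h y (h y)"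
    define V f \<sigma> where "V j = fst (h j)" and "f j = fst (snd (h j))" and "\<sigma> j = snd (snd (h j))" for j
    have h: "h j = (V j, f j, \<sigma> j)" for j by (simp add: V_def f_def \<sigma>_def)
    have Ph: "carries (V j) (\<sigma> j) (N j)"
      "\<And>k. k \<in> I \<Longrightarrow> (k, j) \<in> r \<Longrightarrow> k \<noteq> j \<Longrightarrow> f j k \<in> hom A (V k) (V j)"
      "\<And>k. k \<in> I \<Longrightarrow> (k, j) \<in> r \<Longrightarrow> k \<noteq> j \<Longrightarrow> Comp B (\<sigma> j) (AMap F (f j k)) = \<sigma> k"
      "\<And>k l. k \<in> I \<Longrightarrow> (k, j) \<in> r \<Longrightarrow> k \<noteq> j \<Longrightarrow> l \<in> I \<Longrightarrow> (l, k) \<in> r \<Longrightarrow> l \<noteq> k \<Longrightarrow> Comp A (f j k) (f k l) = f j l"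
      if "j \<in> I" "(j, i) \<in> r" "j \<noteq> i" for j
      using IH[of j] that unfolding P_def h by auto
    have Pi: "P h i (W, g, \<tau>)" if "carries W \<tau> (N i)"
      "\<And>j. j \<in> I \<Longrightarrow> (j, i) \<in> r \<Longrightarrow> j \<noteq> i \<Longrightarrow> g j \<in> hom A (V j) W"
      "\<And>j. j \<in> I \<Longrightarrow> (j, i) \<in> r \<Longrightarrow> j \<noteq> i \<Longrightarrow> Comp B \<tau> (AMap F (g j)) = \<sigma> j"
      "\<And>j k. j \<in> I \<Longrightarrow> (j, i) \<in> r \<Longrightarrow> j \<noteq> i \<Longrightarrow> k \<in> I \<Longrightarrow> (k, j) \<in> r \<Longrightarrow> k \<noteq> j \<Longrightarrow> Comp A (g j) (f j k) = g k" for W g \<tau>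
      using that unfolding P_def h by auto
    show "\<exists>x. P h i x"
    proof (cases "i \<in> I")
      case False then show ?thesis by (simp add: P_def)
    next
      case i: True
      consider "\<not> (\<exists>j \<in> I. (j, i) \<in> r \<and> j \<noteq> i)"
        | b where "b \<in> I" "(b, i) \<in> r" "b \<noteq> i" "\<And>j. j \<in> I \<Longrightarrow> (j, i) \<in> r \<Longrightarrow> j \<noteq> i \<Longrightarrow> (j, b) \<in> r"
        | "\<exists>j \<in> I. (j, i) \<in> r \<and> j \<noteq> i"
          "\<forall>j \<in> I. (j, i) \<in> r \<and> j \<noteq> i \<longrightarrow> (\<exists>k \<in> I. (j, k) \<in> r \<and> j \<noteq> k \<and> (k, i) \<in> r \<and> k \<noteq> i)"
        using r(4) r(1) by metis
      then show ?thesis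
      proof cases
        case 1
        obtain W \<tau> where "carries W \<tau> (N i)" using N(1)[OF i] by blast
        then show ?thesis using 1 by (intro exI[of _ "(W, undefined, \<tau>)"] Pi) auto
      next
        case (2 b)
        \<comment> \<open>\<open>b\<close> is the last index before \<open>i\<close>, so the
          successor of \<open>b\<close> cannot lie strictly before \<open>i\<close>.\<close>
        have "nx b = i"
        proof (rule ccontr)
          assume "nx b \<noteq> i"
          then have "(nx b, b) \<in> r" using 2(4)[OF nx(1)[OF 2(1)] nx(4)[OF 2(1) i 2(2,3)]] by simp
          then show False using r(3)[OF nx(2)[OF 2(1)]] nx(3)[OF 2(1)] by simp
        qed
        then have "lifts (N b) (N i)" using N(2)[OF 2(1)] by simp
        from extend_carries[OF Ph(1)[OF 2(1-3)] this] obtain W \<tau> g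
          where W: "carries W \<tau> (N i)" "g \<in> hom A (V b) W" "Comp B \<tau> (AMap F g) = \<sigma> b" by blast
        note w = carriesD[OF W(1)]
        have bj: "j = b \<or> (j, b) \<in> r \<and> j \<noteq> b" if "j \<in> I" "(j, i) \<in> r" "j \<noteq> i" for j using 2(4)[OF that] by blast
        have "P h i (W, \<lambda>j. if j = b then g else Comp A g (f b j), \<tau>)"
        proof (rule Pi[OF W(1)])
          fix j assume j: "j \<in> I" "(j, i) \<in> r" "j \<noteq> i"
          show "(if j = b then g else Comp A g (f b j)) \<in> hom A (V j) W"
            using bj[OF j] W(2) A.comp_hom[OF Ph(2)[OF 2(1-3) j(1)] W(2)] by auto
          show "Comp B \<tau> (AMap F (if j = b then g else Comp A g (f b j))) = \<sigma> j"
          proof (cases "j = b")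
            case False
            then have jb: "(j, b) \<in> r" "j \<noteq> b" using bj[OF j] by auto
            note fb = Ph(2,3)[OF 2(1-3) j(1) jb]
            have "Comp B \<tau> (AMap F (Comp A g (f b j))) = Comp B (\<sigma> b) (AMap F (f b j))"
              using B.rewrite_left[OF W(3), of "AMap F (f b j)"] amap_comp[OF fb(1) W(2)] amap_hom[OF fb(1)]
                amap_hom[OF W(2)] w(2) by (simp add: hom_iff)
            then show ?thesis using fb(2) jb(2) by simp
          qed (use W(3) in simp)
          fix k assume k: "k \<in> I" "(k, j) \<in> r" "k \<noteq> j"
          show "Comp A (if j = b then g else Comp A g (f b j)) (f j k) = (if k = b then g else Comp A g (f b k))"
          proof (cases "j = b")
            case True then show ?thesis using k(3) by simp
          next
            case False
            then have jb: "(j, b) \<in> r" "j \<noteq> b" using bj[OF j] by auto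
            then have kb: "k \<noteq> b" using r(3) k(2) by blast
            note fb = Ph(2)[OF 2(1-3) j(1) jb] and fk = Ph(2)[OF j k]
            show ?thesis using Ph(4)[OF 2(1-3) j(1) jb k] A.comp_assoc[OF fk fb W(2)] jb(2) kb by simp
          qed
        qed
        then show ?thesis by blast
      next
        case 3
        let ?S = "{j \<in> I. (j, i) \<in> r \<and> j \<noteq> i}"
        have U: "(\<Union>j \<in> ?S. N j) = N i" using limit[OF i 3] N(3)[OF _ i] by blast
        have "\<exists>Q c \<tau>. carries Q \<tau> (\<Union>i \<in> ?S. N i) \<and> (\<forall>i \<in> ?S. c i \<in> hom A (V i) Q \<and> Comp B \<tau> (AMap F (c i)) = \<sigma> i \<and>
            (\<forall>j \<in> ?S. (j, i) \<in> r \<longrightarrow> j \<noteq> i \<longrightarrow> Comp A (c i) (f i j) = c j))"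
        proof (rule limit_of_carriers)
          show "?S \<noteq> {}" using 3(1) by blast
          show "|?S| <o |UNIV :: 'u set|" by (rule subset_ordLess[OF small]) blast
          show "(k, k) \<in> r" if "k \<in> ?S" for k using r(1) that by blast
          show "(j, k) \<in> r \<or> (k, j) \<in> r" if "j \<in> ?S" "k \<in> ?S" for j k using r(4) that by blast
          show "carries (V j) (\<sigma> j) (N j)" if "j \<in> ?S" for j using Ph(1) that by blast
          show "N j \<subseteq> N k" if "j \<in> ?S" "k \<in> ?S" "(j, k) \<in> r" for j k using N(3) that by blast
          show "(j, l) \<in> r" if "(j, k) \<in> r" "(k, l) \<in> r" for j k l by (rule r(2)[OF that])
          show "j = k" if "(j, k) \<in> r" "(k, j) \<in> r" for j k by (rule r(3)[OF that])
          show "f k j \<in> hom A (V j) (V k)" "Comp B (\<sigma> k) (AMap F (f k j)) = \<sigma> j"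
            if "k \<in> ?S" "j \<in> ?S" "(j, k) \<in> r" "j \<noteq> k" for k j using Ph(2,3)[of k j] that by simp_all
          show "Comp A (f k j) (f j l) = f k l"
            if "k \<in> ?S" "j \<in> ?S" "l \<in> ?S" "(j, k) \<in> r" "j \<noteq> k" "(l, j) \<in> r" "l \<noteq> j" for k j l
            using Ph(4)[of k j l] that by simp
        qed
        then obtain Q c \<tau> where Q: "carries Q \<tau> (N i)" "\<forall>i \<in> ?S. c i \<in> hom A (V i) Q \<and> Comp B \<tau> (AMap F (c i)) = \<sigma> i \<and>
            (\<forall>j \<in> ?S. (j, i) \<in> r \<longrightarrow> j \<noteq> i \<longrightarrow> Comp A (c i) (f i j) = c j)" unfolding U by blast
        have "P h i (Q, c, \<tau>)"
        proof (rule Pi[OF Q(1)])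
          fix j assume j: "j \<in> I" "(j, i) \<in> r" "j \<noteq> i"
          show "c j \<in> hom A (V j) Q" "Comp B \<tau> (AMap F (c j)) = \<sigma> j" using Q(2) j by blast+
          fix k assume k: "k \<in> I" "(k, j) \<in> r" "k \<noteq> j"
          have "(k, i) \<in> r" "k \<noteq> i" using r(2)[OF k(2) j(2)] r(3)[OF j(2)] k(2,3) by auto
          then show "Comp A (c j) (f j k) = c k" using Q(2) j k by blast
        qed
        then show ?thesis by blast
      qed
    qed
  qed
  then obtain h where hP: "\<And>i. P h i (h i)" by blast
  define V f \<sigma> where "V j = fst (h j)" and "f j = fst (snd (h j))" and "\<sigma> j = snd (snd (h j))" for j
  have h: "h j = (V j, f j, \<sigma> j)" for j by (simp add: V_def f_def \<sigma>_def)
  have Ph: "carries (V j) (\<sigma> j) (N j)"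
    "\<And>k. k \<in> I \<Longrightarrow> (k, j) \<in> r \<Longrightarrow> k \<noteq> j \<Longrightarrow> f j k \<in> hom A (V k) (V j)"
    "\<And>k. k \<in> I \<Longrightarrow> (k, j) \<in> r \<Longrightarrow> k \<noteq> j \<Longrightarrow> Comp B (\<sigma> j) (AMap F (f j k)) = \<sigma> k"
    "\<And>k l. k \<in> I \<Longrightarrow> (k, j) \<in> r \<Longrightarrow> k \<noteq> j \<Longrightarrow> l \<in> I \<Longrightarrow> (l, k) \<in> r \<Longrightarrow> l \<noteq> k \<Longrightarrow> Comp A (f j k) (f k l) = f j l"
    if "j \<in> I" for j
    using hP[of j] that unfolding P_def h by auto
  have "\<exists>Q c \<tau>. carries Q \<tau> (\<Union>i \<in> I. N i) \<and> (\<forall>i \<in> I. c i \<in> hom A (V i) Q \<and> Comp B \<tau> (AMap F (c i)) = \<sigma> i \<and>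
      (\<forall>j \<in> I. (j, i) \<in> r \<longrightarrow> j \<noteq> i \<longrightarrow> Comp A (c i) (f i j) = c j))"
    by (rule limit_of_carriers[OF ne r small Ph(1-3) _ N(3)]) (use Ph(4) in blast)+
  then show ?thesis by blast
qed

text \<open>\<open>s K\<close> has a right inverse, hence so has \<open>\<sigma>\<close>, and a
  monomorphism with a right inverse is an isomorphism.\<close>

lemma in_image_if_carries:
  assumes V: "carries V \<sigma> K" and X: "Id B X \<preceq> s K"
  shows "in_image A B F X"
proof -
  note v = carriesD[OF V]
  have XB: "X \<in> Obj B" by (rule PB.tip)
  have "Id B X \<preceq> \<sigma>" by (rule B.factors_trans[OF v(7) X v(6)])
  then obtain k where k: "k \<in> hom B X (OMap F V)" "Comp B \<sigma> k = Id B X" using XB v(8) by (auto simp: B.factors_def)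
  have "Comp B k \<sigma> = Id B (OMap F V)"
  proof (rule B.mono_cancel[OF v(3)])
    show "Comp B \<sigma> (Comp B k \<sigma>) = Comp B \<sigma> (Id B (OMap F V))"
      using B.rewrite_left[OF k(2), of \<sigma>] k(1) v(7-9) by (simp add: hom_iff)
  qed (use k(1) v(7-9) omap_obj[OF v(1)] in \<open>auto simp: hom_iff\<close>)
  then have "isomorphism B k" unfolding isomorphism_def using k v(2) by (auto simp: hom_iff)
  then show ?thesis unfolding in_image_def isomorphic_def using k(1) v(1) by blast
qed

end

section \<open>Cardinals below a singular cardinal\<close>

lemma ordLess_underS:
  assumes "Card_order r" "|Y| <o r" obtains a where "a \<in> Field r" "|Y| \<le>o |underS r a|"
proof -
  have w: "Well_order r" using assms(1) by (simp add: card_order_on_def)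
  then obtain a where a: "a \<in> Field r" "|Y| =o Restr r (underS r a)"
    using ordLess_iff_ordIso_Restr[OF w card_of_Well_order] assms(2) by blast
  have "|Y| =o |Field (Restr r (underS r a))|" using card_of_cong[OF a(2)] by (simp add: Field_card_of)
  moreover have "Field (Restr r (underS r a)) \<subseteq> underS r a" by (auto simp: Field_def)
  ultimately show ?thesis using that[OF a(1)] ordIso_ordLeq_trans card_of_mono1 by blast
qed

text \<open>The successor of the cardinality of \<open>S\<close> is at most \<open>\<nu>\<close>,
  and strictly less because it is regular and \<open>\<nu>\<close> is not. \<open>cardSuc\<close>
  lives on sets of elements of \<open>'u\<close>; a copy on a subset of \<open>Field \<nu>\<close>
  has the right type.\<close>

lemma ex_successor_cardinal:
  fixes \<nu> :: "'u rel" and S :: "'u set"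
  assumes \<nu>: "Cinfinite \<nu>" "\<not> regularCard \<nu>" and S: "|S| <o \<nu>" "infinite S" and small: "\<nu> <o |UNIV :: 'u set|"
  obtains k :: "'u rel" where "regular_cardinal k" "k <o \<nu>" "\<And>Y :: 'u set. |Y| <o k \<longleftrightarrow> |Y| \<le>o |S|"
proof -
  let ?c = "cardSuc |S|"
  have inf: "Cinfinite |S|" using S(2) by (simp add: cinfinite_def Field_card_of card_of_card_order_on)
  have c: "Card_order ?c" "Cinfinite ?c" "regularCard ?c"
    using cardSuc_Card_order[OF card_of_Card_order] Cinfinite_cardSuc[OF inf] regularCard_cardSuc[OF inf] .
  have le: "?c \<le>o \<nu>" using cardSuc_ordLess_ordLeq[OF card_of_Card_order, of \<nu>] \<nu>(1) S(1) by blast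
  then have "|Field ?c| \<le>o \<nu>" using ordIso_ordLeq_trans[OF card_of_Field_ordIso[OF c(1)]] by blast
  then obtain T where T: "T \<subseteq> Field \<nu>" "|Field ?c| =o |T|" "|T| \<le>o \<nu>"
    using internalize_card_of_ordLeq[of "Field ?c" \<nu>] by blast
  have iso: "?c =o |T|" using ordIso_transitive[OF ordIso_symmetric[OF card_of_Field_ordIso[OF c(1)]] T(2)] .
  have "Cinfinite |T|" "regularCard |T|" using Cinfinite_cong[OF iso c(2)] regularCard_ordIso[OF iso c(2,3)] .
  moreover have "|T| <o \<nu>"
  proof -
    have "\<not> |T| =o \<nu>" using regularCard_ordIso[of "|T|" \<nu>] calculation \<nu>(2) by blast
    then show ?thesis using T(3) ordLeq_iff_ordLess_or_ordIso by blast
  qed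
  moreover have "|Y| <o |T| \<longleftrightarrow> |Y| \<le>o |S|" for Y :: "'u set"
    using cardSuc_ordLeq_ordLess[of "|S|" "|Y|"] card_of_Card_order ordLess_ordIso_trans[OF _ iso]
      ordLess_ordIso_trans[OF _ ordIso_symmetric[OF iso]] by blast
  ultimately show ?thesis using that[of "|T|"] ordLess_transitive[OF _ small] by (auto simp: regular_cardinal_def)
qed

theorem theorem1p6:
  fixes A :: "('o, 'a) cat" and B :: "('p, 'b) cat" and F :: "('o, 'a, 'p, 'b) func"
    and X :: 'p and \<mu> \<nu> :: "'u rel"
  assumes "inaccessible_type TYPE('u)"
    and "accessible TYPE('u) A" and "has_filtered_colimits TYPE('u) A"
    and "finitely_accessible TYPE('u) B"
    and "is_functor A B F" and "preserves_filtered_colimits TYPE('u) A B F"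
    and "X \<in> Obj B"
    and "is_rank_of_accessibility A B F \<mu>"
    and "is_size B X \<nu>"
    and "\<mu> <o \<nu>" and "cat_card (fp TYPE('u) B) <o \<nu>"
    and "singular_cardinal \<nu>"
    and "\<exists>\<phi> :: 'u rel. Card_order \<phi> \<and> \<phi> <o \<nu> \<and>
           (\<forall>\<kappa> :: 'u rel. regular_cardinal \<kappa> \<and> \<phi> <o \<kappa> \<and> \<kappa> <o \<nu> \<longrightarrow>
              image_contains_dense_filter \<kappa> A B F X)"
    and "structures_extend_along_morphisms A B F"
  shows "in_image A B F X"
proof -
  interpret F: is_functor A B F by fact
  interpret fa: finitely_accessible_category B "TYPE('u)" by unfold_locales (fact assms(1,4))+
  have \<mu>: "Card_order \<mu>" "accessible_at \<mu> A" "\<And>\<theta> :: 'u rel. \<And>U. regular_cardinal \<theta> \<Longrightarrow> \<mu> \<le>o \<theta> \<Longrightarrow>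
      presentable \<theta> A U \<Longrightarrow> presentable \<theta> B (OMap F U)"
    using assms(8) unfolding is_rank_of_accessibility_def least_cardinal_def by blast+
  obtain \<rho> :: "'u rel" where \<rho>: "presentable \<rho> B X" "\<rho> =o cardSuc \<nu>"
    using assms(9) unfolding is_size_def is_rank_def least_cardinal_def by blast
  have \<nu>: "Cinfinite \<nu>" "\<not> regularCard \<nu>" "Card_order \<nu>" using assms(12) by (auto simp: singular_cardinal_def)
  have reg\<rho>: "regular_cardinal \<rho>" using \<rho>(1) by (simp add: presentable_def)
  have \<nu>\<rho>: "\<nu> <o \<rho>" using cardSuc_greater[OF \<nu>(3)] \<rho>(2) ordIso_symmetric ordLess_ordIso_trans by blast
  have small: "\<nu> <o |UNIV :: 'u set|" using ordLess_transitive[OF \<nu>\<rho>] regular_cardinalD(4)[OF reg\<rho>] by blast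
  obtain J :: "('u, 'u) cat" and D \<iota> extra where "pure_presentation J B D X \<iota> extra"
    and extra: "\<And>l \<kappa>. Cinfinite (\<kappa> :: 'u rel) \<Longrightarrow> |Arr (fp TYPE('u) B)| <o \<kappa> \<Longrightarrow> |extra l| <o \<kappa>"
    using fa.ex_pure_presentation[OF assms(7)] by metis
  then interpret PB: pure_presentation J B D X \<iota> extra by simp
  interpret compactness_setting A B F J D X \<iota> extra \<mu>
    by unfold_locales (use assms \<mu> in auto)
  let ?fp = "cat_card (fp TYPE('u) B)"
  have adequate: "adequate \<kappa>" if "regular_cardinal \<kappa>" "?fp <o \<kappa>" "\<mu> \<le>o \<kappa>" for \<kappa> :: "'u rel"
  proof -
    have "|Arr (fp TYPE('u) B)| \<le>o ?fp" "natLeq \<le>o ?fp"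
      unfolding cat_card_def by (simp_all add: ordLeq_csum1 ordLeq_csum2 card_of_Card_order natLeq_Card_order)
    then have "|Arr (fp TYPE('u) B)| <o \<kappa>" "natLeq <o \<kappa>" using that(2) ordLeq_ordLess_trans by blast+
    then show ?thesis using that extra regular_cardinalD(1)[OF that(1)] by (simp add: adequate_def PB.ample_def)
  qed
  have "adequate \<rho>"
    using ordLess_transitive[OF assms(11) \<nu>\<rho>] ordLess_imp_ordLeq[OF ordLess_transitive[OF assms(10) \<nu>\<rho>]] reg\<rho> by (intro adequate)
  \<comment> \<open>As \<open>X\<close> is \<open>\<rho>\<close>-presentable and
    \<open>\<rho>\<close> is the successor of \<open>\<nu>\<close>, its identity factors through a
    subobject given by at most \<open>\<nu>\<close> arrows. These are the arrows that the chain has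
    to exhaust.\<close>
  then obtain M where M: "closed M" "|M| <o \<rho>" "F.B.factors (Id B X) (s M)"
    using PB.presentable_factors[OF adequateD(1) \<rho>(1) F.B.id_hom[OF assms(7)]] by blast
  have "|M| \<le>o \<nu>" using ordLess_ordIso_trans[OF M(2) \<rho>(2)] cardSuc_ordLeq_ordLess[OF \<nu>(3) card_of_Card_order] by blast
  then have "|M| \<le>o |Field \<nu>|" using ordLeq_ordIso_trans[OF _ ordIso_symmetric[OF card_of_Field_ordIso[OF \<nu>(3)]]] by blast
  then have "\<exists>e. e ` Field \<nu> = M" by (rule iffD2[OF card_of_ordLeq2[OF PB.closed_nonempty[OF M(1)]]])
  then obtain e where e: "e ` Field \<nu> = M" ..
  obtain \<phi> :: "'u rel" where \<phi>: "Card_order \<phi>" "\<phi> <o \<nu>" "\<And>\<kappa> :: 'u rel. regular_cardinal \<kappa> \<Longrightarrow> \<phi> <o \<kappa> \<Longrightarrow> \<kappa> <o \<nu> \<Longrightarrow>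
      image_contains_dense_filter \<kappa> A B F X"
    using assms(13) by blast
  have wo: "well_order_on (Field \<nu>) \<nu>" using \<nu>(3) by (simp add: card_order_on_def)
  then have "wf (\<nu> - Relation.Id)" "Refl \<nu>" "trans \<nu>" "antisym \<nu>" "Total \<nu>"
    by (auto simp: well_order_on_def linear_order_on_def partial_order_on_def preorder_on_def)
  note w = this
  have ord: "(i, i) \<in> \<nu>" if "i \<in> Field \<nu>" for i using w(2) that by (auto simp: refl_on_def)
  have ord: "wf (\<nu> - Relation.Id)" "\<And>i. i \<in> Field \<nu> \<Longrightarrow> (i, i) \<in> \<nu>" "\<And>i j k. (i, j) \<in> \<nu> \<Longrightarrow> (j, k) \<in> \<nu> \<Longrightarrow> (i, k) \<in> \<nu>"
    "\<And>i j. (i, j) \<in> \<nu> \<Longrightarrow> (j, i) \<in> \<nu> \<Longrightarrow> i = j"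
    "\<And>i j. i \<in> Field \<nu> \<Longrightarrow> j \<in> Field \<nu> \<Longrightarrow> (i, j) \<in> \<nu> \<or> (j, i) \<in> \<nu>"
  proof -
    show "wf (\<nu> - Relation.Id)" by (rule w(1))
    show "(i, k) \<in> \<nu>" if "(i, j) \<in> \<nu>" "(j, k) \<in> \<nu>" for i j k using w(3) that by (rule transD)
    show "i = j" if "(i, j) \<in> \<nu>" "(j, i) \<in> \<nu>" for i j using w(4) that by (rule antisymD)
    show "(i, j) \<in> \<nu> \<or> (j, i) \<in> \<nu>" if "i \<in> Field \<nu>" "j \<in> Field \<nu>" for i j
      using w(5) that ord by (cases "i = j") (auto simp: total_on_def)
  qed (rule ord)
  obtain C where C: "C \<subseteq> Field \<nu>" "cofinal C \<nu>" "|C| <o \<nu>"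
  proof -
    obtain C where C: "C \<subseteq> Field \<nu>" "cofinal C \<nu>" "\<not> |C| =o \<nu>" using \<nu>(2) by (auto simp: regularCard_def)
    have "|C| \<le>o \<nu>" using ordLeq_ordIso_trans[OF card_of_mono1[OF C(1)] card_of_Field_ordIso[OF \<nu>(3)]] .
    then show ?thesis using that C ordLeq_iff_ordLess_or_ordIso by blast
  qed
  \<comment> \<open>A set at least as large as each cardinal that the games must exceed: the length
    of a cofinal set, \<open>\<phi>\<close>, \<open>\<mu>\<close> and the size of \<open>fp\<close>.
    It is smaller than \<open>\<nu>\<close>, so some initial segment \<open>underS \<nu> a0\<close>
    dominates it; this segment is put into every \<open>E i\<close>.\<close>
  define Y where "Y = C <+> (Field \<phi> <+> (Field \<mu> <+> Field ?fp))"
  have fp_card: "Card_order ?fp" by (simp add: cat_card_def Card_order_csum)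
  have field_less: "|Field q| <o \<nu>" if "Card_order q" "q <o \<nu>" for q :: "'z rel"
    using ordIso_ordLess_trans[OF card_of_Field_ordIso[OF that(1)] that(2)] .
  have fp_less: "|Field ?fp| <o \<nu>" using ordIso_ordLess_trans[OF card_of_Field_ordIso[OF fp_card] assms(11)] .
  have "|Y| <o \<nu>" unfolding Y_def
    using \<nu>(1) C(3) field_less[OF \<phi>(1,2)] field_less[OF \<mu>(1) assms(10)] fp_less
    by (intro card_of_Plus_ordLess_infinite_Field) (auto simp: cinfinite_def)
  then obtain a0 where a0: "a0 \<in> Field \<nu>" "|Y| \<le>o |underS \<nu> a0|" by (rule ordLess_underS[OF \<nu>(3)])
  have Yle: "|C| \<le>o |Y|" "\<phi> \<le>o |Y|" "\<mu> \<le>o |Y|" "?fp \<le>o |Y|"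
  proof -
    note p1 = card_of_Plus1 and p2 = card_of_Plus2 and tr = ordLeq_transitive
    show "|C| \<le>o |Y|" unfolding Y_def by (rule p1)
    have "|Field \<phi>| \<le>o |Y|" "|Field \<mu>| \<le>o |Y|" "|Field ?fp| \<le>o |Y|" unfolding Y_def
      by (rule tr[OF p1 p2], rule tr[OF tr[OF p1 p2] p2], rule tr[OF tr[OF p2 p2] p2])
    then show "\<phi> \<le>o |Y|" "\<mu> \<le>o |Y|" "?fp \<le>o |Y|"
      using ordIso_ordLeq_trans[OF ordIso_symmetric[OF card_of_Field_ordIso]] \<phi>(1) \<mu>(1) fp_card by blast+
  qed
  \<comment> \<open>Still cofinal, and for each index \<open>i\<close> smaller than the cardinal
    \<open>kf i\<close> of its game by the choice of \<open>Y\<close>.\<close>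
  define I where "I = {a \<in> C. (a0, a) \<in> \<nu> \<and> a \<noteq> a0}"
  have IF: "i \<in> Field \<nu>" if "i \<in> I" for i using that C(1) by (auto simp: I_def)
  have cof: "\<exists>b \<in> I. (a, b) \<in> \<nu> \<and> b \<noteq> a" if a: "a \<in> Field \<nu>" "(a0, a) \<in> \<nu>" for a
  proof -
    obtain b where b: "b \<in> C" "a \<noteq> b" "(a, b) \<in> \<nu>" using C(2) a(1) unfolding cofinal_def by blast
    then have "b \<in> I" using ord(3)[OF a(2) b(3)] ord(4) a(2) by (auto simp: I_def)
    then show ?thesis using b by blast
  qed
  have cofI: "\<exists>b \<in> I. (a, b) \<in> \<nu> \<and> b \<noteq> a" if "a \<in> I" for a using cof[OF IF[OF that]] that by (simp add: I_def)
  have cofF: "\<exists>b \<in> I. (a, b) \<in> \<nu> \<and> b \<noteq> a" if a: "a \<in> Field \<nu>" for a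
  proof (cases "(a0, a) \<in> \<nu>")
    case False
    then have "(a, a0) \<in> \<nu>" using ord(5)[OF a a0(1)] by blast
    moreover obtain b where "b \<in> I" "(a0, b) \<in> \<nu>" "b \<noteq> a0" using cof[OF a0(1) ord(2)[OF a0(1)]] by blast
    ultimately show ?thesis using ord(3,4) by blast
  qed (rule cof[OF a])
  have "\<exists>n. n \<in> I \<and> (i, n) \<in> \<nu> \<and> n \<noteq> i \<and> (\<forall>j \<in> I. (i, j) \<in> \<nu> \<and> i \<noteq> j \<longrightarrow> (n, j) \<in> \<nu>)" if i: "i \<in> I" for i
  proof -
    obtain b where "b \<in> {j \<in> I. (i, j) \<in> \<nu> \<and> j \<noteq> i}" using cofI[OF i] by blast
    then have "\<exists>n \<in> {j \<in> I. (i, j) \<in> \<nu> \<and> j \<noteq> i}. \<forall>y. (y, n) \<in> \<nu> - Relation.Id \<longrightarrow> y \<notin> {j \<in> I. (i, j) \<in> \<nu> \<and> j \<noteq> i}"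
      by (rule wfE_min[OF ord(1)]) blast
    then obtain n where n: "n \<in> I" "(i, n) \<in> \<nu>" "n \<noteq> i" "\<forall>y. (y, n) \<in> \<nu> - Relation.Id \<longrightarrow> y \<notin> {j \<in> I. (i, j) \<in> \<nu> \<and> j \<noteq> i}" by blast
    have "(n, j) \<in> \<nu>" if "j \<in> I" "(i, j) \<in> \<nu>" "i \<noteq> j" for j
      using n(4) ord(5)[OF IF[OF n(1)] IF[OF that(1)]] that by blast
    then show ?thesis using n by blast
  qed
  then obtain nx where nx: "\<And>i. i \<in> I \<Longrightarrow> nx i \<in> I" "\<And>i. i \<in> I \<Longrightarrow> (i, nx i) \<in> \<nu>" "\<And>i. i \<in> I \<Longrightarrow> nx i \<noteq> i"
    "\<And>i j. i \<in> I \<Longrightarrow> j \<in> I \<Longrightarrow> (i, j) \<in> \<nu> \<Longrightarrow> i \<noteq> j \<Longrightarrow> (nx i, j) \<in> \<nu>" by metis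
  \<comment> \<open>Not simply \<open>underS \<nu> i\<close>: \<open>C\<close> need not be closed in \<open>\<nu>\<close>, and \<open>E\<close> has to be continuous on \<open>I\<close>.\<close>
  define E where "E i = underS \<nu> a0 \<union> (\<Union>b \<in> {b \<in> I. (b, i) \<in> \<nu> \<and> b \<noteq> i}. underS \<nu> b)" for i
  have Esub: "E i \<subseteq> underS \<nu> i" if "i \<in> I" for i
  proof -
    have "underS \<nu> b \<subseteq> underS \<nu> i" if "(b, i) \<in> \<nu>" for b
      using that ord(3,4) unfolding underS_def by blast
    then show ?thesis using that unfolding E_def I_def by blast
  qed
  have Emono: "E i \<subseteq> E j" if "i \<in> I" "j \<in> I" "(i, j) \<in> \<nu>" for i j
    using ord(3,4) that unfolding E_def by blast
  have YE: "|Y| \<le>o |E i|" for i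
    using ordLeq_transitive[OF a0(2) card_of_mono1[of "underS \<nu> a0" "E i"]] by (auto simp: E_def)
  have Eless: "|E i| <o \<nu>" if "i \<in> I" for i
    using subset_ordLess[OF card_of_underS[OF \<nu>(3) IF[OF that]] Esub[OF that]] .
  have Einf: "infinite (E i)" for i
  proof -
    have "natLeq \<le>o ?fp" unfolding cat_card_def by (simp add: ordLeq_csum2 natLeq_Card_order)
    then have "natLeq \<le>o |E i|" using ordLeq_transitive[OF ordLeq_transitive[OF _ Yle(4)] YE] by blast
    then show ?thesis using infinite_iff_natLeq_ordLeq[of "E i"] by blast
  qed
  have "\<forall>i \<in> I. \<exists>k :: 'u rel. regular_cardinal k \<and> k <o \<nu> \<and> (\<forall>Y :: 'u set. |Y| <o k \<longleftrightarrow> |Y| \<le>o |E i| )"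
  proof
    fix i assume i: "i \<in> I"
    show "\<exists>k :: 'u rel. regular_cardinal k \<and> k <o \<nu> \<and> (\<forall>Y :: 'u set. |Y| <o k \<longleftrightarrow> |Y| \<le>o |E i| )"
      by (rule ex_successor_cardinal[OF \<nu>(1,2) Eless[OF i] Einf small], intro exI conjI allI)
  qed
  from bchoice[OF this] obtain kf :: "'u \<Rightarrow> 'u rel" where kfs: "\<forall>i \<in> I. regular_cardinal (kf i) \<and> kf i <o \<nu> \<and>
    (\<forall>Y :: 'u set. |Y| <o kf i \<longleftrightarrow> |Y| \<le>o |E i| )" ..
  have kf: "regular_cardinal (kf i)" "kf i <o \<nu>" "|Y| <o kf i \<longleftrightarrow> |Y| \<le>o |E i|" if "i \<in> I" for i and Y :: "'u set"
    using bspec[OF kfs that] by simp_all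
  have Ekf: "|E i| <o kf i" if "i \<in> I" for i using kf(3)[OF that, of "E i"] ordLeq_refl[OF card_of_Card_order] by blast
  have Ykf: "|Y| <o kf i" if "i \<in> I" for i using ordLeq_ordLess_trans[OF YE Ekf[OF that]] .
  have "\<exists>N. \<forall>i \<in> I. closed (N i) \<and> (\<exists>V \<sigma>. carries V \<sigma> (N i)) \<and> lifts (N i) (N (nx i)) \<and>
    (\<forall>j \<in> I. (i, j) \<in> \<nu> \<longrightarrow> N i \<subseteq> N j) \<and> e ` E i \<subseteq> N i \<and>
    (\<forall>x \<in> N i. \<exists>\<xi> \<in> E i. \<forall>j \<in> I. (j, i) \<in> \<nu> \<longrightarrow> \<xi> \<in> E j \<longrightarrow> x \<in> N j)"
  proof (rule singular_stages[of I nx \<nu> kf E e])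
    fix i assume i: "i \<in> I"
    show "adequate (kf i)"
      using ordLeq_ordLess_trans[OF Yle(4) Ykf[OF i]] ordLess_imp_ordLeq[OF ordLeq_ordLess_trans[OF Yle(3) Ykf[OF i]]]
      by (rule adequate[OF kf(1)[OF i]])
    show "|I| <o kf i"
      using ordLeq_ordLess_trans[OF ordLeq_transitive[OF card_of_mono1 Yle(1)] Ykf[OF i]] by (auto simp: I_def)
    show "image_contains_dense_filter (kf i) A B F X"
      by (rule \<phi>(3)[OF kf(1)[OF i] ordLeq_ordLess_trans[OF Yle(2) Ykf[OF i]] kf(2)[OF i]])
    show "(i, i) \<in> \<nu>" by (rule ord(2)[OF IF[OF i]])
    have "E i \<subseteq> Field \<nu>" using Esub[OF i] by (auto simp: underS_def Field_def)
    then show "e ` E i \<subseteq> Arr J" using e PB.closedD(1)[OF M(1)] by blast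
    show "nx i \<in> I" "(i, nx i) \<in> \<nu>" by (rule nx(1,2)[OF i])+
    show "|Y| <o kf i \<longleftrightarrow> |Y| \<le>o |E i|" for Y :: "'u set" by (rule kf(3)[OF i])
    show "E i \<subseteq> E j" if "j \<in> I" "(i, j) \<in> \<nu>" for j by (rule Emono[OF i that])
  qed
  then obtain N where NN: "\<forall>i \<in> I. closed (N i) \<and> (\<exists>V \<sigma>. carries V \<sigma> (N i)) \<and> lifts (N i) (N (nx i)) \<and>
    (\<forall>j \<in> I. (i, j) \<in> \<nu> \<longrightarrow> N i \<subseteq> N j) \<and> e ` E i \<subseteq> N i \<and>
    (\<forall>x \<in> N i. \<exists>\<xi> \<in> E i. \<forall>j \<in> I. (j, i) \<in> \<nu> \<longrightarrow> \<xi> \<in> E j \<longrightarrow> x \<in> N j)" ..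
  have N: "\<exists>V \<sigma>. carries V \<sigma> (N i)" "lifts (N i) (N (nx i))" "e ` E i \<subseteq> N i"
    "\<And>j. j \<in> I \<Longrightarrow> (i, j) \<in> \<nu> \<Longrightarrow> N i \<subseteq> N j"
    "\<And>x. x \<in> N i \<Longrightarrow> \<exists>\<xi> \<in> E i. \<forall>j \<in> I. (j, i) \<in> \<nu> \<longrightarrow> \<xi> \<in> E j \<longrightarrow> x \<in> N j" if "i \<in> I" for i
    using bspec[OF NN that] by simp_all
  have "\<exists>V \<sigma>. carries V \<sigma> (\<Union>i \<in> I. N i)"
  proof (rule transfinite_carries[of I \<nu> nx N])
    show "I \<noteq> {}" using cofF[OF a0(1)] by blast
    show "|I| <o |UNIV :: 'u set|"
      using subset_ordLess[OF ordLess_transitive[OF C(3) small], of I] by (auto simp: I_def)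
    fix i assume i: "i \<in> I" and pre: "\<exists>j \<in> I. (j, i) \<in> \<nu> \<and> j \<noteq> i"
      and lim: "\<forall>j \<in> I. (j, i) \<in> \<nu> \<and> j \<noteq> i \<longrightarrow> (\<exists>k \<in> I. (j, k) \<in> \<nu> \<and> j \<noteq> k \<and> (k, i) \<in> \<nu> \<and> k \<noteq> i)"
    show "N i \<subseteq> (\<Union>j \<in> {j \<in> I. (j, i) \<in> \<nu> \<and> j \<noteq> i}. N j)"
    proof
      fix x assume "x \<in> N i"
      then obtain \<xi> where \<xi>: "\<xi> \<in> E i" "\<forall>j \<in> I. (j, i) \<in> \<nu> \<longrightarrow> \<xi> \<in> E j \<longrightarrow> x \<in> N j" using N(5)[OF i] by blast
      \<comment> \<open>The segment below \<open>a0\<close> lies in every \<open>E j\<close>. Any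
        other element enters \<open>E i\<close> through some \<open>b\<close> before
        \<open>i\<close>; at a limit there is a \<open>k\<close> strictly between, and
        \<open>E k\<close> already has the element.\<close>
      have "\<exists>j \<in> I. (j, i) \<in> \<nu> \<and> j \<noteq> i \<and> \<xi> \<in> E j"
      proof (cases "\<xi> \<in> underS \<nu> a0")
        case True then show ?thesis using pre by (auto simp: E_def)
      next
        case False
        then obtain b where b: "b \<in> I" "(b, i) \<in> \<nu>" "b \<noteq> i" "\<xi> \<in> underS \<nu> b" using \<xi>(1) by (auto simp: E_def)
        then obtain k where k: "k \<in> I" "(b, k) \<in> \<nu>" "b \<noteq> k" "(k, i) \<in> \<nu>" "k \<noteq> i" using lim by blast
        then have "\<xi> \<in> E k" using b by (auto simp: E_def)
        then show ?thesis using k by blast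
      qed
      then show "x \<in> (\<Union>j \<in> {j \<in> I. (j, i) \<in> \<nu> \<and> j \<noteq> i}. N j)" using \<xi>(2) by blast
    qed
  qed (fact ord(1) | (rule ord(2)[OF IF], assumption) | (rule ord(3), assumption, assumption) | (rule ord(4), assumption, assumption)
      | (rule ord(5)[OF IF IF], assumption, assumption) | (rule nx; assumption) | (rule N; assumption))+
  then obtain V \<sigma> where V: "carries V \<sigma> (\<Union>i \<in> I. N i)" by blast
  have "M \<subseteq> (\<Union>i \<in> I. N i)"
  proof
    fix x assume "x \<in> M"
    then obtain a where a: "a \<in> Field \<nu>" "x = e a" using e by blast
    obtain b where b: "b \<in> I" "(a, b) \<in> \<nu>" "b \<noteq> a" using cofF[OF a(1)] by blast
    \<comment> \<open>\<open>E k\<close> contains only segments below indices strictly before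
      \<open>k\<close>, so one index beyond \<open>b\<close> is taken.\<close>
    obtain k where k: "k \<in> I" "(b, k) \<in> \<nu>" "k \<noteq> b" using cofI[OF b(1)] by blast
    have "a \<in> E k" using a b k by (auto simp: E_def underS_def)
    then show "x \<in> (\<Union>i \<in> I. N i)" using N(3)[OF k(1)] k(1) a(2) by blast
  qed
  then have "F.B.factors (s M) (s (\<Union>i \<in> I. N i))" by (intro PB.s_subset M(1) carriesD(4)[OF V])
  then have "F.B.factors (Id B X) (s (\<Union>i \<in> I. N i))" using F.B.factors_trans[OF _ M(3)] carriesD(4)[OF V] by simp
  then show ?thesis by (rule in_image_if_carries[OF V])
qed

end
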